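(* Swap Bribery for $k$-approval (with $k$ part of the input), restricted to instances with only one vote, is W[1]-hard when parameterized by $k$.
   Context: Elections. An election consists of a set $C=\{c_1,\dots,c_m\}$ of candidates and votes $V=\{v_1,\dots,v_n\}$; each vote is a strict linear order over $C$, and $\mathrm{rank}(c,v)$ is the position of $c$ in $v$ (position $1$ is best). In $k$-approval, a candidate $c$ receives one point from $v$ if $\mathrm{rank}(c,v)\le k$ and zero points otherwise; the winners are all candidates with the highest total number of points (ties are allowed, so there may be several winners). Swaps. A swap in a vote $v$ is a triple $(v,a,b)$ with $a,b\in C$, $a\ne b$. It is admissible in $v$ if $\mathrm{rank}(a,v)=\mathrm{rank}(b,v)-1$; applying it exchanges the positions of $a$ and $b$ in $v$. A set $\Gamma$ of swaps is admissible in $v$ if its elements can be applied to $v$ one after the other in some order, each being admissible in the vote obtained so far; the resulting vote is $v^{\Gamma}$. This extends vote by vote to several votes, the resulting votes being denoted $V^{\Gamma}$. Swap Bribery for an election system $\mathcal{E}$: given an $\mathcal{E}$-election $(C,V)$, a preferred candidate $p\in C$, a cost function assigning to each possible swap in each vote a non-negative integer, and a budget $\beta\in\mathbb{N}$, decide whether there is an admissible set $\Gamma$ of swaps of total cost at most $\beta$ such that $p$ is a winner in the $\mathcal{E}$-election $(C,V^{\Gamma})$. W[1]-hardness is with respect to parameterized reductions: $(I,\kappa)$ is mapped in time $f(\kappa)\cdot|I|^{O(1)}$, $f$ computable, to an equivalent instance $(I',\kappa')$ with $\kappa'$ depending only on $\kappa$. *)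

theory Defs
  imports Main
begin

section \<open>Machine model\<close>

text \<open>
  Time is measured on the WHILE language over binary trees (N. D. Jones, Computability and
  Complexity from a Programming Perspective), which is polynomially equivalent to multitape
  Turing machines. Each elementary command costs one step. Trees can share subtrees, so a
  program could build a tree that is exponentially larger than its number of steps; producing
  an output is therefore charged with the size of the output in addition.
\<close>

datatype tree = Leaf | Node tree tree

fun tsize :: "tree \<Rightarrow> nat" where
  "tsize Leaf = 1"
| "tsize (Node l r) = Suc (tsize l + tsize r)"

datatype expr = Var nat | Nil_Ex | Cons_Ex expr expr | Hd expr | Tl expr

fun expr_val :: "expr \<Rightarrow> (nat \<Rightarrow> tree) \<Rightarrow> tree" where
  "expr_val (Var x) s = s x"
| "expr_val Nil_Ex s = Leaf"
| "expr_val (Cons_Ex d e) s = Node (expr_val d s) (expr_val e s)"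
| "expr_val (Hd e) s = (case expr_val e s of Leaf \<Rightarrow> Leaf | Node l r \<Rightarrow> l)"
| "expr_val (Tl e) s = (case expr_val e s of Leaf \<Rightarrow> Leaf | Node l r \<Rightarrow> r)"

datatype com = Assign nat expr | Seq com com | If expr com com | While expr com

inductive exec :: "com \<Rightarrow> (nat \<Rightarrow> tree) \<Rightarrow> nat \<Rightarrow> (nat \<Rightarrow> tree) \<Rightarrow> bool" where
  Assign: "exec (Assign x e) s 1 (s(x := expr_val e s))"
| Seq: "exec c s t s' \<Longrightarrow> exec d s' u s'' \<Longrightarrow> exec (Seq c d) s (t + u) s''"
| IfTrue: "expr_val e s \<noteq> Leaf \<Longrightarrow> exec c s t s' \<Longrightarrow> exec (If e c d) s (Suc t) s'"
| IfFalse: "expr_val e s = Leaf \<Longrightarrow> exec d s t s' \<Longrightarrow> exec (If e c d) s (Suc t) s'"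
| WhileFalse: "expr_val e s = Leaf \<Longrightarrow> exec (While e c) s 1 s"
| WhileTrue: "expr_val e s \<noteq> Leaf \<Longrightarrow> exec c s t s' \<Longrightarrow> exec (While e c) s' u s'' \<Longrightarrow>
    exec (While e c) s (Suc (t + u)) s''"

text \<open>Variable 0 holds the input and the output; all other variables are initially \<open>Leaf\<close>.\<close>

definition computes_in :: "com \<Rightarrow> tree \<Rightarrow> tree \<Rightarrow> nat \<Rightarrow> bool" where
  "computes_in c x y t \<longleftrightarrow>
    (\<exists>u s. exec c ((\<lambda>_. Leaf)(0 := x)) u s \<and> s 0 = y \<and> t = u + tsize y)"


section \<open>Encodings\<close>

text \<open>Numbers are encoded in binary, least significant bit first, without leading zeros.\<close>

definition enc_bit :: "bool \<Rightarrow> tree" where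
  "enc_bit b = (if b then Node Leaf Leaf else Leaf)"

fun enc_nat :: "nat \<Rightarrow> tree" where
  "enc_nat n = (if n = 0 then Leaf else Node (enc_bit (odd n)) (enc_nat (n div 2)))"

declare enc_nat.simps [simp del]

fun enc_list :: "('a \<Rightarrow> tree) \<Rightarrow> 'a list \<Rightarrow> tree" where
  "enc_list enc [] = Leaf"
| "enc_list enc (x # xs) = Node (enc x) (enc_list enc xs)"


section \<open>Parameterized problems and reductions\<close>

text \<open>
  A problem consists of its instances (paired with the parameter) and its yes-instances.
  Reductions are only required to behave correctly on instances, and must produce instances.
  A decision problem given as a language is the case \<open>insts P = UNIV\<close>.
\<close>

record problem =
  insts :: "(tree \<times> nat) set"
  yes_insts :: "(tree \<times> nat) set"

definition enc_inst :: "tree \<Rightarrow> nat \<Rightarrow> tree" where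
  "enc_inst x k = Node x (enc_nat k)"

definition computable :: "(nat \<Rightarrow> nat) \<Rightarrow> bool" where
  "computable f \<longleftrightarrow> (\<exists>c. \<forall>n. \<exists>t. computes_in c (enc_nat n) (enc_nat (f n)) t)"

definition fpt_reducible :: "problem \<Rightarrow> problem \<Rightarrow> bool" (infix "\<le>fpt" 50) where
  "P \<le>fpt Q \<longleftrightarrow>
    (\<exists>c f g d. computable f \<and> computable g \<and>
      (\<forall>x k. (x, k) \<in> insts P \<longrightarrow>
        (\<exists>y t. computes_in c (enc_inst x k) (enc_inst y (g k)) t \<and>
               t \<le> f k * tsize (enc_inst x k) ^ d \<and>
               (y, g k) \<in> insts Q \<and>
               ((x, k) \<in> yes_insts P \<longleftrightarrow> (y, g k) \<in> yes_insts Q))))"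


section \<open>The W-hierarchy\<close>

text \<open>
  A circuit is a list of gates in topological order: the arguments of the gate at position
  \<open>j\<close> are positions smaller than \<open>j\<close>, and the last gate is the output. An input vector is
  given by the set of positions of the input gates that are set to true.
\<close>

datatype gate = InputG | NotG nat | AndG "nat list" | OrG "nat list"

fun wires :: "gate \<Rightarrow> nat list" where
  "wires InputG = []"
| "wires (NotG i) = [i]"
| "wires (AndG is) = is"
| "wires (OrG is) = is"

definition is_circuit :: "gate list \<Rightarrow> bool" where
  "is_circuit C \<longleftrightarrow> C \<noteq> [] \<and> (\<forall>j < length C. \<forall>i \<in> set (wires (C ! j)). i < j)"

definition inputs :: "gate list \<Rightarrow> nat set" where
  "inputs C = {j. j < length C \<and> C ! j = InputG}"

text \<open>
  In the next three functions the guards \<open>i < j\<close> serve termination only; they always hold in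
  a circuit.
\<close>

fun gate_val :: "gate list \<Rightarrow> nat set \<Rightarrow> nat \<Rightarrow> bool" where
  "gate_val C S j =
    (case C ! j of
       InputG \<Rightarrow> j \<in> S
     | NotG i \<Rightarrow> i < j \<longrightarrow> \<not> gate_val C S i
     | AndG is \<Rightarrow> (\<forall>i \<in> {i \<in> set is. i < j}. gate_val C S i)
     | OrG is \<Rightarrow> (\<exists>i \<in> {i \<in> set is. i < j}. gate_val C S i))"

fun gate_depth :: "gate list \<Rightarrow> nat \<Rightarrow> nat" where
  "gate_depth C j =
    (if C ! j = InputG then 0
     else Suc (Max (insert 0 (gate_depth C ` {i \<in> set (wires (C ! j)). i < j}))))"

text \<open>A gate is large if its fan-in exceeds two.\<close>

fun gate_weft :: "gate list \<Rightarrow> nat \<Rightarrow> nat" where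
  "gate_weft C j =
    (if length (wires (C ! j)) > 2 then 1 else 0) +
    Max (insert 0 (gate_weft C ` {i \<in> set (wires (C ! j)). i < j}))"

declare gate_val.simps [simp del] gate_depth.simps [simp del] gate_weft.simps [simp del]

definition circuit_out :: "gate list \<Rightarrow> nat" where
  "circuit_out C = length C - 1"

fun enc_gate :: "gate \<Rightarrow> tree" where
  "enc_gate InputG = Node (enc_nat 0) Leaf"
| "enc_gate (NotG i) = Node (enc_nat 1) (enc_nat i)"
| "enc_gate (AndG is) = Node (enc_nat 2) (enc_list enc_nat is)"
| "enc_gate (OrG is) = Node (enc_nat 3) (enc_list enc_nat is)"

definition circuits :: "nat \<Rightarrow> nat \<Rightarrow> gate list set" where
  "circuits t h = {C. is_circuit C \<and> gate_weft C (circuit_out C) \<le> t \<and>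
                      gate_depth C (circuit_out C) \<le> h}"

text \<open>Weighted circuit satisfiability for circuits of weft at most \<open>t\<close> and depth at most \<open>h\<close>.\<close>

definition weighted_circuit_sat :: "nat \<Rightarrow> nat \<Rightarrow> problem" where
  "weighted_circuit_sat t h =
    \<lparr>insts = {(enc_list enc_gate C, k) | C k. C \<in> circuits t h},
     yes_insts = {(enc_list enc_gate C, k) | C k. C \<in> circuits t h \<and>
       (\<exists>S \<subseteq> inputs C. card S = k \<and> gate_val C S (circuit_out C))}\<rparr>"

definition W_class :: "nat \<Rightarrow> problem set" where
  "W_class t = {P. \<exists>h. P \<le>fpt weighted_circuit_sat t h}"

definition W1_hard :: "problem \<Rightarrow> bool" where
  "W1_hard Q \<longleftrightarrow> (\<forall>P \<in> W_class 1. P \<le>fpt Q)"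


section \<open>Elections and swaps\<close>

text \<open>A vote over a set of candidates is the list of its candidates, the best one first.\<close>

definition is_vote :: "'c set \<Rightarrow> 'c list \<Rightarrow> bool" where
  "is_vote C v \<longleftrightarrow> distinct v \<and> set v = C"

definition rank :: "'c \<Rightarrow> 'c list \<Rightarrow> nat" where
  "rank c v = Suc (length (takeWhile (\<lambda>d. d \<noteq> c) v))"

definition approval_score :: "nat \<Rightarrow> 'c list list \<Rightarrow> 'c \<Rightarrow> nat" where
  "approval_score k V c = length (filter (\<lambda>v. rank c v \<le> k) V)"

definition approval_winner :: "nat \<Rightarrow> 'c set \<Rightarrow> 'c list list \<Rightarrow> 'c \<Rightarrow> bool" where
  "approval_winner k C V p \<longleftrightarrow>
    p \<in> C \<and> (\<forall>c \<in> C. approval_score k V c \<le> approval_score k V p)"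

fun apply_swap :: "'c \<times> 'c \<Rightarrow> 'c list \<Rightarrow> 'c list" where
  "apply_swap (a, b) v = map (\<lambda>c. if c = a then b else if c = b then a else c) v"

fun admissible_swap :: "'c list \<Rightarrow> 'c \<times> 'c \<Rightarrow> bool" where
  "admissible_swap v (a, b) \<longleftrightarrow>
    a \<in> set v \<and> b \<in> set v \<and> a \<noteq> b \<and> rank b v = rank a v + 1"

fun apply_swaps :: "'c list \<Rightarrow> ('c \<times> 'c) list \<Rightarrow> 'c list" where
  "apply_swaps v [] = v"
| "apply_swaps v (s # ss) = apply_swaps (apply_swap s v) ss"

fun admissible_seq :: "'c list \<Rightarrow> ('c \<times> 'c) list \<Rightarrow> bool" where
  "admissible_seq v [] \<longleftrightarrow> True"
| "admissible_seq v (s # ss) \<longleftrightarrow> admissible_swap v s \<and> admissible_seq (apply_swap s v) ss"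

text \<open>
  \<open>swap_result v \<Gamma> w\<close>: the set \<open>\<Gamma>\<close> is admissible in \<open>v\<close> and \<open>w\<close> is the resulting vote.
  The order in which \<open>\<Gamma>\<close> is applied does not affect \<open>w\<close>: two candidates are finally in
  their original relative order iff \<open>\<Gamma>\<close> contains an even number of swaps between them.
\<close>

definition swap_result :: "'c list \<Rightarrow> ('c \<times> 'c) set \<Rightarrow> 'c list \<Rightarrow> bool" where
  "swap_result v \<Gamma> w \<longleftrightarrow>
    (\<exists>ss. distinct ss \<and> set ss = \<Gamma> \<and> admissible_seq v ss \<and> w = apply_swaps v ss)"

text \<open>A swap in the \<open>i\<close>-th vote is a triple \<open>(i, a, b)\<close>.\<close>

definition swap_results :: "'c list list \<Rightarrow> (nat \<times> 'c \<times> 'c) set \<Rightarrow> 'c list list \<Rightarrow> bool" where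
  "swap_results V \<Gamma> V' \<longleftrightarrow>
    (\<forall>(i, a, b) \<in> \<Gamma>. i < length V) \<and> length V' = length V \<and>
    (\<forall>i < length V. swap_result (V ! i) {(a, b). (i, a, b) \<in> \<Gamma>} (V' ! i))"


section \<open>Swap bribery\<close>

text \<open>
  The candidates are \<open>0, \<dots>, m - 1\<close>, and \<open>costs I ! i ! a ! b\<close> is the cost of the swap
  \<open>(i, a, b)\<close>. The diagonal entries \<open>a = b\<close> have no meaning.
\<close>

record bribery_inst =
  num_cands :: nat
  votes :: "nat list list"
  preferred :: nat
  costs :: "nat list list list"
  budget :: nat

definition cands :: "bribery_inst \<Rightarrow> nat set" where
  "cands I = {..<num_cands I}"

definition valid_inst :: "bribery_inst \<Rightarrow> bool" where
  "valid_inst I \<longleftrightarrow>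
    (\<forall>v \<in> set (votes I). is_vote (cands I) v) \<and>
    preferred I \<in> cands I \<and>
    length (costs I) = length (votes I) \<and>
    (\<forall>A \<in> set (costs I). length A = num_cands I \<and> (\<forall>r \<in> set A. length r = num_cands I))"

definition total_cost :: "bribery_inst \<Rightarrow> (nat \<times> nat \<times> nat) set \<Rightarrow> nat" where
  "total_cost I \<Gamma> = (\<Sum>(i, a, b) \<in> \<Gamma>. costs I ! i ! a ! b)"

definition approval_bribable :: "nat \<Rightarrow> bribery_inst \<Rightarrow> bool" where
  "approval_bribable k I \<longleftrightarrow>
    (\<exists>\<Gamma> V'. swap_results (votes I) \<Gamma> V' \<and> total_cost I \<Gamma> \<le> budget I \<and>
           approval_winner k (cands I) V' (preferred I))"

definition enc_bribery_inst :: "bribery_inst \<Rightarrow> tree" where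
  "enc_bribery_inst I =
    Node (enc_nat (num_cands I))
    (Node (enc_list (enc_list enc_nat) (votes I))
    (Node (enc_nat (preferred I))
    (Node (enc_list (enc_list (enc_list enc_nat)) (costs I))
          (enc_nat (budget I)))))"

text \<open>
  Swap bribery for \<open>k\<close>-approval, parameterized by \<open>k\<close> (which is part of the input, see
  \<open>enc_inst\<close>), restricted to the instances with property \<open>R\<close>.
\<close>

definition approval_swap_bribery :: "(bribery_inst \<Rightarrow> bool) \<Rightarrow> problem" where
  "approval_swap_bribery R =
    \<lparr>insts = {(enc_bribery_inst I, k) | I k. valid_inst I \<and> R I},
     yes_insts = {(enc_bribery_inst I, k) | I k. valid_inst I \<and> R I \<and> approval_bribable k I}\<rparr>"


section \<open>The encodings are injective\<close>

lemma enc_nat_inject: "enc_nat m = enc_nat n \<longleftrightarrow> m = n"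
proof (induction m arbitrary: n rule: less_induct)
  case (less m)
  have IH: "enc_nat (m div 2) = enc_nat (n div 2) \<longleftrightarrow> m div 2 = n div 2" if "m \<noteq> 0"
    using less.IH[of "m div 2"] that by simp
  have "m = n" if "m div 2 = n div 2" "odd m = odd n"
    using that by presburger
  then show ?case
    using IH by (auto simp: enc_nat.simps[of m] enc_nat.simps[of n] enc_bit_def split: if_splits)
qed

lemma enc_list_inject:
  assumes "\<And>x y. enc x = enc y \<longleftrightarrow> x = y"
  shows "enc_list enc xs = enc_list enc ys \<longleftrightarrow> xs = ys"
proof (induction xs arbitrary: ys)
  case Nil
  then show ?case by (cases ys) auto
next
  case (Cons x xs)
  then show ?case by (cases ys) (auto simp: assms)
qed

lemma enc_gate_inject: "enc_gate g = enc_gate h \<longleftrightarrow> g = h"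
  by (cases g; cases h) (auto simp: enc_nat_inject enc_list_inject)

lemma enc_bribery_inst_inject: "enc_bribery_inst I = enc_bribery_inst J \<longleftrightarrow> I = J"
  by (cases I; cases J) (auto simp: enc_bribery_inst_def enc_nat_inject enc_list_inject)

end

theory Submission
  imports Defs
begin

text \<open>
  To bribe a single voter is to choose the set \<open>T\<close> of the candidates on the first \<open>k\<close> positions;
  the pairs that have to be swapped are those of a candidate leaving \<open>T\<close> and one entering it. If
  the swaps of adjacent vertices of a graph have cost one, and the swap of \<open>b\<close> and the preferred
  candidate costs the number of edges from \<open>b\<close> to vertices that precede it in the vote, then the
  cost of \<open>T\<close> is the number of all edges minus the number of the edges inside \<open>T\<close>. Hence a
  suitable budget forces \<open>T\<close> to be a clique.

  A circuit of weft one and depth \<open>h\<close> reduces to the clique problem as follows. An input vector of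
  weight \<open>k\<close> is split into \<open>k + 1\<close> gaps between consecutive true inputs, so that the value of each
  input, true or false, is witnessed by one of these items. A gate that has no large gate below or
  at it depends on at most \<open>2 ^ h\<close> inputs. Hence there are \<open>2 ^ h\<close> items \<open>w\<close> that force the values
  of all gates that matter, provided that a large gate whose value is not forced by a single
  argument is given its default value. The guess \<open>w\<close> is verified by evaluating the circuit for
  \<open>\<rho> @ w\<close>, for all \<open>\<rho>\<close> of the same length; the vertices are the pairs \<open>(\<rho>, w)\<close>, and a clique
  consists of the pairs with all consistent \<open>\<rho>\<close> for a common \<open>w\<close>.
\<close>

section \<open>Programs\<close>

text \<open>The default values make evaluation non-monotone in the known facts: a guess
  \<open>w\<close> may be accepted only because a decisive argument of a large gate is unknown. A
  clique therefore has to challenge \<open>w\<close> with every kind of tuple \<open>\<rho>\<close>.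
  If the items of a clique describe an input vector \<open>S\<close>, the list that forces the
  output for \<open>S\<close> is, after padding, one of these tuples, so its acceptance proves the
  output true. To make a clique contain all challenges, adjacent vertices must have different index
  tuples; there are \<open>(k + 2) ^ R\<close> of them with \<open>R = 2 ^ h\<close>, and this
  number is the clique size. The new parameter, one more because of the preferred candidate, thus
  depends on \<open>k\<close> only, while \<open>R\<close> is constant, so that all lists of
  \<open>R\<close> items can be enumerated in polynomial time. Items carry pieces of the input list
  because a few members of a list of true inputs could not certify that an input is false. The
  instance is computed with the successor as the only arithmetic operation: numbers arise as lengths
  of lists, and the parameter is expanded to unary first.\<close>

definition clean :: "nat \<Rightarrow> (nat \<Rightarrow> tree) \<Rightarrow> bool" where
  "clean N s \<longleftrightarrow> (\<forall>i. 0 < i \<and> i < N \<longrightarrow> s i = Leaf)"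

text \<open>
  A program may use the variables below \<open>N\<close>, but has to reset them to \<open>Leaf\<close> (except for the
  output); the variables from \<open>N\<close> on are left to its context.
\<close>

definition runs :: "com \<Rightarrow> nat \<Rightarrow> tree \<Rightarrow> tree \<Rightarrow> nat \<Rightarrow> bool" where
  "runs c N x y t \<longleftrightarrow> (\<forall>s. s 0 = x \<longrightarrow> clean N s \<longrightarrow> exec c s t (s(0 := y)))"

lemma clean_mono: "clean N s \<Longrightarrow> M \<le> N \<Longrightarrow> clean M s"
  by (auto simp: clean_def)

lemma clean_upd: "clean N s \<Longrightarrow> i = 0 \<or> N \<le> i \<Longrightarrow> clean N (s(i := y))"
  by (auto simp: clean_def)

lemma runs_mono: "runs c M x y t \<Longrightarrow> M \<le> N \<Longrightarrow> runs c N x y t"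
  unfolding runs_def using clean_mono[of N _ M] by blast

lemma runsD: "runs c N (s 0) y t \<Longrightarrow> clean N s \<Longrightarrow> exec c s t (s(0 := y))"
  by (simp add: runs_def)

lemma runs_seq:
  assumes "runs c N x y t" "runs d N y z u"
  shows "runs (Seq c d) N x z (t + u)"
  unfolding runs_def
proof (intro allI impI)
  fix s :: "nat \<Rightarrow> tree" assume s: "s 0 = x" "clean N s"
  have "exec c s t (s(0 := y))" using assms(1) s by (simp add: runs_def)
  moreover have "exec d (s(0 := y)) u ((s(0 := y))(0 := z))"
    using assms(2) s by (intro runsD) (auto simp: clean_upd)
  ultimately show "exec (Seq c d) s (t + u) (s(0 := z))"
    using exec.Seq by fastforce
qed

lemma exec_Assign: "s' = s(x := expr_val e s) \<Longrightarrow> exec (Assign x e) s 1 s'"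
  using exec.Assign[of x e s] by simp

lemma exec_AssignI: "expr_val e s = v \<Longrightarrow> exec (Assign x e) s 1 (s(x := v))"
  by (rule exec_Assign) simp

lemma exec_SeqI: "exec c s t s' \<Longrightarrow> exec d s' u s'' \<Longrightarrow> v = t + u \<Longrightarrow> exec (Seq c d) s v s''"
  by (simp add: exec.Seq)

lemma runs_exec: "runs c N x y t \<Longrightarrow> s 0 = x \<Longrightarrow> clean N s \<Longrightarrow> s' = s(0 := y) \<Longrightarrow> exec c s t s'"
  by (simp add: runs_def)

lemma runs_Assign: "(\<And>s. s 0 = x \<Longrightarrow> expr_val e s = y) \<Longrightarrow> runs (Assign 0 e) N x y 1"
  unfolding runs_def by (intro allI impI exec_Assign) simp

text \<open>Variable \<open>N\<close> keeps the input while \<open>c\<close> runs,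
  \<open>N + 1\<close> keeps the first result while \<open>d\<close> runs. Both are out of reach of
  \<open>c\<close> and \<open>d\<close>.\<close>

lemma runs_pair:
  assumes c: "runs c N x y t" and d: "runs d N x z u" and "0 < N"
  shows "runs (Seq (Assign N (Var 0)) (Seq c (Seq (Assign (N + 1) (Var 0))
    (Seq (Assign 0 (Var N)) (Seq (Assign N Nil_Ex) (Seq d
    (Seq (Assign 0 (Cons_Ex (Var (N + 1)) (Var 0))) (Assign (N + 1) Nil_Ex))))))))
    (N + 2) x (Node y z) (t + u + 6)"
  unfolding runs_def
proof (intro allI impI)
  fix s :: "nat \<Rightarrow> tree" assume s: "s 0 = x" "clean (N + 2) s"
  have N: "s N = Leaf" "s (Suc N) = Leaf" "clean N s"
    using s(2) \<open>0 < N\<close> by (auto simp: clean_def)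
  show "exec (Seq (Assign N (Var 0)) (Seq c (Seq (Assign (N + 1) (Var 0))
    (Seq (Assign 0 (Var N)) (Seq (Assign N Nil_Ex) (Seq d
    (Seq (Assign 0 (Cons_Ex (Var (N + 1)) (Var 0))) (Assign (N + 1) Nil_Ex)))))))) s
    (t + u + 6) (s(0 := Node y z))"
    apply (rule exec_SeqI, rule exec_AssignI, use s(1) \<open>0 < N\<close> in simp)
     apply (rule exec_SeqI, rule runs_exec[OF c])
         apply (use s(1) \<open>0 < N\<close> in simp)
        apply (intro clean_upd N(3), simp)
       apply (rule refl)
      apply (rule exec_SeqI, rule exec_AssignI, use s(1) \<open>0 < N\<close> in simp)
       apply (rule exec_SeqI, rule exec_AssignI, use s(1) \<open>0 < N\<close> in simp)
        apply (rule exec_SeqI, rule exec_AssignI, use s(1) \<open>0 < N\<close> in simp)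
         apply (rule exec_SeqI, rule runs_exec[OF d])
             apply (use s(1) \<open>0 < N\<close> in simp)
            apply (intro clean_upd N(3); simp)
           apply (rule refl)
          apply (rule exec_SeqI, rule exec_AssignI, use s(1) \<open>0 < N\<close> in simp)
           apply (rule exec_Assign)
           apply (use s(1) N \<open>0 < N\<close> in \<open>auto simp: fun_eq_iff\<close>)
    done
qed

text \<open>The guard is the first component of the state, so the loop itself only looks at variable
  0. \<open>Suc (t i)\<close> pays for the test and the body, the outer \<open>Suc\<close> for the
  final failing test.\<close>

lemma runs_while:
  assumes "\<And>i. i < m \<Longrightarrow> runs c N (Node (a i) (b i)) (Node (a (Suc i)) (b (Suc i))) (t i)"
    and "\<And>i. i < m \<Longrightarrow> a i \<noteq> Leaf" and "a m = Leaf"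
  shows "runs (While (Hd (Var 0)) c) N (Node (a 0) (b 0)) (Node (a m) (b m)) (Suc (\<Sum>i<m. Suc (t i)))"
  using assms
proof (induction m arbitrary: a b t)
  case 0
  show ?case
    unfolding runs_def
  proof (intro allI impI)
    fix s :: "nat \<Rightarrow> tree" assume s: "s 0 = Node (a 0) (b 0)"
    then have "s(0 := Node (a 0) (b 0)) = s" by (metis fun_upd_triv)
    then show "exec (While (Hd (Var 0)) c) s (Suc (\<Sum>i<0. Suc (t i))) (s(0 := Node (a 0) (b 0)))"
      using exec.WhileFalse[of "Hd (Var 0)" s c] 0 s by simp
  qed
next
  case (Suc m)
  have IH: "runs (While (Hd (Var 0)) c) N (Node (a 1) (b 1)) (Node (a (Suc m)) (b (Suc m)))
    (Suc (\<Sum>i<m. Suc (t (Suc i))))"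
    using Suc.IH[of "\<lambda>i. a (Suc i)" "\<lambda>i. b (Suc i)" "\<lambda>i. t (Suc i)"] Suc.prems by simp
  show ?case
    unfolding runs_def
  proof (intro allI impI)
    fix s :: "nat \<Rightarrow> tree" assume s: "s 0 = Node (a 0) (b 0)" "clean N s"
    have 1: "exec c s (t 0) (s(0 := Node (a 1) (b 1)))"
      using Suc.prems(1)[of 0] s by (simp add: runs_def)
    have 2: "exec (While (Hd (Var 0)) c) (s(0 := Node (a 1) (b 1))) (Suc (\<Sum>i<m. Suc (t (Suc i))))
      (s(0 := Node (a (Suc m)) (b (Suc m))))"
      using s by (intro runs_exec[OF IH]) (auto simp: clean_upd)
    have "exec (While (Hd (Var 0)) c) s (Suc (t 0 + Suc (\<Sum>i<m. Suc (t (Suc i)))))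
      (s(0 := Node (a (Suc m)) (b (Suc m))))"
      using Suc.prems(2)[of 0] s by (intro exec.WhileTrue[OF _ 1 2]) simp
    then show "exec (While (Hd (Var 0)) c) s (Suc (\<Sum>i<Suc m. Suc (t i)))
      (s(0 := Node (a (Suc m)) (b (Suc m))))"
      by (simp only: sum.lessThan_Suc_shift comp_def) simp
  qed
qed

text \<open>One round of a fold: the state is the list of the remaining elements, paired with the
  context \<open>x\<close> and the accumulator.\<close>

lemma runs_fold_body:
  assumes g: "runs c N (Node x (Node y e)) z t" and "0 < N"
  shows "runs (Seq (Assign N (Tl (Hd (Var 0)))) (Seq (Assign (N + 1) (Hd (Tl (Var 0))))
    (Seq (Assign 0 (Cons_Ex (Hd (Tl (Var 0))) (Cons_Ex (Tl (Tl (Var 0))) (Hd (Hd (Var 0))))))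
    (Seq c (Seq (Assign 0 (Cons_Ex (Var N) (Cons_Ex (Var (N + 1)) (Var 0))))
    (Seq (Assign N Nil_Ex) (Assign (N + 1) Nil_Ex)))))))
    (N + 2) (Node (Node e l) (Node x y)) (Node l (Node x z)) (t + 6)"
  unfolding runs_def
proof (intro allI impI)
  fix s :: "nat \<Rightarrow> tree" assume s: "s 0 = Node (Node e l) (Node x y)" "clean (N + 2) s"
  have N: "s N = Leaf" "s (Suc N) = Leaf" "clean N s"
    using s(2) \<open>0 < N\<close> by (auto simp: clean_def)
  show "exec (Seq (Assign N (Tl (Hd (Var 0)))) (Seq (Assign (N + 1) (Hd (Tl (Var 0))))
    (Seq (Assign 0 (Cons_Ex (Hd (Tl (Var 0))) (Cons_Ex (Tl (Tl (Var 0))) (Hd (Hd (Var 0))))))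
    (Seq c (Seq (Assign 0 (Cons_Ex (Var N) (Cons_Ex (Var (N + 1)) (Var 0))))
    (Seq (Assign N Nil_Ex) (Assign (N + 1) Nil_Ex))))))) s
    (t + 6) (s(0 := Node l (Node x z)))"
    apply (rule exec_SeqI, rule exec_AssignI, use s(1) \<open>0 < N\<close> in simp)
     apply (rule exec_SeqI, rule exec_AssignI, use s(1) \<open>0 < N\<close> in simp)
      apply (rule exec_SeqI, rule exec_AssignI, use s(1) \<open>0 < N\<close> in simp)
       apply (rule exec_SeqI, rule runs_exec[OF g])
           apply (use s(1) \<open>0 < N\<close> in simp)
          apply (intro clean_upd N(3); simp)
         apply (rule refl)
        apply (rule exec_SeqI, rule exec_AssignI, use s(1) \<open>0 < N\<close> in simp)
         apply (rule exec_SeqI, rule exec_AssignI, use s(1) \<open>0 < N\<close> in simp)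
          apply (rule exec_Assign)
          apply (use s(1) N \<open>0 < N\<close> in \<open>auto simp: fun_eq_iff\<close>)
    done
qed

text \<open>The remaining list is itself the guard, as only the empty list is encoded by
  \<open>Leaf\<close>. The 7 consists of the six assignments of the body and the loop test.\<close>

lemma runs_fold:
  assumes g: "\<And>i. i < length l \<Longrightarrow> runs c N (Node x (Node (a i) (l ! i))) (a (Suc i)) (t i)" "0 < N"
  shows "runs (While (Hd (Var 0)) (Seq (Assign N (Tl (Hd (Var 0)))) (Seq (Assign (N + 1) (Hd (Tl (Var 0))))
    (Seq (Assign 0 (Cons_Ex (Hd (Tl (Var 0))) (Cons_Ex (Tl (Tl (Var 0))) (Hd (Hd (Var 0))))))
    (Seq c (Seq (Assign 0 (Cons_Ex (Var N) (Cons_Ex (Var (N + 1)) (Var 0))))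
    (Seq (Assign N Nil_Ex) (Assign (N + 1) Nil_Ex)))))))) (N + 2)
    (Node (enc_list (\<lambda>x. x) l) (Node x (a 0))) (Node Leaf (Node x (a (length l))))
    (Suc (\<Sum>i<length l. t i + 7))"
proof -
  have [simp]: "enc_list (\<lambda>x. x) (drop i l) = Node (l ! i) (enc_list (\<lambda>x. x) (drop (Suc i) l))"
    if "i < length l" for i
    using Cons_nth_drop_Suc[OF that] by (metis enc_list.simps(2))
  show ?thesis
    using runs_while[where a = "\<lambda>i. enc_list (\<lambda>x. x) (drop i l)" and b = "\<lambda>i. Node x (a i)"
        and m = "length l" and t = "\<lambda>i. t i + 6" and N = "N + 2"
        and c = "Seq (Assign N (Tl (Hd (Var 0)))) (Seq (Assign (N + 1) (Hd (Tl (Var 0))))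
    (Seq (Assign 0 (Cons_Ex (Hd (Tl (Var 0))) (Cons_Ex (Tl (Tl (Var 0))) (Hd (Hd (Var 0))))))
    (Seq c (Seq (Assign 0 (Cons_Ex (Var N) (Cons_Ex (Var (N + 1)) (Var 0))))
    (Seq (Assign N Nil_Ex) (Assign (N + 1) Nil_Ex))))))"]
      runs_fold_body[OF g(1) \<open>0 < N\<close>] by (simp add: numeral_eq_Suc)
qed

section \<open>Turning arbitrary programs into subprograms\<close>

fun vars_expr :: "expr \<Rightarrow> nat set" where
  "vars_expr (Var x) = {x}"
| "vars_expr Nil_Ex = {}"
| "vars_expr (Cons_Ex d e) = vars_expr d \<union> vars_expr e"
| "vars_expr (Hd e) = vars_expr e"
| "vars_expr (Tl e) = vars_expr e"

fun vars_com :: "com \<Rightarrow> nat set" where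
  "vars_com (Assign x e) = insert x (vars_expr e)"
| "vars_com (Seq c d) = vars_com c \<union> vars_com d"
| "vars_com (If e c d) = vars_expr e \<union> vars_com c \<union> vars_com d"
| "vars_com (While e c) = vars_expr e \<union> vars_com c"

lemma finite_vars_com: "finite (vars_com c)"
proof -
  have "finite (vars_expr e)" for e by (induction e) auto
  then show ?thesis by (induction c) auto
qed

lemma expr_val_agree: "(\<And>x. x \<in> vars_expr e \<Longrightarrow> s x = s' x) \<Longrightarrow> expr_val e s = expr_val e s'"
  by (induction e) auto

text \<open>A program reads and writes only its own variables, so the rest of the store may be any
  \<open>r\<close>. This lets a program that is specified on an otherwise empty store run inside a
  larger one.\<close>

lemma exec_agree:
  assumes "exec c s t s'" "vars_com c \<subseteq> X"
  shows "exec c (\<lambda>i. if i \<in> X then s i else r i) t (\<lambda>i. if i \<in> X then s' i else r i)"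
  using assms
proof (induction rule: exec.induct)
  case (Assign x e s)
  then show ?case
    by (intro exec_Assign) (auto simp: fun_eq_iff intro!: expr_val_agree)
next
  case (Seq c s t s' d u s'')
  then show ?case by (auto intro: exec.Seq)
next
  case (IfTrue e s c t s' d)
  have "expr_val e (\<lambda>i. if i \<in> X then s i else r i) = expr_val e s"
    using IfTrue.prems by (intro expr_val_agree) auto
  then show ?case using IfTrue by (auto intro: exec.IfTrue)
next
  case (IfFalse e s d t s' c)
  have "expr_val e (\<lambda>i. if i \<in> X then s i else r i) = expr_val e s"
    using IfFalse.prems by (intro expr_val_agree) auto
  then show ?case using IfFalse by (auto intro: exec.IfFalse)
next
  case (WhileFalse e s c)
  have "expr_val e (\<lambda>i. if i \<in> X then s i else r i) = expr_val e s"
    using WhileFalse.prems by (intro expr_val_agree) auto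
  then show ?case using WhileFalse by (intro exec.WhileFalse) simp
next
  case (WhileTrue e s c t s' u s'')
  have "expr_val e (\<lambda>i. if i \<in> X then s i else r i) = expr_val e s"
    using WhileTrue.prems by (intro expr_val_agree) auto
  then show ?case using WhileTrue by (intro exec.WhileTrue) auto
qed

text \<open>The language has no skip command, so the base case copies variable 0 to itself.\<close>

fun clear :: "nat \<Rightarrow> com" where
  "clear 0 = Assign 0 (Var 0)"
| "clear (Suc N) = Seq (clear N) (Assign (Suc N) Nil_Ex)"

lemma exec_clear: "exec (clear N) s (Suc N) (\<lambda>i. if 0 < i \<and> i \<le> N then Leaf else s i)"
proof (induction N)
  case 0
  have "(\<lambda>i. if 0 < i \<and> i \<le> 0 then Leaf else s i) = s" by auto
  then show ?case using exec_Assign[of s s 0 "Var 0"] by simp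
next
  case (Suc N)
  show ?case
    by (simp, rule exec_SeqI, rule Suc.IH, rule exec_Assign) auto
qed

text \<open>\<open>computes_in\<close> tolerates garbage in the work variables, whereas
  \<open>runs\<close> forbids it. Clearing the variables of \<open>c\<close> afterwards makes
  \<open>c\<close> composable; the cost \<open>N\<close> depends on \<open>c\<close> only.\<close>

lemma normalize_com:
  "\<exists>d N. 0 < N \<and> (\<forall>x t s. exec c ((\<lambda>_. Leaf)(0 := x)) t s \<longrightarrow> runs d N x (s 0) (t + N))"
proof -
  define N where "N = Suc (Max (vars_com c))"
  have N: "vars_com c \<subseteq> {..<N}" "0 < N"
    using finite_vars_com[of c] by (auto simp: N_def less_Suc_eq_le)
  show ?thesis
  proof (rule exI[of _ "Seq c (clear (N - 1))"], rule exI[of _ N], intro conjI allI impI)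
    fix x t s assume *: "exec c ((\<lambda>_. Leaf)(0 := x)) t s"
    show "runs (Seq c (clear (N - 1))) N x (s 0) (t + N)"
      unfolding runs_def
    proof (intro allI impI)
      fix r assume r: "r 0 = x" "clean N r"
      have eq: "r = (\<lambda>i. if i \<in> {..<N} then ((\<lambda>_. Leaf)(0 := x)) i else r i)"
        using r by (auto simp: fun_eq_iff clean_def)
      have "exec c r t (\<lambda>i. if i \<in> {..<N} then s i else r i)"
        by (subst eq) (rule exec_agree[OF * N(1)])
      moreover have "(\<lambda>i. if 0 < i \<and> i \<le> N - 1 then Leaf else if i \<in> {..<N} then s i else r i)
        = r(0 := s 0)"
        using r N(2) by (auto simp: fun_eq_iff clean_def)
      ultimately show "exec (Seq c (clear (N - 1))) r (t + N) (r(0 := s 0))"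
        using exec_clear[of "N - 1" "\<lambda>i. if i \<in> {..<N} then s i else r i"] N(2)
        by (auto intro: exec_SeqI)
    qed
  qed (rule N(2))
qed

lemma runs_computes_in: "runs c N x y t \<Longrightarrow> computes_in c x y (t + tsize y)"
  unfolding computes_in_def
  by (intro exI[of _ t] exI[of _ "((\<lambda>_. Leaf)(0 := x))(0 := y)"])
    (auto simp: clean_def intro!: runs_exec)

section \<open>Polynomial-time functions\<close>

text \<open>Typed values instead of bare trees allow compositional reasoning; injectivity reduces
  every equality test to one on trees.\<close>

class encodable =
  fixes encode :: "'a \<Rightarrow> tree"
  assumes encode_inject: "encode x = encode y \<longleftrightarrow> x = y"

instantiation tree :: encodable
begin
definition encode_tree :: "tree \<Rightarrow> tree" where [simp]: "encode_tree x = x"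
instance by standard simp
end

instantiation prod :: (encodable, encodable) encodable
begin
definition encode_prod :: "'a \<times> 'b \<Rightarrow> tree" where
  "encode_prod p = Node (encode (fst p)) (encode (snd p))"
instance by standard (auto simp: encode_prod_def encode_inject prod_eq_iff)
end

instantiation bool :: encodable
begin
definition encode_bool :: "bool \<Rightarrow> tree" where "encode_bool = enc_bit"
instance by standard (simp add: encode_bool_def enc_bit_def)
end

instantiation unit :: encodable
begin
definition encode_unit :: "unit \<Rightarrow> tree" where "encode_unit u = Leaf"
instance by standard simp
end

instantiation nat :: encodable
begin
definition encode_nat :: "nat \<Rightarrow> tree" where "encode_nat = enc_nat"
instance by standard (simp add: encode_nat_def enc_nat_inject)
end

instantiation list :: (encodable) encodable
begin
definition encode_list :: "'a list \<Rightarrow> tree" where "encode_list = enc_list encode"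
instance by standard (simp add: encode_list_def enc_list_inject encode_inject)
end

instantiation gate :: encodable
begin
definition encode_gate :: "gate \<Rightarrow> tree" where "encode_gate = enc_gate"
instance by standard (simp add: encode_gate_def enc_gate_inject)
end

lemma encode_Pair [simp]: "encode (x, y) = Node (encode x) (encode y)"
  by (simp add: encode_prod_def)

lemma encode_Nil [simp]: "encode [] = Leaf"
  and encode_Cons [simp]: "encode (x # xs) = Node (encode x) (encode xs)"
  by (simp_all add: encode_list_def)

lemma encode_bool_simps [simp]: "encode True = Node Leaf Leaf" "encode False = Leaf"
  by (simp_all add: encode_bool_def enc_bit_def)

section \<open>Sizes, polynomial bounds and basic closure properties\<close>

abbreviation esize :: "'a :: encodable \<Rightarrow> nat" where
  "esize x \<equiv> tsize (encode x)"

lemma tsize_pos [simp]: "0 < tsize x" "tsize x \<noteq> 0"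
  by (induction x) auto

text \<open>The base is at least 2, so every constant is below some power and coefficients can be
  absorbed into the exponent.\<close>

definition poly_bounded :: "('a :: encodable \<Rightarrow> nat) \<Rightarrow> bool" where
  "poly_bounded T \<longleftrightarrow> (\<exists>d. \<forall>x. T x \<le> (esize x + 1) ^ d)"

text \<open>\<open>T\<close> bounds the output as well as the time: shared subtrees could make the
  output exponentially large, and the next program of a composition has to work on it.\<close>

definition ptime :: "('a :: encodable \<Rightarrow> 'b :: encodable) \<Rightarrow> bool" where
  "ptime f \<longleftrightarrow> (\<exists>c N T. 0 < N \<and> poly_bounded T \<and>
    (\<forall>x. esize (f x) \<le> T x \<and> (\<exists>t\<le>T x. runs c N (encode x) (encode (f x)) t)))"

lemma ptimeI:
  assumes "\<And>x. \<exists>t\<le>T x. runs c N (encode x) (encode (f x)) t" "poly_bounded T"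
    "\<And>x. esize (f x) \<le> T x" "0 < N"
  shows "ptime f"
  unfolding ptime_def using assms by blast

lemma poly_bounded_mono:
  assumes "poly_bounded T" "\<And>x. U x \<le> T x"
  shows "poly_bounded U"
  using assms order_trans unfolding poly_bounded_def by blast

lemma poly_bounded_const [intro, simp]: "poly_bounded (\<lambda>_. n)"
  unfolding poly_bounded_def
proof (intro exI allI)
  fix x :: 'a
  have "n \<le> 2 ^ n" by (simp add: less_imp_le)
  also have "\<dots> \<le> (esize x + 1) ^ n"
    by (intro power_mono) (auto simp: Suc_le_eq)
  finally show "n \<le> (esize x + 1) ^ n" .
qed

lemma poly_bounded_mult [intro]:
  assumes "poly_bounded T" "poly_bounded U"
  shows "poly_bounded (\<lambda>x. T x * U x)"
proof -
  obtain d e where "\<And>x. T x \<le> (esize x + 1) ^ d" "\<And>x. U x \<le> (esize x + 1) ^ e"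
    using assms unfolding poly_bounded_def by blast
  then have "T x * U x \<le> (esize x + 1) ^ (d + e)" for x
    by (simp add: power_add mult_le_mono)
  then show ?thesis unfolding poly_bounded_def by blast
qed

lemma poly_bounded_add [intro]:
  assumes "poly_bounded T" "poly_bounded U"
  shows "poly_bounded (\<lambda>x. T x + U x)"
proof -
  \<comment> \<open>Sums follow from products by \<open>T + U \<le> (T + 1) * (U + 1)\<close>; the
    successor costs one more factor \<open>esize x + 1 \<ge> 2\<close>.\<close>
  have "poly_bounded (\<lambda>x. V x + 1)" if "poly_bounded V" for V :: "'a \<Rightarrow> nat"
  proof -
    obtain d where d: "\<And>x. V x \<le> (esize x + 1) ^ d"
      using \<open>poly_bounded V\<close> unfolding poly_bounded_def by blast
    have "V x + 1 \<le> (esize x + 1) ^ (d + 1)" for x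
    proof -
      have "V x + 1 \<le> 2 * (esize x + 1) ^ d"
        unfolding mult_2 using d[of x] by (intro add_mono one_le_power) simp_all
      also have "\<dots> \<le> (esize x + 1) * (esize x + 1) ^ d"
        by (intro mult_le_mono1) (auto simp: Suc_le_eq)
      finally show ?thesis by simp
    qed
    then show ?thesis unfolding poly_bounded_def by blast
  qed
  then have "poly_bounded (\<lambda>x. (T x + 1) * (U x + 1))"
    using assms by (intro poly_bounded_mult)
  then show ?thesis by (rule poly_bounded_mono) simp
qed

lemma poly_bounded_esize [intro]:
  assumes "ptime f"
  shows "poly_bounded (\<lambda>x. esize (f x))"
  using assms unfolding ptime_def by (meson poly_bounded_mono)

lemma poly_bounded_comp:
  assumes "poly_bounded T" "ptime f"
  shows "poly_bounded (\<lambda>x. T (f x))"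
proof -
  obtain d where d: "\<And>x. T x \<le> (esize x + 1) ^ d"
    using assms unfolding poly_bounded_def by blast
  have "poly_bounded (\<lambda>x. (esize (f x) + 1) ^ d)"
  proof (induction d)
    case (Suc d)
    then show ?case
      using poly_bounded_esize[OF assms(2)] by (auto intro!: poly_bounded_mult poly_bounded_add
          simp del: add_Suc_right add_Suc One_nat_def)
  qed simp
  then show ?thesis using d by (rule poly_bounded_mono)
qed

lemma ptime_comp:
  assumes "ptime g" "ptime f"
  shows "ptime (\<lambda>x. g (f x))"
proof -
  obtain c M T where c: "0 < M" "poly_bounded T" "\<And>x. esize (f x) \<le> T x"
    "\<And>x. \<exists>t\<le>T x. runs c M (encode x) (encode (f x)) t"
    using assms(2) unfolding ptime_def by blast
  obtain d N U where d: "0 < N" "poly_bounded U" "\<And>x. esize (g x) \<le> U x"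
    "\<And>x. \<exists>t\<le>U x. runs d N (encode x) (encode (g x)) t"
    using assms(1) unfolding ptime_def by blast
  have "\<exists>t\<le>T x + U (f x). runs (Seq c d) (max M N) (encode x) (encode (g (f x))) t" for x
  proof -
    obtain t u where "t \<le> T x" "u \<le> U (f x)" "runs c M (encode x) (encode (f x)) t"
      "runs d N (encode (f x)) (encode (g (f x))) u"
      using c(4)[of x] d(4)[of "f x"] by blast
    then show ?thesis
      by (intro exI[of _ "t + u"] conjI runs_seq) (auto intro: runs_mono)
  qed
  moreover have "poly_bounded (\<lambda>x. T x + U (f x))"
    using c(2) d(2) assms(2) by (intro poly_bounded_add poly_bounded_comp[of U f])
  ultimately show ?thesis
    by (rule ptimeI) (use c(1) d(3) in \<open>auto intro: trans_le_add2\<close>)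
qed

lemma ptime_Pair:
  assumes "ptime f" "ptime g"
  shows "ptime (\<lambda>x. (f x, g x))"
proof -
  obtain c M T where c: "0 < M" "poly_bounded T" "\<And>x. esize (f x) \<le> T x"
    "\<And>x. \<exists>t\<le>T x. runs c M (encode x) (encode (f x)) t"
    using assms(1) unfolding ptime_def by blast
  obtain d N U where d: "0 < N" "poly_bounded U" "\<And>x. esize (g x) \<le> U x"
    "\<And>x. \<exists>t\<le>U x. runs d N (encode x) (encode (g x)) t"
    using assms(2) unfolding ptime_def by blast
  let ?N = "max M N"
  define e where "e = Seq (Assign ?N (Var 0)) (Seq c (Seq (Assign (?N + 1) (Var 0))
      (Seq (Assign 0 (Var ?N)) (Seq (Assign ?N Nil_Ex) (Seq d
      (Seq (Assign 0 (Cons_Ex (Var (?N + 1)) (Var 0))) (Assign (?N + 1) Nil_Ex)))))))"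
  have "\<exists>t\<le>T x + U x + 6. runs e (?N + 2) (encode x) (encode (f x, g x)) t" for x
  proof -
    obtain t u where "t \<le> T x" "u \<le> U x" "runs c ?N (encode x) (encode (f x)) t"
      "runs d ?N (encode x) (encode (g x)) u"
      using c(4)[of x] d(4)[of x] by (meson max.cobounded1 max.cobounded2 runs_mono)
    then show ?thesis
      unfolding encode_Pair e_def using c(1)
      by (intro exI[of _ "t + u + 6"] conjI runs_pair) auto
  qed
  moreover have "poly_bounded (\<lambda>x. T x + U x + 6)"
    using c(2) d(2) by (intro poly_bounded_add poly_bounded_const)
  moreover have "esize (f x, g x) \<le> T x + U x + 6" for x
    using c(3)[of x] d(3)[of x] by simp
  ultimately show ?thesis
    by (rule ptimeI) simp
qed

lemma ptime_expr:
  assumes "\<And>x s. s 0 = encode x \<Longrightarrow> expr_val e s = encode (f x)"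
  shows "ptime f"
proof -
  \<comment> \<open>An expression mentions its variables a fixed number of times, so it enlarges its
    input at most by a constant factor.\<close>
  have "\<exists>K. \<forall>y. tsize (expr_val e (\<lambda>_. y)) \<le> K * tsize y"
  proof (induction e)
    case (Var n)
    show ?case by (rule exI[of _ 1]) simp
  next
    case Nil_Ex
    show ?case by (rule exI[of _ 1]) (simp add: Suc_le_eq)
  next
    case (Cons_Ex d e)
    then obtain K L where *: "\<And>y. tsize (expr_val d (\<lambda>_. y)) \<le> K * tsize y"
      "\<And>y. tsize (expr_val e (\<lambda>_. y)) \<le> L * tsize y" by blast
    have "tsize (expr_val (Cons_Ex d e) (\<lambda>_. y)) \<le> (K + L + 1) * tsize y" for y
      using *[of y] tsize_pos(1)[of y] by (simp add: add_mult_distrib del: tsize_pos)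
    then show ?case by blast
  next
    case (Hd e)
    then obtain K where "\<And>y. tsize (expr_val e (\<lambda>_. y)) \<le> K * tsize y" by blast
    then have "tsize (expr_val (Hd e) (\<lambda>_. y)) \<le> K * tsize y" for y
      by (rule order_trans[rotated]) (auto split: tree.split)
    then show ?case by blast
  next
    case (Tl e)
    then obtain K where "\<And>y. tsize (expr_val e (\<lambda>_. y)) \<le> K * tsize y" by blast
    then have "tsize (expr_val (Tl e) (\<lambda>_. y)) \<le> K * tsize y" for y
      by (rule order_trans[rotated]) (auto split: tree.split)
    then show ?case by blast
  qed
  then obtain K where K: "\<And>y. tsize (expr_val e (\<lambda>_. y)) \<le> K * tsize y" by blast
  have size: "esize (f x) \<le> K * esize x" for x
    using K[of "encode x"] assms[where x = x and s = "\<lambda>_. encode x"] by simp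
  have "poly_bounded (\<lambda>x::'a. esize x)"
    unfolding poly_bounded_def by (rule exI[of _ 1]) simp
  then have "poly_bounded (\<lambda>x::'a. K * esize x + 1)"
    by (intro poly_bounded_add poly_bounded_mult poly_bounded_const)
  moreover have "\<exists>t\<le>K * esize x + 1. runs (Assign 0 e) 1 (encode x) (encode (f x)) t" for x
    using runs_Assign[of "encode x" e "encode (f x)" 1] assms by (auto intro!: exI[of _ 1])
  ultimately show ?thesis
    using size by (intro ptimeI) (auto simp: le_SucI)
qed

lemma ptime_id: "ptime (\<lambda>x. x)"
  by (rule ptime_expr[of "Var 0"]) simp

lemma ptime_encode: "ptime (\<lambda>x. encode (f x)) \<longleftrightarrow> ptime f"
  by (simp add: ptime_def)

text \<open>Only the trees count, so a change of type that preserves the encoding is free, for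
  instance from a pair to a list cell or from a number to its digits.\<close>

lemma ptime_same_encode: "(\<And>x. encode (f x) = encode (g x)) \<Longrightarrow> ptime f \<Longrightarrow> ptime g"
  by (simp add: ptime_def)

primrec const_expr :: "tree \<Rightarrow> expr" where
  "const_expr Leaf = Nil_Ex"
| "const_expr (Node l r) = Cons_Ex (const_expr l) (const_expr r)"

lemma ptime_const: "ptime (\<lambda>_. y)"
proof (rule ptime_expr)
  have "expr_val (const_expr z) s = z" for z s by (induction z) auto
  then show "expr_val (const_expr (encode y)) s = encode y" for s .
qed

lemma ptime_fst: "ptime f \<Longrightarrow> ptime (\<lambda>x. fst (f x))"
  by (rule ptime_comp[of fst]) (rule ptime_expr[of "Hd (Var 0)"], simp add: encode_prod_def)

lemma ptime_snd: "ptime f \<Longrightarrow> ptime (\<lambda>x. snd (f x))"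
  by (rule ptime_comp[of snd]) (rule ptime_expr[of "Tl (Var 0)"], simp add: encode_prod_def)

lemma ptime_Cons: "ptime f \<Longrightarrow> ptime g \<Longrightarrow> ptime (\<lambda>x. f x # g x)"
  by (rule ptime_same_encode[of "\<lambda>x. (f x, g x)"]) (auto intro: ptime_Pair)

lemma ptime_tl: "ptime f \<Longrightarrow> ptime (\<lambda>x. tl (f x))"
proof (rule ptime_comp[of tl], rule ptime_expr[of "Tl (Var 0)"])
  fix x :: "'b list" and s :: "nat \<Rightarrow> tree" assume "s 0 = encode x"
  then show "expr_val (Tl (Var 0)) s = encode (tl x)" by (cases x) auto
qed

section \<open>Branching and Boolean operations\<close>

lemma ptime_runs:
  assumes "\<And>x. runs c N (encode x) (encode (f x)) (t x)" "0 < N"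
    "poly_bounded t" "poly_bounded (\<lambda>x. esize (f x))"
  shows "ptime f"
  using assms by (intro ptimeI[of "\<lambda>x. esize (f x) + t x"] exI[of _ "t _"]) auto

text \<open>\<open>If\<close> can only test for \<open>Leaf\<close>, and \<open>encode False\<close>
  is \<open>Leaf\<close>; hence one branching function on trees covers conditionals on all
  types.\<close>

lemma ptime_tree_if:
  "ptime (\<lambda>p::tree \<times> tree \<times> tree. if fst p \<noteq> Leaf then fst (snd p) else snd (snd p))"
proof (rule ptime_runs)
  let ?f = "\<lambda>p::tree \<times> tree \<times> tree. if fst p \<noteq> Leaf then fst (snd p) else snd (snd p)"
  let ?c = "If (Hd (Var 0)) (Assign 0 (Hd (Tl (Var 0)))) (Assign 0 (Tl (Tl (Var 0))))"
  show "runs ?c 1 (encode p) (encode (?f p)) 2" for p :: "tree \<times> tree \<times> tree"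
    unfolding runs_def
  proof (intro allI impI)
    fix s :: "nat \<Rightarrow> tree" assume s: "s 0 = encode p"
    have "exec ?c s (Suc 1) (s(0 := encode (?f p)))"
    proof (cases "fst p = Leaf")
      case True
      then show ?thesis
        using s by (intro exec.IfFalse exec_Assign) (simp_all add: encode_prod_def)
    next
      case False
      then show ?thesis
        using s by (intro exec.IfTrue exec_Assign) (simp_all add: encode_prod_def)
    qed
    then show "exec ?c s 2 (s(0 := encode (?f p)))" by (simp add: numeral_2_eq_2)
  qed
  have "ptime (\<lambda>p :: tree \<times> tree \<times> tree. p)" by (rule ptime_id)
  from poly_bounded_esize[OF this] show "poly_bounded (\<lambda>p. esize (?f p))"
    by (rule poly_bounded_mono) (auto simp: encode_prod_def)
qed simp_all

lemma ptime_if: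
  assumes "ptime b" "ptime f" "ptime g"
  shows "ptime (\<lambda>x. if b x then f x else g x)"
proof -
  have "ptime (\<lambda>x. (encode (b x), encode (f x), encode (g x)))"
    using assms by (intro ptime_Pair) (simp_all add: ptime_encode)
  from ptime_comp[OF ptime_tree_if this] have "ptime (\<lambda>x. encode (if b x then f x else g x))"
    by (rule ptime_same_encode[rotated]) simp
  then show ?thesis by (simp only: ptime_encode)
qed

lemma ptime_cong: "ptime f \<Longrightarrow> (\<And>x. f x = g x) \<Longrightarrow> ptime g"
  by (rule ptime_same_encode) auto

lemma ptime_not: "ptime b \<Longrightarrow> ptime (\<lambda>x. \<not> b x)"
  by (rule ptime_cong[OF ptime_if[of b "\<lambda>_. False" "\<lambda>_. True"]]) (simp_all add: ptime_const)

lemma ptime_conj: "ptime b \<Longrightarrow> ptime c \<Longrightarrow> ptime (\<lambda>x. b x \<and> c x)"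
  by (rule ptime_cong[OF ptime_if[of b c "\<lambda>_. False"]]) (simp_all add: ptime_const)

lemma ptime_disj: "ptime b \<Longrightarrow> ptime c \<Longrightarrow> ptime (\<lambda>x. b x \<or> c x)"
  by (rule ptime_cong[OF ptime_if[of b "\<lambda>_. True" c]]) (simp_all add: ptime_const)

lemma ptime_imp: "ptime b \<Longrightarrow> ptime c \<Longrightarrow> ptime (\<lambda>x. b x \<longrightarrow> c x)"
  by (rule ptime_cong[OF ptime_if[of b c "\<lambda>_. True"]]) (simp_all add: ptime_const)

lemma poly_bounded_power [intro]: "poly_bounded T \<Longrightarrow> poly_bounded (\<lambda>x. T x ^ d)"
  by (induction d) (auto intro!: poly_bounded_mult)

subsection \<open>Equality\<close>

text \<open>Tree recursion is replaced by a worklist of pairs still to be compared. A mismatch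
  empties the list, which ends the loop at once.\<close>

fun eq_step :: "(tree \<times> tree) list \<times> bool \<Rightarrow> (tree \<times> tree) list \<times> bool" where
  "eq_step ((Leaf, Leaf) # w, f) = (w, f)"
| "eq_step ((Node a b, Node c d) # w, f) = ((a, c) # (b, d) # w, f)"
| "eq_step (_ # w, f) = ([], False)"
| "eq_step ([], f) = ([], f)"

text \<open>Each step removes at least one node from the left trees, so their total size bounds the
  number of steps. The nonempty worklists before step \<open>m\<close> are what
  \<open>runs_while\<close> demands of the guard.\<close>

lemma eq_steps:
  "\<exists>m \<le> sum_list (map (tsize \<circ> fst) w).
    (eq_step ^^ m) (w, f) = ([], f \<and> (\<forall>p \<in> set w. fst p = snd p)) \<and>
    (\<forall>i<m. fst ((eq_step ^^ i) (w, f)) \<noteq> [])"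
proof (induction "sum_list (map (tsize \<circ> fst) w)" arbitrary: w f rule: less_induct)
  case less
  have Suc: ?case
    if w: "w \<noteq> []" "eq_step (w, f) = (w', f')"
      and m: "sum_list (map (tsize \<circ> fst) w') < sum_list (map (tsize \<circ> fst) w)"
      and eq: "(f' \<and> (\<forall>p \<in> set w'. fst p = snd p)) = (f \<and> (\<forall>p \<in> set w. fst p = snd p))"
    for w' f'
  proof -
    obtain m where m': "m \<le> sum_list (map (tsize \<circ> fst) w')"
      "(eq_step ^^ m) (w', f') = ([], f' \<and> (\<forall>p \<in> set w'. fst p = snd p))"
      "\<forall>i<m. fst ((eq_step ^^ i) (w', f')) \<noteq> []"
      using less[OF m] by blast
    have step: "(eq_step ^^ Suc i) (w, f) = (eq_step ^^ i) (w', f')" for i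
      using w(2) by (simp add: funpow_swap1)
    have "fst ((eq_step ^^ i) (w, f)) \<noteq> []" if "i < Suc m" for i
    proof (cases i)
      case 0
      then show ?thesis using w(1) by simp
    next
      case (Suc j)
      then show ?thesis using step[of j] m'(3) that by simp
    qed
    then show ?thesis
      using m'(1,2) m step[of m] eq by (intro exI[of _ "Suc m"]) simp
  qed
  show ?case
  proof (cases w)
    case Nil
    then show ?thesis by (intro exI[of _ 0]) simp
  next
    case (Cons p w')
    obtain a b where p: "p = (a, b)" by (cases p)
    show ?thesis
    proof (cases a)
      case a: Leaf
      show ?thesis
      proof (cases b)
        case Leaf
        show ?thesis by (rule Suc[of w' f]) (auto simp: Cons p a Leaf)
      next
        case (Node _ _)
        show ?thesis by (rule Suc[of "[]" False]) (auto simp: Cons p a Node)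
      qed
    next
      case a: (Node a1 a2)
      show ?thesis
      proof (cases b)
        case Leaf
        show ?thesis by (rule Suc[of "[]" False]) (auto simp: Cons p a Leaf)
      next
        case (Node b1 b2)
        show ?thesis by (rule Suc[of "(a1, b1) # (a2, b2) # w'" f]) (auto simp: Cons p a Node)
      qed
    qed
  qed
qed

lemma runs_If:
  "(x' \<noteq> Leaf \<Longrightarrow> runs c N x y t) \<Longrightarrow> (x' = Leaf \<Longrightarrow> runs d N x y t) \<Longrightarrow>
    (\<And>s. s 0 = x \<Longrightarrow> expr_val e s = x') \<Longrightarrow> runs (If e c d) N x y (Suc t)"
  unfolding runs_def by (cases "x' = Leaf") (auto intro: exec.IfTrue exec.IfFalse)

text \<open>The time is 3 in every case: two tests and one assignment.\<close>

lemma runs_eq_step: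
  assumes "w \<noteq> []"
  shows "runs
    (If (Hd (Hd (Hd (Var 0))))
      (If (Tl (Hd (Hd (Var 0))))
        (Assign 0 (Cons_Ex (Cons_Ex (Cons_Ex (Hd (Hd (Hd (Hd (Var 0))))) (Hd (Tl (Hd (Hd (Var 0))))))
          (Cons_Ex (Cons_Ex (Tl (Hd (Hd (Hd (Var 0))))) (Tl (Tl (Hd (Hd (Var 0)))))) (Tl (Hd (Var 0)))))
          (Tl (Var 0))))
        (Assign 0 (Cons_Ex Nil_Ex Nil_Ex)))
      (If (Tl (Hd (Hd (Var 0))))
        (Assign 0 (Cons_Ex Nil_Ex Nil_Ex))
        (Assign 0 (Cons_Ex (Tl (Hd (Var 0))) (Tl (Var 0))))))
    1 (encode (w, f)) (encode (eq_step (w, f))) 3"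
proof -
  obtain a b w' where w: "w = (a, b) # w'" using assms by (metis list.exhaust surj_pair)
  have 3: "3 = Suc (Suc 1)" by simp
  show ?thesis
    unfolding 3
  proof (rule runs_If[of a]; (rule runs_If[of b])?)
    assume "a \<noteq> Leaf" "b \<noteq> Leaf"
    then show "runs (Assign 0 (Cons_Ex (Cons_Ex (Cons_Ex (Hd (Hd (Hd (Hd (Var 0))))) (Hd (Tl (Hd (Hd (Var 0))))))
          (Cons_Ex (Cons_Ex (Tl (Hd (Hd (Hd (Var 0))))) (Tl (Tl (Hd (Hd (Var 0)))))) (Tl (Hd (Var 0)))))
          (Tl (Var 0)))) 1 (encode (w, f)) (encode (eq_step (w, f))) 1"
      by (intro runs_Assign; cases a; cases b) (simp_all add: w)
  qed (auto simp: w simp del: One_nat_def intro!: runs_Assign; cases a; cases b; simp)+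
qed

lemma ptime_tree_eq: "ptime (\<lambda>p :: tree \<times> tree. fst p = snd p)"
proof -
  have "\<exists>c. \<forall>w f. w \<noteq> [] \<longrightarrow> runs c 1 (encode (w, f)) (encode (eq_step (w, f))) 3"
    using runs_eq_step by blast
  then obtain c where c: "\<And>w f. w \<noteq> [] \<Longrightarrow> runs c 1 (encode (w, f)) (encode (eq_step (w, f))) 3"
    by blast
  let ?c = "Seq (Assign 0 (Cons_Ex (Cons_Ex (Var 0) Nil_Ex) (Cons_Ex Nil_Ex Nil_Ex)))
    (Seq (While (Hd (Var 0)) c) (Assign 0 (Tl (Var 0))))"
  show ?thesis
  proof (rule ptimeI)
    fix p :: "tree \<times> tree"
    obtain m where m: "m \<le> tsize (fst p)" "(eq_step ^^ m) ([p], True) = ([], fst p = snd p)"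
      "\<forall>i<m. fst ((eq_step ^^ i) ([p], True)) \<noteq> []"
      using eq_steps[of "[p]" True] by auto
    have "runs (While (Hd (Var 0)) c) 1
      (Node (encode (fst ((eq_step ^^ 0) ([p], True)))) (encode (snd ((eq_step ^^ 0) ([p], True)))))
      (Node (encode (fst ((eq_step ^^ m) ([p], True)))) (encode (snd ((eq_step ^^ m) ([p], True)))))
      (Suc (\<Sum>i<m. Suc 3))"
    proof (rule runs_while)
      fix i assume "i < m"
      then have i: "fst ((eq_step ^^ i) ([p], True)) \<noteq> []" using m by blast
      then show "encode (fst ((eq_step ^^ i) ([p], True))) \<noteq> Leaf"
        by (cases "fst ((eq_step ^^ i) ([p], True))") auto
      show "runs c 1
        (Node (encode (fst ((eq_step ^^ i) ([p], True)))) (encode (snd ((eq_step ^^ i) ([p], True)))))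
        (Node (encode (fst ((eq_step ^^ Suc i) ([p], True)))) (encode (snd ((eq_step ^^ Suc i) ([p], True))))) 3"
        using c[OF i, of "snd ((eq_step ^^ i) ([p], True))"] by (simp add: encode_prod_def)
    qed (simp add: m)
    then have loop: "runs (While (Hd (Var 0)) c) 1 (encode ([p], True))
      (encode ([] :: (tree \<times> tree) list, fst p = snd p)) (4 * m + 1)"
      by (simp add: m mult.commute)
    have "runs ?c 1 (encode p) (encode (fst p = snd p)) (1 + ((4 * m + 1) + 1))"
      by (rule runs_seq[OF runs_Assign runs_seq[OF loop runs_Assign]]) simp_all
    then show "\<exists>t \<le> 4 * tsize (fst p) + 5. runs ?c 1 (encode p) (encode (fst p = snd p)) t"
      using m(1) by (intro exI[of _ "1 + ((4 * m + 1) + 1)"]) simp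
    show "esize (fst p = snd p) \<le> 4 * tsize (fst p) + 5"
      by (simp add: encode_bool_def enc_bit_def)
  next
    show "poly_bounded (\<lambda>p :: tree \<times> tree. 4 * tsize (fst p) + 5)"
      using poly_bounded_esize[OF ptime_fst[OF ptime_id], where ?'b = tree]
      by (intro poly_bounded_add poly_bounded_mult) simp_all
  qed simp
qed

lemma ptime_eq: "ptime f \<Longrightarrow> ptime g \<Longrightarrow> ptime (\<lambda>x. f x = g x)"
  using ptime_comp[OF ptime_tree_eq ptime_Pair[of "\<lambda>x. encode (f x)" "\<lambda>x. encode (g x)"]]
  by (simp add: ptime_encode encode_inject)


subsection \<open>Folds\<close>

lemma esize_list: "esize xs = Suc (\<Sum>e\<leftarrow>xs. Suc (esize e))"
  by (induction xs) auto

lemma length_less_esize: "length xs < esize xs"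
  by (induction xs) auto

lemma esize_elem: "e \<in> set xs \<Longrightarrow> esize e < esize xs"
  by (induction xs) auto

lemma encode_list_map: "encode xs = enc_list (\<lambda>x. x) (map encode xs)"
  by (induction xs) auto

text \<open>The exponent \<open>d\<close> is uniform, and time is measured by a bound
  \<open>B\<close> on all sizes that occur. This also covers folds whose accumulator is not
  polynomial in the input, such as the unary expansion of a number.\<close>

lemma fold_runs:
  fixes g :: "'x :: encodable \<Rightarrow> 'b :: encodable \<Rightarrow> 'c :: encodable \<Rightarrow> 'b"
  assumes "ptime (\<lambda>z. g (fst z) (fst (snd z)) (snd (snd z)))"
  shows "\<exists>c N d. 0 < N \<and>
    (\<forall>l x a B. (\<forall>i\<le>length l. esize (foldl (g x) a (take i l)) + esize x + esize l \<le> B) \<longrightarrow>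
      (\<exists>t\<le>(B + 1) ^ d. runs c N (encode (l, x, a)) (encode (foldl (g x) a l)) t))"
proof -
  obtain c N T where c: "0 < N" "poly_bounded T" "\<And>z. \<exists>t\<le>T z. runs c N (encode z)
      (encode (g (fst z) (fst (snd z)) (snd (snd z)))) t"
    using assms unfolding ptime_def by blast
  obtain d where d: "\<And>z. T z \<le> (esize z + 1) ^ d"
    using c(2) unfolding poly_bounded_def by blast
  have c': "\<exists>t\<le>(esize (x, a, e) + 1) ^ d. runs c N (encode (x, a, e)) (encode (g x a e)) t" for x a e
    using c(3)[of "(x, a, e)"] d[of "(x, a, e)"] order_trans by (metis fst_conv snd_conv)
  define f where "f = Seq (While (Hd (Var 0)) (Seq (Assign N (Tl (Hd (Var 0)))) (Seq (Assign (N + 1) (Hd (Tl (Var 0))))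
    (Seq (Assign 0 (Cons_Ex (Hd (Tl (Var 0))) (Cons_Ex (Tl (Tl (Var 0))) (Hd (Hd (Var 0))))))
    (Seq c (Seq (Assign 0 (Cons_Ex (Var N) (Cons_Ex (Var (N + 1)) (Var 0))))
    (Seq (Assign N Nil_Ex) (Assign (N + 1) Nil_Ex)))))))) (Assign 0 (Tl (Tl (Var 0))))"
  show ?thesis
  proof (rule exI[of _ f], rule exI[of _ "N + 2"], rule exI[of _ "2 * d + 4"], intro conjI allI impI)
    show "0 < N + 2" by simp
    fix l :: "'c list" and x :: 'x and a :: 'b and B :: nat
    assume B': "\<forall>i\<le>length l. esize (foldl (g x) a (take i l)) + esize x + esize l \<le> B"
    then have B: "esize (foldl (g x) a (take i l)) + esize x + esize l \<le> B" if "i \<le> length l" for i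
      using that by blast
    define b where "b i = foldl (g x) a (take i l)" for i
    have b: "b (Suc i) = g x (b i) (l ! i)" if "i < length l" for i
      using that by (simp add: b_def take_Suc_conv_app_nth)
    have "\<exists>t\<le>(B + 3) ^ d. runs c N (encode (x, b i, l ! i)) (encode (b (Suc i))) t" if "i < length l" for i
    proof -
      have "esize (l ! i) < esize l" using that by (simp add: esize_elem)
      then have "esize (x, b i, l ! i) + 1 \<le> B + 3"
        using B[of i] that by (simp add: b_def)
      then have "(esize (x, b i, l ! i) + 1) ^ d \<le> (B + 3) ^ d" by (intro power_mono) simp_all
      then show ?thesis using c'[of x "b i" "l ! i"] b[OF that] order_trans by metis
    qed
    then obtain t where t: "\<And>i. i < length l \<Longrightarrow> t i \<le> (B + 3) ^ d"
      "\<And>i. i < length l \<Longrightarrow> runs c N (encode (x, b i, l ! i)) (encode (b (Suc i))) (t i)"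
      by metis
    let ?t = "Suc (\<Sum>i<length l. t i + 7) + 1"
    have "runs f (N + 2) (encode (l, x, a)) (encode (b (length l))) ?t"
      unfolding f_def
    proof (rule runs_seq)
      have "encode (l, x, a) = Node (enc_list (\<lambda>x. x) (map encode l)) (Node (encode x) (encode (b 0)))"
        by (simp add: b_def encode_list_map)
      then show "runs (While (Hd (Var 0)) (Seq (Assign N (Tl (Hd (Var 0)))) (Seq (Assign (N + 1) (Hd (Tl (Var 0))))
        (Seq (Assign 0 (Cons_Ex (Hd (Tl (Var 0))) (Cons_Ex (Tl (Tl (Var 0))) (Hd (Hd (Var 0))))))
        (Seq c (Seq (Assign 0 (Cons_Ex (Var N) (Cons_Ex (Var (N + 1)) (Var 0))))
        (Seq (Assign N Nil_Ex) (Assign (N + 1) Nil_Ex)))))))) (N + 2)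
        (encode (l, x, a)) (Node Leaf (Node (encode x) (encode (b (length l))))) (Suc (\<Sum>i<length l. t i + 7))"
        using runs_fold[of "map encode l" c N "encode x" "\<lambda>i. encode (b i)" t] t(2) c(1) by simp
      show "runs (Assign 0 (Tl (Tl (Var 0)))) (N + 2)
        (Node Leaf (Node (encode x) (encode (b (length l))))) (encode (b (length l))) 1"
        by (rule runs_Assign) simp
    qed
    \<comment> \<open>There are at most \<open>B\<close> rounds of at most
      \<open>(B + 3) ^ d + 7\<close> steps each. As \<open>B\<close> covers three nonempty trees,
      \<open>3 \<le> B\<close> and \<open>B + 3 \<le> (B + 1) ^ 2\<close>, whence the factor 2 in
      the exponent.\<close>
    moreover have "?t \<le> (B + 1) ^ (2 * d + 4)"
    proof -
      have B3: "3 \<le> B" "length l \<le> B"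
        using B[of 0] length_less_esize[of l] tsize_pos(1)[of "encode a"] tsize_pos(1)[of "encode x"]
        by (simp_all del: tsize_pos)
      have "(\<Sum>i<length l. t i + 7) \<le> (\<Sum>i<length l. (B + 3) ^ d + 7)"
        using t(1) by (intro sum_mono) simp
      also have "\<dots> \<le> B * ((B + 3) ^ d + 7)" using B3 by simp
      finally have 1: "?t \<le> B * ((B + 3) ^ d + 7) + 2" by simp
      have "B + 3 \<le> (B + 1) ^ 2" using B3 by (simp add: power2_eq_square)
      then have "(B + 3) ^ d \<le> ((B + 1) ^ 2) ^ d" by (intro power_mono) simp_all
      then have 2: "(B + 3) ^ d \<le> (B + 1) ^ (2 * d)" by (simp only: power_mult)
      define X where "X = (B + 1) ^ (2 * d)"
      have "1 \<le> X" by (simp add: X_def)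
      have "8 \<le> (B + 1) ^ 2" using power_mono[of 4 "B + 1" 2] B3 by simp
      then have "8 * X \<le> (B + 1) ^ 2 * X" by simp
      then have "(B + 3) ^ d + 7 \<le> (B + 1) ^ 2 * X"
        using 2 \<open>1 \<le> X\<close> unfolding X_def[symmetric] by linarith
      then have "?t \<le> B * ((B + 1) ^ 2 * X) + 2"
        using 1 by (meson add_le_mono1 mult_le_mono2 order_trans)
      also have "\<dots> \<le> B * ((B + 1) ^ 2 * X) + (B + 1) ^ 2 * X"
        using \<open>1 \<le> X\<close> \<open>8 * X \<le> (B + 1) ^ 2 * X\<close> by linarith
      also have "\<dots> = (B + 1) ^ 3 * X"
        by (simp add: algebra_simps power2_eq_square power3_eq_cube)
      also have "\<dots> \<le> (B + 1) ^ 4 * X" by (intro mult_le_mono1 power_increasing) simp_all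
      also have "\<dots> = (B + 1) ^ (2 * d + 4)" by (simp add: X_def power_add)
      finally show ?thesis .
    qed
    ultimately show "\<exists>t\<le>(B + 1) ^ (2 * d + 4). runs f (N + 2) (encode (l, x, a)) (encode (foldl (g x) a l)) t"
      by (auto simp: b_def)
  qed
qed

text \<open>The input itself is the context of the fold, so the step may depend on \<open>x\<close>.
  The bound \<open>B\<close> has to be supplied because a polynomial-time step may still double the
  accumulator in each round.\<close>

lemma ptime_foldl:
  assumes l: "ptime l" and a: "ptime a" and g: "ptime (\<lambda>z. g (fst z) (fst (snd z)) (snd (snd z)))"
    and "poly_bounded B" and B: "\<And>x i. i \<le> length (l x) \<Longrightarrow> esize (foldl (g x) (a x) (take i (l x))) \<le> B x"
  shows "ptime (\<lambda>x. foldl (g x) (a x) (l x))"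
proof -
  obtain c N d where c: "0 < N"
    "\<forall>l x a B. (\<forall>i\<le>length l. esize (foldl (g x) a (take i l)) + esize x + esize l \<le> B) \<longrightarrow>
      (\<exists>t\<le>(B + 1) ^ d. runs c N (encode (l, x, a)) (encode (foldl (g x) a l)) t)"
    using fold_runs[OF g] by (elim exE conjE) rule
  have "ptime (\<lambda>x. (l x, x, a x))" by (intro ptime_Pair l a ptime_id)
  then obtain c' N' T where c': "0 < N'" "poly_bounded T"
    "\<And>x. \<exists>t\<le>T x. runs c' N' (encode x) (encode (l x, x, a x)) t"
    unfolding ptime_def by blast
  let ?B = "\<lambda>x. B x + esize x + esize (l x)"
  let ?T = "\<lambda>x. T x + (?B x + 1) ^ d + B x"
  show ?thesis
  proof (rule ptimeI[where T = ?T])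
    fix x
    have "\<exists>t\<le>(?B x + 1) ^ d. runs c N (encode (l x, x, a x)) (encode (foldl (g x) (a x) (l x))) t"
      by (rule c(2)[rule_format]) (use B in simp)
    then obtain t u where "t \<le> (?B x + 1) ^ d" "u \<le> T x"
      "runs c N (encode (l x, x, a x)) (encode (foldl (g x) (a x) (l x))) t"
      "runs c' N' (encode x) (encode (l x, x, a x)) u"
      using c'(3)[of x] by blast
    then show "\<exists>t\<le>?T x. runs (Seq c' c) (max N N') (encode x) (encode (foldl (g x) (a x) (l x))) t"
      by (intro exI[of _ "u + t"] conjI runs_seq) (auto intro: runs_mono)
    show "esize (foldl (g x) (a x) (l x)) \<le> ?T x"
      using B[of "length (l x)" x] by simp
  next
    show "poly_bounded ?T"
      using c'(2) assms(4) l
      by (intro poly_bounded_add poly_bounded_power poly_bounded_const poly_bounded_esize ptime_id)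
  qed (use c(1) in simp)
qed

subsection \<open>Lists\<close>

lemma esize_append: "Suc (esize (xs @ ys)) = esize xs + esize ys"
  by (induction xs) auto

lemma esize_rev [simp]: "esize (rev xs) = esize xs"
  by (simp add: esize_list rev_map[symmetric] flip: rev_map)

lemma esize_take: "esize (take i xs) \<le> esize xs"
  using esize_append[of "take i xs" "drop i xs"] tsize_pos(1)[of "encode (drop i xs)"]
  unfolding append_take_drop_id by (simp del: tsize_pos)

lemma esize_concat: "esize (concat xss) \<le> esize xss"
proof (induction xss)
  case (Cons xs xss)
  then show ?case using esize_append[of xs "concat xss"] by simp
qed simp

lemma esize_map_le:
  assumes "\<And>e. e \<in> set xs \<Longrightarrow> esize (f e) \<le> M" "length xs \<le> L"
  shows "esize (map f xs) \<le> L * (M + 1) + 1"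
proof -
  have "(\<Sum>e\<leftarrow>xs. Suc (esize (f e))) \<le> (\<Sum>e\<leftarrow>xs. M + 1)"
    using assms(1) by (intro sum_list_mono) simp
  also have "\<dots> = length xs * (M + 1)" by (simp add: sum_list_triv)
  also have "\<dots> \<le> L * (M + 1)" using assms(2) by (rule mult_le_mono1)
  finally show ?thesis by (simp add: esize_list comp_def)
qed

lemma poly_bounded_length: "ptime l \<Longrightarrow> poly_bounded (\<lambda>x. length (l x))"
  using poly_bounded_esize[of l]
  by (auto elim!: poly_bounded_mono intro: less_imp_le length_less_esize)

lemma foldl_rev_map: "foldl (\<lambda>acc e. f e # acc) ys xs = rev (map f xs) @ ys"
  by (induction xs arbitrary: ys) auto

lemma ptime_rev: "ptime l \<Longrightarrow> ptime (\<lambda>x. rev (l x))"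
proof -
  assume l: "ptime l"
  have "ptime (\<lambda>x. foldl (\<lambda>acc e. e # acc) [] (l x))"
    using l
    by (rule ptime_foldl[where B = "\<lambda>x. esize (l x)"])
      (intro ptime_const ptime_Cons ptime_fst ptime_snd ptime_id poly_bounded_esize l
        | simp add: foldl_rev_map[of "\<lambda>x. x", simplified] esize_take)+
  then show ?thesis by (rule ptime_cong) (simp add: foldl_rev_map[of "\<lambda>x. x", simplified])
qed

lemma ptime_append:
  assumes "ptime k" "ptime l"
  shows "ptime (\<lambda>x. k x @ l x)"
proof -
  have eq: "foldl (\<lambda>acc e. e # acc) ys zs = rev zs @ ys" for zs ys :: "'c list"
    using foldl_rev_map[of "\<lambda>x. x" ys zs] by simp
  have "ptime (\<lambda>x. foldl (\<lambda>acc e. e # acc) (l x) (rev (k x)))"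
  proof (rule ptime_foldl[where B = "\<lambda>x. esize (k x) + esize (l x)"])
    fix x i
    show "esize (foldl (\<lambda>acc e. e # acc) (l x) (take i (rev (k x)))) \<le> esize (k x) + esize (l x)"
      using esize_take[of i "rev (k x)"] esize_append[of "rev (take i (rev (k x)))" "l x"]
      by (simp add: eq)
  qed (intro ptime_Cons ptime_fst ptime_snd ptime_id ptime_rev poly_bounded_add poly_bounded_esize assms)+
  then show ?thesis by (rule ptime_cong) (simp add: eq)
qed

lemma ptime_map:
  assumes l: "ptime l" and f: "ptime (\<lambda>z. f (fst z) (snd z))"
  shows "ptime (\<lambda>x. map (f x) (l x))"
proof -
  obtain d where d: "\<And>z. esize (f (fst z) (snd z)) \<le> (esize z + 1) ^ d"
    using poly_bounded_esize[OF f] unfolding poly_bounded_def by blast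
  let ?M = "\<lambda>x. (esize x + esize (l x) + 1) ^ d"
  have M: "esize (f x e) \<le> ?M x" if "e \<in> set (l x)" for x e
  proof -
    have "(esize (x, e) + 1) ^ d \<le> ?M x"
      using esize_elem[OF that] by (intro power_mono) simp_all
    then show ?thesis using d[of "(x, e)"] by simp
  qed
  have "ptime (\<lambda>x. foldl (\<lambda>acc e. f x e # acc) [] (l x))"
  proof (rule ptime_foldl[where B = "\<lambda>x. length (l x) * (?M x + 1) + 1"])
    have "ptime (\<lambda>z::'a \<times> 'c list \<times> 'b. (fst z, snd (snd z)))"
      by (intro ptime_Pair ptime_fst ptime_snd ptime_id)
    from ptime_comp[OF f this]
    show "ptime (\<lambda>z. f (fst z) (snd (snd z)) # fst (snd z))"
      by (intro ptime_Cons ptime_fst ptime_snd ptime_id) simp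
    fix x i
    show "esize (foldl (\<lambda>acc e. f x e # acc) [] (take i (l x))) \<le> length (l x) * (?M x + 1) + 1"
      unfolding foldl_rev_map append_Nil2 esize_rev
      by (rule esize_map_le) (erule M[OF in_set_takeD], simp)
  qed (intro l ptime_const poly_bounded_add poly_bounded_mult poly_bounded_power poly_bounded_esize
      poly_bounded_length poly_bounded_const ptime_id)+
  from ptime_rev[OF this] show ?thesis by (rule ptime_cong) (simp add: foldl_rev_map)
qed

lemma ptime_concat:
  assumes "ptime l"
  shows "ptime (\<lambda>x. concat (l x))"
proof -
  have eq: "foldl (\<lambda>acc xs. acc @ xs) ys xss = ys @ concat xss" for ys :: "'b list" and xss
    by (induction xss arbitrary: ys) auto
  have "ptime (\<lambda>x. foldl (\<lambda>acc xs. acc @ xs) [] (l x))"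
  proof (rule ptime_foldl[where B = "\<lambda>x. esize (l x)"])
    fix x i
    show "esize (foldl (\<lambda>acc xs. acc @ xs) [] (take i (l x))) \<le> esize (l x)"
      using esize_concat[of "take i (l x)"] esize_take[of i "l x"] by (simp add: eq)
  qed (intro assms ptime_const ptime_append ptime_fst ptime_snd ptime_id poly_bounded_esize)+
  then show ?thesis by (rule ptime_cong) (simp add: eq)
qed

lemma ptime_filter:
  assumes l: "ptime l" and "ptime (\<lambda>z. P (fst z) (snd z))"
  shows "ptime (\<lambda>x. filter (P x) (l x))"
proof -
  have "ptime (\<lambda>x. concat (map (\<lambda>e. if P x e then [e] else []) (l x)))"
    by (intro ptime_concat ptime_map ptime_if ptime_Cons ptime_const ptime_snd ptime_id assms)
  moreover have "concat (map (\<lambda>e. if Q e then [e] else []) ys) = filter Q ys" for Q and ys :: "'b list"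
    by (induction ys) auto
  ultimately show ?thesis by (simp only:)
qed

lemma ptime_Bex:
  assumes "ptime l" "ptime (\<lambda>z. P (fst z) (snd z))"
  shows "ptime (\<lambda>x. \<exists>e \<in> set (l x). P x e)"
proof -
  have "ptime (\<lambda>x. filter (P x) (l x) \<noteq> [])"
    by (intro ptime_not ptime_eq ptime_filter ptime_const assms)
  then show ?thesis by (rule ptime_cong) (simp add: filter_empty_conv)
qed

lemma ptime_Ball:
  assumes "ptime l" "ptime (\<lambda>z. P (fst z) (snd z))"
  shows "ptime (\<lambda>x. \<forall>e \<in> set (l x). P x e)"
proof -
  have "ptime (\<lambda>x. \<not> (\<exists>e \<in> set (l x). \<not> P x e))"
    by (intro ptime_not ptime_Bex assms)
  then show ?thesis by (rule ptime_cong) simp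
qed

lemma ptime_member:
  assumes "ptime f" "ptime l"
  shows "ptime (\<lambda>x. f x \<in> set (l x))"
proof -
  have "ptime (\<lambda>x. \<exists>e \<in> set (l x). f x = e)"
    by (intro ptime_Bex ptime_eq ptime_snd ptime_id assms ptime_comp[OF assms(1) ptime_fst[OF ptime_id]])
  then show ?thesis by (rule ptime_cong) auto
qed

text \<open>\<open>take 1\<close> replaces \<open>hd\<close>, whose value on the empty list is
  unspecified.\<close>

lemma ptime_take1: "ptime f \<Longrightarrow> ptime (\<lambda>x. take 1 (f x))"
proof (rule ptime_comp[of "take 1"])
  let ?hd = "\<lambda>t. case t of Leaf \<Rightarrow> Leaf | Node l r \<Rightarrow> l"
  have "ptime ?hd"
    by (rule ptime_expr[of "Hd (Var 0)"]) simp
  moreover have "ptime (\<lambda>xs :: 'b list. encode xs)"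
    by (simp add: ptime_encode ptime_id)
  ultimately have "ptime (\<lambda>xs :: 'b list. ?hd (encode xs))"
    by (rule ptime_comp)
  then have "ptime (\<lambda>xs :: 'b list. if xs = [] then [] else [?hd (encode xs)])"
    by (intro ptime_if ptime_eq ptime_id ptime_const ptime_Cons)
  then show "ptime (take 1 :: 'b list \<Rightarrow> 'b list)"
  proof (rule ptime_same_encode[rotated])
    show "encode (if xs = [] then [] else [?hd (encode xs)]) = encode (take 1 xs)" for xs :: "'b list"
      by (cases xs) auto
  qed
qed

text \<open>The exponent \<open>n\<close> does not depend on the input: the result has
  \<open>length (l x) ^ n\<close> members, polynomially many only for constant
  \<open>n\<close>.\<close>

lemma ptime_n_lists: "ptime l \<Longrightarrow> ptime (\<lambda>x. List.n_lists n (l x))"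
proof (induction n)
  case 0
  then show ?case by (simp add: ptime_const)
next
  case (Suc n)
  have "ptime (\<lambda>z. l (fst z))" using ptime_comp[OF Suc.prems ptime_fst[OF ptime_id]] .
  then show ?case
    unfolding List.n_lists.simps
    by (intro ptime_concat ptime_map ptime_Cons ptime_snd ptime_fst ptime_id Suc)
qed

text \<open>Running through the tails gives access to an element along with all later ones, which
  replaces index arithmetic in programs. The empty tail is included, as it occurs as the component
  \<open>D\<close> of an item.\<close>

fun tails :: "'a list \<Rightarrow> 'a list list" where
  "tails [] = [[]]"
| "tails (x # xs) = (x # xs) # tails xs"

lemma set_tails: "set (tails xs) = {ys. \<exists>zs. xs = zs @ ys}"
  by (induction xs) (auto simp: Cons_eq_append_conv)

lemma concat_take1_tails: "concat (take 1 (tails xs)) = xs"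
  by (cases xs) auto

lemma ptime_tails: "ptime l \<Longrightarrow> ptime (\<lambda>x. tails (l x))"
proof -
  assume l: "ptime l"
  let ?f = "\<lambda>acc e. (e # concat (take 1 acc)) # acc"
  have eq: "foldl ?f [[]] (rev ys) = tails ys" for ys :: "'b list"
    by (induction ys) (simp_all add: concat_take1_tails[simplified])
  have size: "esize (tails ys) \<le> (length ys + 1) * (esize ys + 1) + 1" for ys :: "'b list"
  proof -
    have "length (tails ys) = length ys + 1" by (induction ys) auto
    moreover have "esize zs \<le> esize ys" if zs: "zs \<in> set (tails ys)" for zs
    proof -
      obtain ws where "ys = ws @ zs" using zs by (auto simp: set_tails)
      then show ?thesis
        using esize_append[of ws zs] tsize_pos(1)[of "encode ws"] by (simp del: tsize_pos)
    qed
    ultimately show ?thesis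
      using esize_map_le[of "tails ys" "\<lambda>x. x" "esize ys" "length ys + 1"] by simp
  qed
  have "ptime (\<lambda>x. foldl ?f [[]] (rev (l x)))"
  proof (rule ptime_foldl[where B = "\<lambda>x. (length (l x) + 1) * (esize (l x) + 1) + 1"])
    fix x i
    define ys where "ys = rev (take i (rev (l x)))"
    have 1: "foldl ?f [[]] (take i (rev (l x))) = tails ys"
      unfolding eq[symmetric] by (simp add: ys_def)
    have "length ys \<le> length (l x)" by (simp add: ys_def)
    moreover have "esize ys \<le> esize (l x)"
      using esize_take[of i "rev (l x)"] by (simp add: ys_def)
    ultimately have "(length ys + 1) * (esize ys + 1) \<le> (length (l x) + 1) * (esize (l x) + 1)"
      by (intro mult_le_mono) simp_all
    then show "esize (foldl ?f [[]] (take i (rev (l x)))) \<le> (length (l x) + 1) * (esize (l x) + 1) + 1"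
      using size[of ys] unfolding 1 by linarith
  qed (intro l ptime_rev ptime_const ptime_Cons ptime_concat ptime_take1 ptime_fst ptime_snd ptime_id
      poly_bounded_add poly_bounded_mult poly_bounded_esize poly_bounded_length poly_bounded_const)+
  then show ?thesis by (rule ptime_cong) (rule eq)
qed

text \<open>Lists serve as unary numbers: dropping is truncated subtraction, which will yield the
  budget.\<close>

lemma ptime_drop_length:
  assumes "ptime k" "ptime l"
  shows "ptime (\<lambda>x. drop (length (k x)) (l x))"
proof -
  have eq: "foldl (\<lambda>acc _. tl acc) ys zs = drop (length zs) ys" for ys :: "'c list" and zs :: "'b list"
    by (induction zs arbitrary: ys) (auto simp: drop_Suc)
  have "ptime (\<lambda>x. foldl (\<lambda>acc _. tl acc) (l x) (k x))"
  proof (rule ptime_foldl[where B = "\<lambda>x. esize (l x)"])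
    fix x i
    show "esize (foldl (\<lambda>acc _. tl acc) (l x) (take i (k x))) \<le> esize (l x)"
      using esize_append[of "take (length (take i (k x))) (l x)" "drop (length (take i (k x))) (l x)"]
        tsize_pos(1)[of "encode (take (length (take i (k x))) (l x))"]
      unfolding append_take_drop_id by (simp add: eq del: tsize_pos)
  qed (intro assms ptime_tl ptime_fst ptime_snd ptime_id poly_bounded_esize)+
  then show ?thesis by (rule ptime_cong) (rule eq)
qed


subsection \<open>Numbers\<close>

text \<open>This list has the same tree as the number and gives folds access to its digits.\<close>

function bits :: "nat \<Rightarrow> bool list" where
  "bits n = (if n = 0 then [] else odd n # bits (n div 2))"
  by auto
termination by (relation "measure id") auto

declare bits.simps [simp del]

lemma bits_0 [simp]: "bits 0 = []"
  by (simp add: bits.simps)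

lemma encode_bits: "encode (bits n) = encode n"
proof (induction n rule: less_induct)
  case (less n)
  then show ?case
    by (subst bits.simps) (auto simp: encode_nat_def encode_bool_def enc_nat.simps[of n])
qed

fun incr :: "bool list \<Rightarrow> bool list" where
  "incr [] = [True]"
| "incr (b # bs) = (if b then False # incr bs else True # bs)"

lemma bits_Suc: "bits (Suc n) = incr (bits n)"
proof (induction n rule: less_induct)
  case (less n)
  show ?case
  proof (cases "n = 0")
    case True
    then show ?thesis by (simp add: bits.simps)
  next
    case False
    have "odd n \<Longrightarrow> Suc n div 2 = Suc (n div 2)" "even n \<Longrightarrow> Suc n div 2 = n div 2"
      by presburger+
    then show ?thesis
      using less[of "n div 2"] False by (auto simp: bits.simps[of n] bits.simps[of "Suc n"])
  qed
qed

lemma esize_nat_Suc: "esize (Suc n) \<le> esize n + 4"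
proof -
  have "esize (incr bs) \<le> esize bs + 4" for bs
    by (induction bs) auto
  then show ?thesis
    using bits_Suc[of n] encode_bits[of n] encode_bits[of "Suc n"] by metis
qed

lemma esize_nat: "esize (n :: nat) \<le> 4 * n + 1"
proof (induction n)
  case 0
  show ?case by (simp add: encode_nat_def enc_nat.simps)
next
  case (Suc n)
  then show ?case using esize_nat_Suc[of n] by simp
qed

lemma ptime_Suc: "ptime f \<Longrightarrow> ptime (\<lambda>x. Suc (f x))"
proof (rule ptime_comp[of Suc])
  \<comment> \<open>Ripple carry: the accumulator holds the carry and the digits so far in reverse;
    \<open>fst acc = (\<not> b)\<close> is exclusive or. A carry that survives the fold becomes a
    new top digit.\<close>
  let ?f = "\<lambda>(acc :: bool \<times> bool list) b. (fst acc \<and> b, (fst acc = (\<not> b)) # snd acc)"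
  let ?g = "\<lambda>bs. foldl ?f (True, []) bs"
  have g: "foldl ?f (c, acc) bs = (c \<and> (\<forall>b \<in> set bs. b), rev (if c then take (length bs) (incr bs) else bs) @ acc)"
    for bs c acc
    by (induction bs arbitrary: c acc) auto
  have incr: "incr bs = take (length bs) (incr bs) @ (if \<forall>b \<in> set bs. b then [True] else [])" for bs
    by (induction bs) auto
  have sz: "esize (incr bs) \<le> esize bs + 4" for bs
    by (induction bs) auto
  have "ptime (\<lambda>bs. ?g bs)"
  proof (rule ptime_foldl[where B = "\<lambda>bs. esize bs + 8"])
    fix bs :: "bool list" and i
    let ?t = "take (length (take i bs)) (incr (take i bs))"
    have "esize ?t \<le> esize bs + 4"
      using esize_take[of "length (take i bs)" "incr (take i bs)"] sz[of "take i bs"] esize_take[of i bs]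
      by linarith
    moreover have "esize (b :: bool) \<le> 3" for b by (cases b) auto
    from this[of "\<forall>b \<in> set (take i bs). b"] have "esize (\<forall>b \<in> set (take i bs). b) \<le> 3" .
    ultimately have "esize (\<forall>b \<in> set (take i bs). b, rev ?t) \<le> esize bs + 8"
      unfolding encode_Pair tsize.simps esize_rev by linarith
    then show "esize (?g (take i bs)) \<le> esize bs + 8"
      unfolding g if_True simp_thms append_Nil2 .
  qed (intro ptime_id ptime_const ptime_Pair ptime_conj ptime_not ptime_eq ptime_Cons ptime_fst ptime_snd
      poly_bounded_add poly_bounded_esize poly_bounded_const)+
  then have "ptime (\<lambda>bs. rev (snd (?g bs)) @ (if fst (?g bs) then [True] else []))"
    by (intro ptime_append ptime_rev ptime_snd ptime_fst ptime_if ptime_const)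
  then have "ptime incr"
    by (rule ptime_cong)
      (unfold g if_True simp_thms fst_conv snd_conv append_Nil2 rev_rev_ident, rule incr[symmetric])
  moreover have "ptime bits"
    by (rule ptime_same_encode[OF _ ptime_id]) (simp add: encode_bits)
  ultimately have "ptime (\<lambda>n. incr (bits n))" by (rule ptime_comp)
  then show "ptime Suc"
    by (rule ptime_same_encode[rotated]) (simp add: encode_bits flip: bits_Suc)
qed

lemma ptime_length:
  assumes "ptime l"
  shows "ptime (\<lambda>x. length (l x))"
proof -
  have eq: "foldl (\<lambda>n _. Suc n) m xs = m + length xs" for m and xs :: "'b list"
    by (induction xs arbitrary: m) auto
  have "ptime (\<lambda>x. foldl (\<lambda>n _. Suc n) 0 (l x))"
  proof (rule ptime_foldl[where B = "\<lambda>x. 4 * length (l x) + 1"])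
    fix x i
    show "esize (foldl (\<lambda>n _. Suc n) 0 (take i (l x))) \<le> 4 * length (l x) + 1"
      unfolding eq using esize_nat[of "length (take i (l x))"] by simp
  qed (intro assms ptime_const ptime_Suc ptime_fst ptime_snd ptime_id poly_bounded_add poly_bounded_mult
      poly_bounded_const poly_bounded_length)+
  then show ?thesis by (rule ptime_cong) (simp add: eq)
qed

lemma ptime_enumerate:
  assumes l: "ptime l"
  shows "ptime (\<lambda>x. List.enumerate 0 (l x))"
proof -
  have eq: "foldl (\<lambda>acc e. (length acc, e) # acc) [] xs = rev (List.enumerate 0 xs)" for xs :: "'b list"
    by (induction xs rule: rev_induct) (simp_all add: enumerate_append_eq)
  have "ptime (\<lambda>x. foldl (\<lambda>acc e. (length acc, e) # acc) [] (l x))"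
  proof (rule ptime_foldl[where B = "\<lambda>x. length (l x) * (4 * length (l x) + 2 + esize (l x) + 1) + 1"])
    fix x i
    have "esize p \<le> 4 * length (l x) + 2 + esize (l x)" if "p \<in> set (List.enumerate 0 (take i (l x)))" for p
    proof -
      have "fst p < length (l x)" "snd p \<in> set (l x)"
        using that by (auto simp: in_set_enumerate_eq dest: nth_mem)
      then show ?thesis
        using esize_nat[of "fst p"] esize_elem[of "snd p" "l x"] by (simp add: encode_prod_def)
    qed
    then have "esize (map (\<lambda>p. p) (List.enumerate 0 (take i (l x))))
      \<le> length (l x) * (4 * length (l x) + 2 + esize (l x) + 1) + 1"
      by (intro esize_map_le) simp_all
    then show "esize (foldl (\<lambda>acc e. (length acc, e) # acc) [] (take i (l x)))
      \<le> length (l x) * (4 * length (l x) + 2 + esize (l x) + 1) + 1"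
      unfolding eq esize_rev list.map_ident .
  qed (intro assms ptime_const ptime_Cons ptime_Pair ptime_length ptime_fst ptime_snd ptime_id
      poly_bounded_add poly_bounded_mult poly_bounded_const poly_bounded_length poly_bounded_esize)+
  from ptime_rev[OF this] show ?thesis by (rule ptime_cong) (simp add: eq)
qed

lemma ptime_upt:
  assumes "ptime l"
  shows "ptime (\<lambda>x. [0..<length (l x)])"
proof -
  have "ptime (\<lambda>x. map fst (List.enumerate 0 (l x)))"
    by (intro ptime_map ptime_fst ptime_snd ptime_id ptime_enumerate assms)
  then show ?thesis by (rule ptime_cong) simp
qed

section \<open>Parameterized reductions\<close>

subsection \<open>Computable bounds\<close>

definition total_computable :: "('a :: encodable \<Rightarrow> 'b :: encodable) \<Rightarrow> bool" where
  "total_computable f \<longleftrightarrow> (\<exists>c N. 0 < N \<and> (\<forall>x. \<exists>t. runs c N (encode x) (encode (f x)) t))"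

lemma computable_iff: "computable f \<longleftrightarrow> total_computable f"
proof
  assume "computable f"
  then obtain c where c: "\<And>n. \<exists>t. computes_in c (enc_nat n) (enc_nat (f n)) t"
    unfolding computable_def by blast
  obtain d N where d: "0 < N"
    "\<And>x t s. exec c ((\<lambda>_. Leaf)(0 := x)) t s \<Longrightarrow> runs d N x (s 0) (t + N)"
    using normalize_com[of c] by blast
  have "\<exists>t. runs d N (encode n) (encode (f n)) t" for n
    using c[of n] d(2) unfolding computes_in_def encode_nat_def by metis
  then show "total_computable f"
    unfolding total_computable_def using d(1) by blast
next
  assume "total_computable f"
  then show "computable f"
    unfolding total_computable_def computable_def encode_nat_def by (meson runs_computes_in)
qed

lemma total_computable_ptime: "ptime f \<Longrightarrow> total_computable f"
  unfolding ptime_def total_computable_def by blast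

lemma total_computable_comp:
  assumes "total_computable g" "total_computable f"
  shows "total_computable (\<lambda>x. g (f x))"
proof -
  obtain c M d N where "0 < M" "\<And>x. \<exists>t. runs c M (encode x) (encode (f x)) t"
    "0 < N" "\<And>x. \<exists>t. runs d N (encode x) (encode (g x)) t"
    using assms unfolding total_computable_def by blast
  then have "\<exists>t. runs (Seq c d) (max M N) (encode x) (encode (g (f x))) t" for x
    by (meson max.cobounded1 max.cobounded2 runs_mono runs_seq)
  then show ?thesis
    unfolding total_computable_def using \<open>0 < M\<close> by (metis less_max_iff_disj)
qed

lemma total_computable_Pair:
  assumes "total_computable f" "total_computable g"
  shows "total_computable (\<lambda>x. (f x, g x))"
proof -
  obtain c M d N where *: "0 < M" "\<And>x. \<exists>t. runs c M (encode x) (encode (f x)) t"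
    "0 < N" "\<And>x. \<exists>t. runs d N (encode x) (encode (g x)) t"
    using assms unfolding total_computable_def by blast
  define K where "K = max M N"
  have K: "0 < K" "\<exists>t. runs c K (encode x) (encode (f x)) t" "\<exists>t. runs d K (encode x) (encode (g x)) t" for x
    using * unfolding K_def by (auto intro: runs_mono max.cobounded1 max.cobounded2 simp: less_max_iff_disj)
      (meson max.cobounded1 max.cobounded2 runs_mono)+
  show ?thesis
    unfolding total_computable_def encode_Pair
    using runs_pair[of c K _ _ _ d] K by (metis add_gr_0 K(1))
qed

fun unbits :: "bool list \<Rightarrow> nat" where
  "unbits [] = 0"
| "unbits (b # bs) = of_bool b + 2 * unbits bs"

lemma unbits_append_True: "2 ^ length bs \<le> unbits (bs @ [True])"
  by (induction bs) auto

text \<open>The final \<open>True\<close> is the most significant bit and rules out leading zeros,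
  so the list is a canonical encoding.\<close>

lemma encode_unbits: "encode (unbits (bs @ [True])) = encode (bs @ [True])"
proof (induction bs)
  case Nil
  show ?case by (simp add: encode_nat_def enc_nat.simps enc_bit_def)
next
  case (Cons b bs)
  have "unbits (bs @ [True]) \<noteq> 0" using unbits_append_True[of bs] by (metis le_zero_eq power_eq_0_iff zero_neq_numeral)
  then show ?case
    using Cons by (auto simp: encode_nat_def encode_bool_def enc_nat.simps[of "Suc _"] enc_nat.simps[of "2 * _"])
qed

lemma less_power_length_bits: "n < 2 ^ length (bits n)"
proof (induction n rule: less_induct)
  case (less n)
  show ?case
  proof (cases "n = 0")
    case False
    then have "n div 2 < 2 ^ length (bits (n div 2))" using less by simp
    then have "n < 2 * 2 ^ length (bits (n div 2))" by simp
    then show ?thesis using False by (subst bits.simps) simp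
  qed simp
qed

text \<open>
  As time bounds may be rounded up, it suffices to concatenate the bits of two numbers instead of
  adding or multiplying them.
\<close>

definition bits_concat :: "nat \<times> nat \<Rightarrow> nat" where
  "bits_concat p = unbits (bits (fst p) @ bits (snd p) @ [True])"

lemma ptime_bits: "ptime f \<Longrightarrow> ptime (\<lambda>x. bits (f x))"
  by (rule ptime_same_encode[of f]) (simp_all add: encode_bits)

lemma ptime_bits_concat: "ptime bits_concat"
proof (rule ptime_same_encode)
  show "ptime (\<lambda>p. (bits (fst p) @ bits (snd p)) @ [True])"
    by (intro ptime_append ptime_bits ptime_fst ptime_snd ptime_id ptime_const)
  show "encode ((bits (fst p) @ bits (snd p)) @ [True]) = encode (bits_concat p)" for p
    unfolding bits_concat_def by (subst encode_unbits[symmetric]) simp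
qed

lemma bits_concat_ge: "(x + 1) * (y + 1) \<le> bits_concat (x, y)"
proof -
  have "(x + 1) * (y + 1) \<le> 2 ^ length (bits x) * 2 ^ length (bits y)"
    using less_power_length_bits by (intro mult_le_mono) (simp_all add: Suc_le_eq)
  also have "\<dots> \<le> bits_concat (x, y)"
    using unbits_append_True[of "bits x @ bits y"] by (simp add: bits_concat_def power_add)
  finally show ?thesis .
qed

text \<open>Running times are upper bounds, so domination by a computable function is enough; it is
  closed under arithmetic without exact programs for the operations.\<close>

definition comp_bounded :: "(nat \<Rightarrow> nat) \<Rightarrow> bool" where
  "comp_bounded f \<longleftrightarrow> (\<exists>h. computable h \<and> (\<forall>n. f n \<le> h n))"

lemma comp_bounded_computable: "computable f \<Longrightarrow> comp_bounded f"
  unfolding comp_bounded_def by blast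

lemma comp_bounded_const: "comp_bounded (\<lambda>_. n)"
  by (simp add: comp_bounded_computable computable_iff total_computable_ptime ptime_const)

lemma comp_bounded_id: "comp_bounded (\<lambda>n. n)"
  by (simp add: comp_bounded_computable computable_iff total_computable_ptime ptime_id)

lemma comp_bounded_comp: "comp_bounded f \<Longrightarrow> computable g \<Longrightarrow> comp_bounded (\<lambda>n. f (g n))"
  unfolding comp_bounded_def computable_iff using total_computable_comp by blast

text \<open>The added ones let this product dominate both the product and the sum of
  \<open>f\<close> and \<open>g\<close>.\<close>

lemma comp_bounded_mult_Suc:
  assumes "comp_bounded f" "comp_bounded g"
  shows "comp_bounded (\<lambda>n. (f n + 1) * (g n + 1))"
proof -
  obtain h i where hi: "computable h" "computable i" "\<And>n. f n \<le> h n" "\<And>n. g n \<le> i n"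
    using assms unfolding comp_bounded_def by blast
  have "(f n + 1) * (g n + 1) \<le> bits_concat (h n, i n)" for n
    using hi(3,4)[of n] by (intro order_trans[OF mult_le_mono bits_concat_ge]) simp_all
  moreover have "computable (\<lambda>n. bits_concat (h n, i n))"
    using hi(1,2) unfolding computable_iff
    by (intro total_computable_comp[OF total_computable_ptime[OF ptime_bits_concat]] total_computable_Pair)
  ultimately show ?thesis
    unfolding comp_bounded_def by blast
qed

lemma comp_bounded_mono: "comp_bounded f \<Longrightarrow> (\<And>n. g n \<le> f n) \<Longrightarrow> comp_bounded g"
  unfolding comp_bounded_def by (meson order_trans)

lemma comp_bounded_mult: "comp_bounded f \<Longrightarrow> comp_bounded g \<Longrightarrow> comp_bounded (\<lambda>n. f n * g n)"
  by (rule comp_bounded_mono[OF comp_bounded_mult_Suc[of f g]]) auto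

lemma comp_bounded_add: "comp_bounded f \<Longrightarrow> comp_bounded g \<Longrightarrow> comp_bounded (\<lambda>n. f n + g n)"
  by (rule comp_bounded_mono[OF comp_bounded_mult_Suc[of f g]]) auto

lemma comp_bounded_power: "comp_bounded f \<Longrightarrow> comp_bounded (\<lambda>n. f n ^ d)"
  by (induction d) (auto intro: comp_bounded_mult comp_bounded_const simp del: One_nat_def)

section \<open>Composition of parameterized reductions\<close>

lemma fpt_reducibleI:
  assumes "comp_bounded f" "computable g"
    and "\<And>x k. (x, k) \<in> insts P \<Longrightarrow> \<exists>y t. computes_in c (enc_inst x k) (enc_inst y (g k)) t \<and>
      t \<le> f k * tsize (enc_inst x k) ^ d \<and> (y, g k) \<in> insts Q \<and>
      ((x, k) \<in> yes_insts P \<longleftrightarrow> (y, g k) \<in> yes_insts Q)"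
  shows "P \<le>fpt Q"
proof -
  obtain h where h: "computable h" "\<And>n. f n \<le> h n"
    using assms(1) unfolding comp_bounded_def by blast
  show ?thesis
    unfolding fpt_reducible_def
  proof (rule exI[of _ c], rule exI[of _ h], rule exI[of _ g], rule exI[of _ d], intro conjI allI impI)
    fix x k assume "(x, k) \<in> insts P"
    from assms(3)[OF this] obtain y t where *: "computes_in c (enc_inst x k) (enc_inst y (g k)) t"
      "t \<le> f k * tsize (enc_inst x k) ^ d" "(y, g k) \<in> insts Q"
      "(x, k) \<in> yes_insts P \<longleftrightarrow> (y, g k) \<in> yes_insts Q" by blast
    have "t \<le> h k * tsize (enc_inst x k) ^ d"
      using *(2) h(2)[of k] mult_le_mono1 order_trans by blast
    then show "\<exists>y t. computes_in c (enc_inst x k) (enc_inst y (g k)) t \<and>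
      t \<le> h k * tsize (enc_inst x k) ^ d \<and> (y, g k) \<in> insts Q \<and>
      ((x, k) \<in> yes_insts P \<longleftrightarrow> (y, g k) \<in> yes_insts Q)" using * by blast
  qed (fact h(1) assms(2))+
qed

text \<open>The time of \<open>computes_in\<close> includes the size of the output, so it also
  bounds the instance handed to the second reduction. Computability of \<open>g1\<close> makes
  \<open>f2 (g1 k)\<close> a computable bound.\<close>

lemma fpt_reducible_trans:
  assumes "P \<le>fpt Q" "Q \<le>fpt R"
  shows "P \<le>fpt R"
proof -
  obtain c1 f1 g1 d1 where 1: "computable f1" "computable g1"
    "\<And>x k. (x, k) \<in> insts P \<Longrightarrow> \<exists>y t. computes_in c1 (enc_inst x k) (enc_inst y (g1 k)) t \<and>
      t \<le> f1 k * tsize (enc_inst x k) ^ d1 \<and> (y, g1 k) \<in> insts Q \<and>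
      ((x, k) \<in> yes_insts P \<longleftrightarrow> (y, g1 k) \<in> yes_insts Q)"
    using assms(1) unfolding fpt_reducible_def by blast
  obtain c2 f2 g2 d2 where 2: "computable f2" "computable g2"
    "\<And>x k. (x, k) \<in> insts Q \<Longrightarrow> \<exists>y t. computes_in c2 (enc_inst x k) (enc_inst y (g2 k)) t \<and>
      t \<le> f2 k * tsize (enc_inst x k) ^ d2 \<and> (y, g2 k) \<in> insts R \<and>
      ((x, k) \<in> yes_insts Q \<longleftrightarrow> (y, g2 k) \<in> yes_insts R)"
    using assms(2) unfolding fpt_reducible_def by blast
  obtain e1 N1 where e1: "0 < N1"
    "\<And>x t s. exec c1 ((\<lambda>_. Leaf)(0 := x)) t s \<Longrightarrow> runs e1 N1 x (s 0) (t + N1)"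
    using normalize_com[of c1] by blast
  obtain e2 N2 where e2: "0 < N2"
    "\<And>x t s. exec c2 ((\<lambda>_. Leaf)(0 := x)) t s \<Longrightarrow> runs e2 N2 x (s 0) (t + N2)"
    using normalize_com[of c2] by blast
  \<comment> \<open>\<open>f1 k ^ d2\<close> comes from the size of the intermediate instance,
    \<open>N1 + N2\<close> from resetting the variables of both programs.\<close>
  let ?f = "\<lambda>k. f1 k + (f2 (g1 k) * f1 k ^ d2 + (N1 + N2))"
  show ?thesis
  proof (rule fpt_reducibleI)
    show "comp_bounded ?f"
      using comp_bounded_comp[OF comp_bounded_computable[OF 2(1)] 1(2)] comp_bounded_computable[OF 1(1)]
      by (intro comp_bounded_add comp_bounded_mult comp_bounded_power comp_bounded_const)
    show "computable (\<lambda>k. g2 (g1 k))"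
      using 1(2) 2(2) unfolding computable_iff by (rule total_computable_comp[rotated])
    fix x k assume "(x, k) \<in> insts P"
    from 1(3)[OF this] obtain y t where y: "computes_in c1 (enc_inst x k) (enc_inst y (g1 k)) t"
      "t \<le> f1 k * tsize (enc_inst x k) ^ d1" "(y, g1 k) \<in> insts Q"
      "(x, k) \<in> yes_insts P \<longleftrightarrow> (y, g1 k) \<in> yes_insts Q" by blast
    from 2(3)[OF y(3)] obtain z u where z: "computes_in c2 (enc_inst y (g1 k)) (enc_inst z (g2 (g1 k))) u"
      "u \<le> f2 (g1 k) * tsize (enc_inst y (g1 k)) ^ d2" "(z, g2 (g1 k)) \<in> insts R"
      "(y, g1 k) \<in> yes_insts Q \<longleftrightarrow> (z, g2 (g1 k)) \<in> yes_insts R" by blast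
    obtain t' where t': "runs e1 N1 (enc_inst x k) (enc_inst y (g1 k)) (t' + N1)"
      "t = t' + tsize (enc_inst y (g1 k))"
      using y(1) e1(2) unfolding computes_in_def by metis
    obtain u' where u': "runs e2 N2 (enc_inst y (g1 k)) (enc_inst z (g2 (g1 k))) (u' + N2)"
      "u = u' + tsize (enc_inst z (g2 (g1 k)))"
      using z(1) e2(2) unfolding computes_in_def by metis
    let ?n = "tsize (enc_inst x k)"
    have "runs (Seq e1 e2) (max N1 N2) (enc_inst x k) (enc_inst z (g2 (g1 k))) ((t' + N1) + (u' + N2))"
      using t'(1) u'(1) by (intro runs_seq) (auto intro: runs_mono)
    from runs_computes_in[OF this]
    have "computes_in (Seq e1 e2) (enc_inst x k) (enc_inst z (g2 (g1 k)))
      (((t' + N1) + (u' + N2)) + tsize (enc_inst z (g2 (g1 k))))" .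
    moreover have "((t' + N1) + (u' + N2)) + tsize (enc_inst z (g2 (g1 k))) \<le> ?f k * ?n ^ (d1 + d1 * d2)"
    proof -
      have n: "1 \<le> ?n" by (simp add: Suc_le_eq)
      have "tsize (enc_inst y (g1 k)) ^ d2 \<le> (f1 k * ?n ^ d1) ^ d2"
        using t'(2) y(2) by (intro power_mono) simp_all
      also have "\<dots> = f1 k ^ d2 * ?n ^ (d1 * d2)"
        by (simp add: power_mult_distrib power_mult)
      also have "\<dots> \<le> f1 k ^ d2 * ?n ^ (d1 + d1 * d2)"
        using n by (intro mult_le_mono2 power_increasing) simp_all
      finally have "u \<le> (f2 (g1 k) * f1 k ^ d2) * ?n ^ (d1 + d1 * d2)"
        using z(2) by (metis (no_types, lifting) mult.assoc mult_le_mono2 order_trans)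
      moreover have "t \<le> f1 k * ?n ^ (d1 + d1 * d2)"
        using y(2) by (rule order_trans) (use n in \<open>auto intro!: mult_le_mono2 power_increasing\<close>)
      moreover have "N1 + N2 \<le> (N1 + N2) * ?n ^ (d1 + d1 * d2)"
        using one_le_power[OF n] by simp
      ultimately show ?thesis
        using t'(2) u'(2) unfolding add_mult_distrib by linarith
    qed
    ultimately show "\<exists>z t. computes_in (Seq e1 e2) (enc_inst x k) (enc_inst z (g2 (g1 k))) t \<and>
      t \<le> ?f k * ?n ^ (d1 + d1 * d2) \<and> (z, g2 (g1 k)) \<in> insts R \<and>
      ((x, k) \<in> yes_insts P \<longleftrightarrow> (z, g2 (g1 k)) \<in> yes_insts R)"
      using y(4) z(3,4) by blast
  qed
qed


subsection \<open>Unary parameters\<close>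

lemma esize_unary: "esize (us :: unit list) = 2 * length us + 1"
  by (induction us) (auto simp: encode_unit_def)

text \<open>The expansion takes time polynomial in the value of \<open>n\<close> rather than in its
  length, which is affordable for a parameter. The bits are read from the most significant one,
  doubling the list each time.\<close>

lemma runs_unary:
  "\<exists>c N d. 0 < N \<and> (\<forall>n. \<exists>t\<le>(6 * n + 4) ^ d. runs c N (encode n) (encode (replicate n ())) t)"
proof -
  let ?g = "\<lambda>(u :: unit) (acc :: unit list) b. if b then () # acc @ acc else acc @ acc"
  have "ptime (\<lambda>z. ?g (fst z) (fst (snd z)) (snd (snd z)))"
    by (intro ptime_if ptime_Cons ptime_append ptime_fst ptime_snd ptime_id ptime_const)
  from fold_runs[of ?g, OF this] obtain c N d where c: "0 < N"
    "\<forall>l x a B. (\<forall>i\<le>length l. esize (foldl (?g x) a (take i l)) + esize x + esize l \<le> B) \<longrightarrow>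
      (\<exists>t\<le>(B + 1) ^ d. runs c N (encode (l, x, a)) (encode (foldl (?g x) a l)) t)"
    by (elim exE conjE) rule
  \<comment> \<open>The list never shrinks, so its final length \<open>n\<close> bounds all
    intermediate lengths.\<close>
  have mono: "length acc \<le> length (foldl (?g ()) acc bs)" for acc bs
  proof (induction bs arbitrary: acc)
    case (Cons b bs)
    then show ?case using Cons[of "() # acc @ acc"] Cons[of "acc @ acc"] by auto
  qed simp
  have eq: "foldl (?g ()) [] (rev (bits n)) = replicate n ()" for n
  proof (induction n rule: less_induct)
    case (less n)
    have r: "replicate a () @ replicate b () = replicate (a + b) ()" for a b
      by (simp add: replicate_add)
    show ?case
    proof (cases "n = 0")
      case False
      then have "foldl (?g ()) [] (rev (bits n)) = ?g () (replicate (n div 2) ()) (odd n)"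
        using less[of "n div 2"] by (subst bits.simps) simp
      also have "\<dots> = replicate n ()"
        by (auto simp: r simp flip: mult_2 replicate_Suc elim!: evenE oddE)
      finally show ?thesis .
    qed simp
  qed
  have "ptime (\<lambda>n :: nat. (rev (bits n), (), [] :: unit list))"
    by (intro ptime_Pair ptime_rev ptime_bits ptime_id ptime_const)
  then obtain c' N' T where c': "0 < N'" "poly_bounded T"
    "\<And>n. \<exists>t\<le>T n. runs c' N' (encode n) (encode (rev (bits n), (), [] :: unit list)) t"
    unfolding ptime_def by blast
  obtain d' where d': "\<And>n. T n \<le> (esize n + 1) ^ d'"
    using c'(2) unfolding poly_bounded_def by blast
  have "\<exists>t\<le>(6 * n + 4) ^ (max d d' + 1). runs (Seq c' c) (max N N') (encode n) (encode (replicate n ())) t" for n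
  proof -
    \<comment> \<open>The bound is \<open>2 * n + 1\<close> for the list, 1 for the context and
      \<open>4 * n + 1\<close> for the digits.\<close>
    have "esize (foldl (?g ()) [] (take i (rev (bits n)))) + esize () + esize (rev (bits n)) \<le> 6 * n + 3" for i
    proof -
      have "length (foldl (?g ()) [] (take i (rev (bits n)))) \<le> length (foldl (?g ()) [] (rev (bits n)))"
        using mono[of "foldl (?g ()) [] (take i (rev (bits n)))" "drop i (rev (bits n))"]
        by (simp only: foldl_append[symmetric] append_take_drop_id)
      then show ?thesis
        using esize_nat[of n] unfolding eq esize_unary esize_rev encode_bits
        by (simp add: encode_unit_def)
    qed
    then have "\<exists>t\<le>(6 * n + 3 + 1) ^ d. runs c N (encode (rev (bits n), (), [] :: unit list)) (encode (replicate n ())) t"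
      using c(2)[rule_format, where l = "rev (bits n)" and x = "()" and a = "[]" and B = "6 * n + 3"] unfolding eq by blast
    then obtain t where t: "t \<le> (6 * n + 4) ^ d"
      "runs c N (encode (rev (bits n), (), [] :: unit list)) (encode (replicate n ())) t"
      by (auto simp: numeral_eq_Suc)
    obtain u where u: "u \<le> (esize n + 1) ^ d'"
      "runs c' N' (encode n) (encode (rev (bits n), (), [] :: unit list)) u"
      using c'(3)[of n] d'[of n] order_trans by blast
    have "t \<le> (6 * n + 4) ^ max d d'"
      using t(1) by (rule order_trans) (intro power_increasing, simp_all)
    moreover have "u \<le> (6 * n + 4) ^ max d d'"
    proof -
      have "(esize n + 1) ^ d' \<le> (6 * n + 4) ^ d'"
        using esize_nat[of n] by (intro power_mono) simp_all
      also have "\<dots> \<le> (6 * n + 4) ^ max d d'" by (intro power_increasing) simp_all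
      finally show ?thesis using u(1) by simp
    qed
    ultimately have "u + t \<le> 2 * (6 * n + 4) ^ max d d'" by simp
    also have "\<dots> \<le> (6 * n + 4) * (6 * n + 4) ^ max d d'" by (intro mult_le_mono1) simp
    finally have "u + t \<le> (6 * n + 4) ^ (max d d' + 1)" by simp
    moreover have "runs (Seq c' c) (max N N') (encode n) (encode (replicate n ())) (u + t)"
      using t(2) u(2) by (intro runs_seq) (auto intro: runs_mono)
    ultimately show ?thesis by blast
  qed
  moreover have "0 < max N N'" using c(1) by simp
  ultimately show ?thesis by blast
qed

lemma total_computable_unary: "total_computable (\<lambda>n. replicate n ())"
  using runs_unary unfolding total_computable_def by blast

text \<open>The parameter is expanded to unary before \<open>F\<close> runs, so time polynomial in
  \<open>k\<close> and the input size is allowed although \<open>k\<close> is given in binary. As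
  \<open>G\<close> sees only the unary parameter, the new parameter depends on \<open>k\<close>
  alone.\<close>

lemma fpt_reducible_ptime:
  fixes F :: "'a :: encodable \<times> unit list \<Rightarrow> 'b :: encodable \<times> nat"
  assumes F: "ptime F" and G: "ptime G"
    and "\<And>x k. (x, k) \<in> insts P \<Longrightarrow> \<exists>X Y. x = encode X \<and> F (X, replicate k ()) = (Y, G (replicate k ())) \<and>
      (encode Y, G (replicate k ())) \<in> insts Q \<and>
      ((x, k) \<in> yes_insts P \<longleftrightarrow> (encode Y, G (replicate k ())) \<in> yes_insts Q)"
  shows "P \<le>fpt Q"
proof -
  have fst: "ptime (\<lambda>p :: 'a \<times> nat. fst p)" and snd: "ptime (\<lambda>p :: 'a \<times> nat. snd p)"
    by (intro ptime_fst ptime_snd ptime_id)+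
  obtain c1 N1 T1 where c1: "0 < N1" "poly_bounded T1"
    "\<And>p :: 'a \<times> nat. \<exists>t\<le>T1 p. runs c1 N1 (encode p) (encode (fst p)) t"
    using fst unfolding ptime_def by blast
  obtain c2 N2 T2 where c2: "0 < N2" "poly_bounded T2"
    "\<And>p :: 'a \<times> nat. \<exists>t\<le>T2 p. runs c2 N2 (encode p) (encode (snd p)) t"
    using snd unfolding ptime_def by blast
  obtain c3 N3 d3 where c3: "0 < N3"
    "\<And>n. \<exists>t\<le>(6 * n + 4) ^ d3. runs c3 N3 (encode n) (encode (replicate n ())) t"
    using runs_unary by blast
  obtain c4 N4 T4 where c4: "0 < N4" "poly_bounded T4"
    "\<And>z. esize (F z) \<le> T4 z" "\<And>z. \<exists>t\<le>T4 z. runs c4 N4 (encode z) (encode (F z)) t"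
    using F unfolding ptime_def by blast
  obtain d where d: "\<And>p. T1 p + T2 p \<le> (esize p + 1) ^ d"
    using poly_bounded_add[OF c1(2) c2(2)] unfolding poly_bounded_def by blast
  obtain d4 where d4: "\<And>z. T4 z \<le> (esize z + 1) ^ d4"
    using c4(2) unfolding poly_bounded_def by blast
  define K where "K = max (max N1 N2) (max N3 N4)"
  define e where "e = Seq (Seq (Assign K (Var 0)) (Seq c1 (Seq (Assign (K + 1) (Var 0))
    (Seq (Assign 0 (Var K)) (Seq (Assign K Nil_Ex) (Seq (Seq c2 c3)
    (Seq (Assign 0 (Cons_Ex (Var (K + 1)) (Var 0))) (Assign (K + 1) Nil_Ex)))))))) c4"
  define D where "D = d + d3 + d4"
  let ?f = "\<lambda>k :: nat. (10 + 6 * k) ^ D * 10"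
  show ?thesis
  proof (rule fpt_reducibleI)
    show "comp_bounded ?f"
      by (intro comp_bounded_mult comp_bounded_power comp_bounded_add comp_bounded_const comp_bounded_id)
    show "computable (\<lambda>k. G (replicate k ()))"
      unfolding computable_iff
      by (rule total_computable_comp[OF total_computable_ptime[OF G] total_computable_unary])
    fix x k assume "(x, k) \<in> insts P"
    from assms(3)[OF this] obtain X Y where XY: "x = encode X" "F (X, replicate k ()) = (Y, G (replicate k ()))"
      "(encode Y, G (replicate k ())) \<in> insts Q"
      "(x, k) \<in> yes_insts P \<longleftrightarrow> (encode Y, G (replicate k ())) \<in> yes_insts Q" by blast
    let ?n = "tsize (enc_inst x k)"
    have x: "enc_inst x k = encode (X, k)"
      by (simp add: enc_inst_def XY(1) encode_nat_def)
    have y: "enc_inst (encode Y) (G (replicate k ())) = encode (F (X, replicate k ()))"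
      by (simp add: enc_inst_def XY(2) encode_nat_def)
    obtain t1 t2 t3 t4 where t: "t1 \<le> T1 (X, k)" "runs c1 N1 (encode (X, k)) (encode X) t1"
      "t2 \<le> T2 (X, k)" "runs c2 N2 (encode (X, k)) (encode k) t2"
      "t3 \<le> (6 * k + 4) ^ d3" "runs c3 N3 (encode k) (encode (replicate k ())) t3"
      "t4 \<le> T4 (X, replicate k ())"
      "runs c4 N4 (encode (X, replicate k ())) (encode (F (X, replicate k ()))) t4"
      using c1(3)[of "(X, k)"] c2(3)[of "(X, k)"] c3(2)[of k] c4(4)[of "(X, replicate k ())"] by auto
    have "runs c1 K (encode (X, k)) (encode X) t1"
      using t(2) by (rule runs_mono) (simp add: K_def)
    moreover have "runs (Seq c2 c3) K (encode (X, k)) (encode (replicate k ())) (t2 + t3)"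
      using t(4,6) by (intro runs_seq) (auto elim!: runs_mono simp: K_def)
    moreover have "runs c4 (K + 2) (encode (X, replicate k ())) (encode (F (X, replicate k ()))) t4"
      using t(8) by (rule runs_mono) (simp add: K_def)
    moreover have "0 < K" using c1(1) by (simp add: K_def less_max_iff_disj)
    ultimately have "runs e (K + 2) (encode (X, k)) (encode (F (X, replicate k ()))) ((t1 + (t2 + t3) + 6) + t4)"
      unfolding e_def by (intro runs_seq[OF runs_pair[of c1 K _ "encode X" _ _ "encode (replicate k ())",
          folded encode_Pair]])
    from runs_computes_in[OF this]
    have "computes_in e (enc_inst x k) (enc_inst (encode Y) (G (replicate k ())))
      (((t1 + (t2 + t3) + 6) + t4) + esize (F (X, replicate k ())))"
      unfolding x y .
    moreover have "((t1 + (t2 + t3) + 6) + t4) + esize (F (X, replicate k ())) \<le> ?f k * ?n ^ D"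
    proof -
      \<comment> \<open>Sums are absorbed into a product by \<open>a + b \<le> a * b + 1\<close> for
        positive numbers, because a power of a product splits into a factor for \<open>k\<close> and
        one for the input size.\<close>
      define m where "m = (10 + 6 * k) * ?n"
      have n: "1 \<le> ?n" by (simp add: Suc_le_eq)
      have m: "(10 + 6 * k) + ?n \<le> m + 1"
      proof -
        obtain a where "?n = a + 1" using n by (metis add.commute le_add_diff_inverse)
        then show ?thesis by (simp add: m_def)
      qed
      then have m1: "1 \<le> m" "6 * k + 4 \<le> m" "?n + 1 \<le> m" "?n + 2 * k + 2 \<le> m" using n by simp_all
      have p: "b ^ j \<le> m ^ D" if "b \<le> m" "j \<le> D" for b j
        using that m1(1) by (meson order_trans power_increasing power_mono zero_le)
      have "t1 + t2 \<le> m ^ D"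
        using t(1,3) d[of "(X, k)"] p[OF m1(3), of d] unfolding x by (simp add: D_def)
      moreover have "t3 \<le> m ^ D"
        using t(5) p[OF m1(2), of d3] by (simp add: D_def)
      moreover have "T4 (X, replicate k ()) \<le> m ^ D"
      proof -
        have "esize (X, replicate k ()) + 1 \<le> ?n + 2 * k + 2"
          unfolding x by (simp add: esize_unary)
        then show ?thesis
          using d4[of "(X, replicate k ())"] p[of "esize (X, replicate k ()) + 1" d4] m1(4)
          by (simp add: D_def)
      qed
      moreover have "1 \<le> m ^ D" using m1(1) by simp
      ultimately have "((t1 + (t2 + t3) + 6) + t4) + esize (F (X, replicate k ())) \<le> 10 * m ^ D"
        using t(7) c4(3)[of "(X, replicate k ())"] by linarith
      then show ?thesis by (simp add: m_def power_mult_distrib)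
    qed
    ultimately show "\<exists>y t. computes_in e (enc_inst x k) (enc_inst y (G (replicate k ()))) t \<and>
      t \<le> ?f k * ?n ^ D \<and> (y, G (replicate k ())) \<in> insts Q \<and>
      ((x, k) \<in> yes_insts P \<longleftrightarrow> (y, G (replicate k ())) \<in> yes_insts Q)"
      using XY(3,4) by blast
  qed
qed

section \<open>Bribing a single voter\<close>

lemma rank_Cons: "rank c (x # v) = (if c = x then 1 else Suc (rank c v))"
  by (auto simp: rank_def)

lemma rank_inject: "a \<in> set v \<Longrightarrow> b \<in> set v \<Longrightarrow> rank a v = rank b v \<longleftrightarrow> a = b"
  by (induction v) (auto simp: rank_Cons rank_def)

lemma rank_le_iff_take: "distinct v \<Longrightarrow> c \<in> set v \<Longrightarrow> rank c v \<le> m \<longleftrightarrow> c \<in> set (take m v)"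
proof (induction v arbitrary: m)
  case (Cons x v)
  then show ?case by (cases m) (auto simp: rank_Cons rank_def)
qed simp

lemma rank_apply_swap:
  "rank c (apply_swap (a, b) v) = rank (if c = a then b else if c = b then a else c) v"
  by (induction v) (auto simp: rank_Cons rank_def)

lemma set_apply_swap: "admissible_swap v s \<Longrightarrow> set (apply_swap s v) = set v"
  by (cases s) (auto simp: image_iff)

lemma rank_less_apply_swap:
  assumes "admissible_swap v s" "s \<noteq> (c, d)" "c \<in> set v" "d \<in> set v" "rank c v < rank d v"
  shows "rank c (apply_swap s v) < rank d (apply_swap s v)"
proof -
  obtain a b where s: "s = (a, b)" by (cases s)
  then have "a \<in> set v" "b \<in> set v" "a \<noteq> b" "rank b v = rank a v + 1"
    using assms(1) by auto
  then show ?thesis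
    using assms rank_inject[of c v a] rank_inject[of c v b] rank_inject[of d v a] rank_inject[of d v b]
    unfolding s rank_apply_swap by (auto split: if_splits)
qed

text \<open>A swap of adjacent candidates changes the relative order of no other pair, so only the
  swap \<open>(a, b)\<close> itself can bring \<open>b\<close> before \<open>a\<close>. This is the
  lower bound on the cost.\<close>

lemma inverted_in_swaps:
  assumes "admissible_seq v ss" "a \<in> set v" "b \<in> set v" "rank a v < rank b v"
    "rank b (apply_swaps v ss) < rank a (apply_swaps v ss)"
  shows "(a, b) \<in> set ss"
  using assms
proof (induction ss arbitrary: v)
  case (Cons s ss)
  show ?case
  proof (cases "s = (a, b)")
    case False
    then have "rank a (apply_swap s v) < rank b (apply_swap s v)"
      using Cons.prems by (intro rank_less_apply_swap) auto
    then show ?thesis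
      using Cons.IH[of "apply_swap s v"] Cons.prems set_apply_swap[of v s] by simp
  qed simp
qed simp

lemma set_apply_swaps: "admissible_seq v ss \<Longrightarrow> set (apply_swaps v ss) = set v"
  by (induction ss arbitrary: v) (auto simp: set_apply_swap simp del: apply_swap.simps)

lemma distinct_apply_swaps: "distinct v \<Longrightarrow> distinct (apply_swaps v ss)"
proof (induction ss arbitrary: v)
  case (Cons s ss)
  obtain a b where s: "s = (a, b)" by (cases s)
  have "distinct (apply_swap s v)"
    using Cons.prems unfolding s by (auto simp: distinct_map inj_on_def)
  then show ?case using Cons.IH by simp
qed simp

lemma admissible_seq_append:
  "admissible_seq v (ss @ ts) \<longleftrightarrow> admissible_seq v ss \<and> admissible_seq (apply_swaps v ss) ts"
  by (induction ss arbitrary: v) auto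

lemma apply_swaps_append: "apply_swaps v (ss @ ts) = apply_swaps (apply_swaps v ss) ts"
  by (induction ss arbitrary: v) auto

text \<open>A new head shifts all ranks by one, which preserves adjacency; this carries swap
  sequences through inductions on the vote.\<close>

lemma swaps_Cons:
  "admissible_seq v ss \<Longrightarrow> x \<notin> set v \<Longrightarrow>
    admissible_seq (x # v) ss \<and> apply_swaps (x # v) ss = x # apply_swaps v ss"
proof (induction ss arbitrary: v)
  case (Cons s ss)
  obtain a b where s: "s = (a, b)" by (cases s)
  have "x \<notin> set (apply_swap s v)" using Cons.prems set_apply_swap[of v s] by auto
  then have "admissible_seq (x # apply_swap s v) ss \<and>
    apply_swaps (x # apply_swap s v) ss = x # apply_swaps (apply_swap s v) ss"
    using Cons by auto
  moreover have "apply_swap s (x # v) = x # apply_swap s v" "admissible_swap (x # v) s"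
    using Cons.prems by (auto simp: s rank_Cons)
  ultimately show ?case by (simp del: apply_swap.simps)
qed simp

lemma swaps_move:
  "distinct (x # us @ ws) \<Longrightarrow> admissible_seq (x # us @ ws) (map (Pair x) us) \<and>
    apply_swaps (x # us @ ws) (map (Pair x) us) = us @ x # ws"
proof (induction us)
  case (Cons u us)
  have "admissible_seq (x # us @ ws) (map (Pair x) us)"
    "apply_swaps (x # us @ ws) (map (Pair x) us) = us @ x # ws"
    using Cons by auto
  moreover have "u \<notin> set (x # us @ ws)" using Cons.prems by auto
  moreover have "admissible_swap (x # u # us @ ws) (x, u)"
    using Cons.prems by (auto simp: rank_Cons)
  moreover have "apply_swap (x, u) (x # u # us @ ws) = u # x # us @ ws"
    using Cons.prems by (auto intro!: map_idI)
  ultimately show ?case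
    using swaps_Cons[of "x # us @ ws" "map (Pair x) us" u] by (simp del: apply_swap.simps admissible_swap.simps)
qed simp

text \<open>Once the rest of the vote is arranged, a head outside \<open>T\<close> moves past the
  members of \<open>T\<close>. Each pair in the wrong order with respect to \<open>T\<close> is
  swapped once and no other pair is, so the lower bound from \<open>inverted_in_swaps\<close> is
  attained.\<close>

lemma swaps_to_front:
  "distinct v \<Longrightarrow> \<exists>ss. distinct ss \<and> admissible_seq v ss \<and>
    set ss = {(a, b). a \<in> set v - T \<and> b \<in> set v \<inter> T \<and> rank a v < rank b v} \<and>
    apply_swaps v ss = filter (\<lambda>c. c \<in> T) v @ filter (\<lambda>c. c \<notin> T) v"
proof (induction v)
  case (Cons x v)
  then obtain ss where ss: "distinct ss" "admissible_seq v ss"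
    "set ss = {(a, b). a \<in> set v - T \<and> b \<in> set v \<inter> T \<and> rank a v < rank b v}"
    "apply_swaps v ss = filter (\<lambda>c. c \<in> T) v @ filter (\<lambda>c. c \<notin> T) v" by auto
  have x: "x \<notin> set v" using Cons.prems by simp
  note ss' = swaps_Cons[OF ss(2) x]
  have rank: "rank x (x # v) = 1" "\<And>c. c \<in> set v \<Longrightarrow> rank c (x # v) = Suc (rank c v)"
    "\<And>c. 0 < rank c v"
    using x by (auto simp: rank_Cons rank_def)
  show ?case
  proof (cases "x \<in> T")
    case True
    have "set ss = {(a, b). a \<in> set (x # v) - T \<and> b \<in> set (x # v) \<inter> T \<and> rank a (x # v) < rank b (x # v)}"
      using True rank x unfolding ss(3) by auto
    then show ?thesis
      using True ss ss' by (intro exI[of _ ss]) simp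
  next
    case False
    let ?us = "filter (\<lambda>c. c \<in> T) v" and ?ws = "filter (\<lambda>c. c \<notin> T) v"
    have "distinct (x # ?us @ ?ws)" using Cons.prems by auto
    note move = swaps_move[OF this]
    have "distinct (ss @ map (Pair x) ?us)"
      using ss(1) Cons.prems unfolding distinct_append ss(3) by (auto simp: distinct_map inj_on_def)
    moreover have "set (ss @ map (Pair x) ?us) =
      {(a, b). a \<in> set (x # v) - T \<and> b \<in> set (x # v) \<inter> T \<and> rank a (x # v) < rank b (x # v)}"
      using False rank x unfolding set_append ss(3) by auto
    ultimately show ?thesis
      using False move ss(4) ss'
      by (intro exI[of _ "ss @ map (Pair x) ?us"]) (simp add: admissible_seq_append apply_swaps_append)
  qed
qed simp

text \<open>With \<open>0 < k\<close> the top candidate has score one, the maximum for one vote, so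
  winning means being approved.\<close>

lemma approval_winner_single:
  assumes "distinct w" "set w = C" "p \<in> C" "0 < k"
  shows "approval_winner k C [w] p \<longleftrightarrow> rank p w \<le> k"
proof -
  have "hd w \<in> C" "rank (hd w) w = 1" using assms by (cases w; auto simp: rank_Cons)+
  then show ?thesis
    using assms unfolding approval_winner_def approval_score_def
    by (auto split: if_splits intro!: bexI[of _ "hd w"])
qed

lemma swap_results_single:
  "swap_results [v] \<Gamma> V' \<longleftrightarrow>
    (\<exists>ss. distinct ss \<and> \<Gamma> = Pair 0 ` set ss \<and> admissible_seq v ss \<and> V' = [apply_swaps v ss])"
proof
  assume *: "swap_results [v] \<Gamma> V'"
  then obtain ss where ss: "distinct ss" "set ss = {(a, b). (0, a, b) \<in> \<Gamma>}" "admissible_seq v ss"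
    "V' ! 0 = apply_swaps v ss" "length V' = 1"
    unfolding swap_results_def swap_result_def by auto
  moreover have "\<Gamma> = Pair 0 ` set ss"
    using * unfolding ss(2) swap_results_def by force
  moreover have "V' = [apply_swaps v ss]" using ss(4,5) by (cases V') auto
  ultimately show "\<exists>ss. distinct ss \<and> \<Gamma> = Pair 0 ` set ss \<and> admissible_seq v ss \<and> V' = [apply_swaps v ss]"
    by blast
next
  assume "\<exists>ss. distinct ss \<and> \<Gamma> = Pair 0 ` set ss \<and> admissible_seq v ss \<and> V' = [apply_swaps v ss]"
  then show "swap_results [v] \<Gamma> V'"
    unfolding swap_results_def swap_result_def by (auto simp: image_iff)
qed

text \<open>These pairs must be swapped by \<open>inverted_in_swaps\<close> and suffice by
  \<open>swaps_to_front\<close>; as costs are non-negative, this is the least price for having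
  \<open>T\<close> in front.\<close>

definition front_cost :: "('c \<Rightarrow> 'c \<Rightarrow> nat) \<Rightarrow> 'c list \<Rightarrow> 'c set \<Rightarrow> nat" where
  "front_cost c v T = (\<Sum>(a, b) \<in> {(a, b). a \<in> set v - T \<and> b \<in> set v \<inter> T \<and> rank a v < rank b v}. c a b)"

text \<open>Any admissible set contains the unavoidable pairs for the front it produces. For
  \<open>k = 0\<close> every candidate would win although no such \<open>T\<close> exists;
  \<open>k \<le> num_cands I\<close> gives the front exactly \<open>k\<close> members.\<close>

lemma approval_bribable_single:
  assumes I: "valid_inst I" "votes I = [v]" and k: "0 < k" "k \<le> num_cands I"
  shows "approval_bribable k I \<longleftrightarrow>
    (\<exists>T \<subseteq> cands I. card T = k \<and> preferred I \<in> T \<and> front_cost (\<lambda>a b. costs I ! 0 ! a ! b) v T \<le> budget I)"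
    (is "_ \<longleftrightarrow> (\<exists>T \<subseteq> cands I. card T = k \<and> preferred I \<in> T \<and> front_cost ?c v T \<le> budget I)")
proof -
  have v: "distinct v" "set v = cands I" "preferred I \<in> cands I"
    using I by (auto simp: valid_inst_def is_vote_def)
  have len: "length v = num_cands I"
    using distinct_card[OF v(1)] v(2) by (simp add: cands_def)
  have cost: "total_cost I (Pair 0 ` X) = (\<Sum>(a, b) \<in> X. ?c a b)" for X
    unfolding total_cost_def by (subst sum.reindex) (auto simp: inj_on_def intro: sum.cong)
  have winner: "approval_winner k (cands I) [apply_swaps v ss] (preferred I) \<longleftrightarrow>
    preferred I \<in> set (take k (apply_swaps v ss))" if "admissible_seq v ss" for ss
    using that v k
    by (simp add: approval_winner_single distinct_apply_swaps set_apply_swaps rank_le_iff_take)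
  show ?thesis
  proof
    assume "approval_bribable k I"
    then obtain ss where ss: "admissible_seq v ss" "total_cost I (Pair 0 ` set ss) \<le> budget I"
      "preferred I \<in> set (take k (apply_swaps v ss))"
      unfolding approval_bribable_def I(2) swap_results_single using winner by blast
    define w where "w = apply_swaps v ss"
    have w: "distinct w" "set w = set v"
      using v(1) ss(1) by (simp_all add: w_def distinct_apply_swaps set_apply_swaps)
    define T where "T = set (take k w)"
    have "length w = num_cands I"
      using distinct_card[OF w(1)] distinct_card[OF v(1)] w(2) len by simp
    then have "card T = k"
      using w(1) k(2) by (simp add: T_def distinct_card)
    moreover have "T \<subseteq> cands I"
      using w(2) v(2) by (auto simp: T_def dest: in_set_takeD)
    moreover have "front_cost ?c v T \<le> (\<Sum>(a, b) \<in> set ss. ?c a b)"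
      unfolding front_cost_def
    proof (rule sum_mono2)
      show "{(a, b). a \<in> set v - T \<and> b \<in> set v \<inter> T \<and> rank a v < rank b v} \<subseteq> set ss"
      proof clarify
        fix a b assume *: "a \<in> set v" "a \<notin> T" "b \<in> set v" "b \<in> T" "rank a v < rank b v"
        then have "rank b w < rank a w"
          using rank_le_iff_take[OF w(1), of a k] rank_le_iff_take[OF w(1), of b k] w(2)
          by (simp add: T_def)
        then show "(a, b) \<in> set ss"
          using inverted_in_swaps[OF ss(1) *(1,3,5)] by (simp add: w_def)
      qed
    qed auto
    ultimately show "\<exists>T \<subseteq> cands I. card T = k \<and> preferred I \<in> T \<and> front_cost ?c v T \<le> budget I"
      using ss(2,3) unfolding cost T_def w_def by (meson order_trans)
  next
    assume "\<exists>T \<subseteq> cands I. card T = k \<and> preferred I \<in> T \<and> front_cost ?c v T \<le> budget I"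
    then obtain T where T: "T \<subseteq> cands I" "card T = k" "preferred I \<in> T" "front_cost ?c v T \<le> budget I"
      by blast
    obtain ss where ss: "distinct ss" "admissible_seq v ss"
      "set ss = {(a, b). a \<in> set v - T \<and> b \<in> set v \<inter> T \<and> rank a v < rank b v}"
      "apply_swaps v ss = filter (\<lambda>c. c \<in> T) v @ filter (\<lambda>c. c \<notin> T) v"
      using swaps_to_front[OF v(1)] by blast
    have "set (filter (\<lambda>c. c \<in> T) v) = T" using T(1) v(2) by auto
    moreover have "length (filter (\<lambda>c. c \<in> T) v) = k"
      using distinct_card[of "filter (\<lambda>c. c \<in> T) v"] v(1) T(2) calculation by simp
    ultimately have "preferred I \<in> set (take k (apply_swaps v ss))"
      using T(3) by (simp add: ss(4))
    moreover have "total_cost I (Pair 0 ` set ss) \<le> budget I"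
      using T(4) unfolding cost ss(3) front_cost_def .
    ultimately show "approval_bribable k I"
      unfolding approval_bribable_def I(2) swap_results_single using ss winner by blast
  qed
qed


subsection \<open>Cliques\<close>

text \<open>The diagonal is included since the graphs have all loops. A set of size \<open>q\<close>
  then has \<open>\<Sum>{..q}\<close> pairs, which is also the length of
  \<open>concat (tails Q)\<close> for a list \<open>Q\<close> of length \<open>q\<close>.\<close>

definition pairs_le :: "nat set \<Rightarrow> (nat \<times> nat) set" where
  "pairs_le T = {(b, a). b \<in> T \<and> a \<in> T \<and> b \<le> a}"

lemma finite_pairs_le: "finite T \<Longrightarrow> finite (pairs_le T)"
  by (rule finite_subset[of _ "T \<times> T"]) (auto simp: pairs_le_def)

lemma card_pairs_le: "finite T \<Longrightarrow> card (pairs_le T) = \<Sum>{..card T}"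
proof (induction T rule: finite_linorder_max_induct)
  case empty
  show ?case by (simp add: pairs_le_def)
next
  case (insert m T)
  have m: "m \<notin> T" using insert by auto
  have "pairs_le (insert m T) = pairs_le T \<union> (\<lambda>b. (b, m)) ` insert m T"
    using insert by (auto simp: pairs_le_def)
  also have "card \<dots> = card (pairs_le T) + card ((\<lambda>b. (b, m)) ` insert m T)"
    using m insert(1) by (intro card_Un_disjoint) (auto simp: pairs_le_def finite_pairs_le[unfolded pairs_le_def])
  also have "card ((\<lambda>b. (b, m)) ` insert m T) = Suc (card T)"
    using insert m by (subst card_image) (auto simp: inj_on_def)
  finally show ?case
    using insert m by simp
qed

text \<open>Vertices are listed in decreasing order, so those preceding \<open>b\<close> are the
  \<open>a > b\<close>; the price of the swap \<open>(b, n)\<close> also counts the loop at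
  \<open>b\<close>. The budget leaves out the \<open>\<Sum>{..q}\<close> pairs of a clique with
  \<open>q\<close> vertices.\<close>

definition graph_inst :: "nat \<Rightarrow> (nat \<Rightarrow> nat \<Rightarrow> bool) \<Rightarrow> nat \<Rightarrow> bribery_inst" where
  "graph_inst n W q = \<lparr>num_cands = Suc n, votes = [rev [0..<n] @ [n]], preferred = n,
    costs = [map (\<lambda>b. map (\<lambda>a. of_bool (W b a)) [0..<n] @ [card {a. b \<le> a \<and> a < n \<and> W b a}]) [0..<n]
      @ [replicate (Suc n) 0]],
    budget = (\<Sum>b<n. card {a. b \<le> a \<and> a < n \<and> W b a}) - \<Sum>{..q}\<rparr>"

lemma valid_graph_inst: "valid_inst (graph_inst n W q)"
  by (auto simp: valid_inst_def graph_inst_def is_vote_def cands_def)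

text \<open>
  All edges (with the loops) are paid for, except those inside \<open>T\<close>: an edge between \<open>b < a\<close> is
  charged to the swap of \<open>b\<close> and the preferred candidate \<open>n\<close> if \<open>b\<close> is not in \<open>T\<close>, and to
  the swap of \<open>a\<close> and \<open>b\<close> if only \<open>a\<close> is not in \<open>T\<close>.
\<close>

lemma front_cost_graph_inst:
  assumes W: "\<And>a b. W a b \<Longrightarrow> W b a" and T: "T \<subseteq> {..<n}"
  shows "front_cost (\<lambda>a b. costs (graph_inst n W q) ! 0 ! a ! b) (rev [0..<n] @ [n]) (insert n T)
    + card {p \<in> pairs_le T. W (fst p) (snd p)} = (\<Sum>b<n. card {a. b \<le> a \<and> a < n \<and> W b a})"
proof -
  let ?v = "rev [0..<n] @ [n]"
  let ?c = "\<lambda>a b. costs (graph_inst n W q) ! 0 ! a ! b"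
  let ?d = "\<lambda>b. card {a. b \<le> a \<and> a < n \<and> W b a}"
  have rank: "rank n ?v = Suc n" "\<And>a. a < n \<Longrightarrow> rank a ?v = n - a"
  proof -
    have "takeWhile (\<lambda>d. d \<noteq> n) ?v = take n ?v"
      by (rule takeWhile_eq_take_P_nth) (auto simp: nth_append rev_nth)
    then show "rank n ?v = Suc n" by (simp add: rank_def)
    show "rank a ?v = n - a" if "a < n" for a
    proof -
      have "takeWhile (\<lambda>d. d \<noteq> a) ?v = take (n - Suc a) ?v"
        using that by (intro takeWhile_eq_take_P_nth) (auto simp: nth_append rev_nth)
      then show ?thesis using that by (simp add: rank_def)
    qed
  qed
  have fin: "finite T" using T finite_subset by blast
  let ?X1 = "(\<lambda>a. (a, n)) ` ({..<n} - T)"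
  let ?X2 = "{(a, b). a \<in> {..<n} - T \<and> b \<in> T \<and> b < a}"
  have fin2: "finite ?X2"
    by (rule finite_subset[of _ "{..<n} \<times> T"]) (use fin in auto)
  have X: "{(a, b). a \<in> set ?v - insert n T \<and> b \<in> set ?v \<inter> insert n T \<and> rank a ?v < rank b ?v}
    = ?X1 \<union> ?X2"
  proof (intro equalityI subsetI)
    fix p assume "p \<in> {(a, b). a \<in> set ?v - insert n T \<and> b \<in> set ?v \<inter> insert n T \<and> rank a ?v < rank b ?v}"
    then obtain a b where "p = (a, b)" "a < n" "a \<notin> T" "b = n \<or> b \<in> T \<and> b < n" "rank a ?v < rank b ?v"
      by auto
    then show "p \<in> ?X1 \<union> ?X2" using rank by (auto simp: less_diff_conv2)
  next
    fix p assume "p \<in> ?X1 \<union> ?X2"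
    then show "p \<in> {(a, b). a \<in> set ?v - insert n T \<and> b \<in> set ?v \<inter> insert n T \<and> rank a ?v < rank b ?v}"
      using T rank by (auto intro: diff_less_mono2 simp: less_Suc_eq_le)
  qed
  have "(\<Sum>(a, b) \<in> ?X1. ?c a b) = (\<Sum>a \<in> {..<n} - T. ?d a)"
    by (subst sum.reindex) (auto simp: inj_on_def graph_inst_def nth_append intro!: sum.cong)
  moreover have "(\<Sum>(a, b) \<in> ?X2. ?c a b) = card {p \<in> ?X2. W (fst p) (snd p)}"
  proof -
    have "(\<Sum>(a, b) \<in> ?X2. ?c a b) = (\<Sum>p \<in> ?X2. of_bool (W (fst p) (snd p)))"
      by (intro sum.cong) (auto simp: graph_inst_def nth_append)
    also have "\<dots> = card {p \<in> ?X2. W (fst p) (snd p)}"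
      using fin2 by (simp add: of_bool_def sum.If_cases Int_def)
    finally show ?thesis .
  qed
  moreover have "front_cost ?c ?v (insert n T) = (\<Sum>(a, b) \<in> ?X1. ?c a b) + (\<Sum>(a, b) \<in> ?X2. ?c a b)"
    unfolding front_cost_def X using fin2 T by (intro sum.union_disjoint) auto
  moreover have "(\<Sum>b<n. ?d b) = (\<Sum>b \<in> {..<n} - T. ?d b) + (\<Sum>b \<in> T. ?d b)"
    using T by (simp add: sum.subset_diff)
  \<comment> \<open>The edges counted at the members \<open>b\<close> of \<open>T\<close> are split
    by whether the larger end \<open>a\<close> is in \<open>T\<close>. \<open>?X2\<close> lists the
    swaps as \<open>(a, b)\<close>, hence \<open>prod.swap\<close>.\<close>
  moreover have "(\<Sum>b \<in> T. ?d b) = card {p \<in> ?X2. W (fst p) (snd p)} + card {p \<in> pairs_le T. W (fst p) (snd p)}"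
  proof -
    have "(\<Sum>b \<in> T. ?d b) = card (SIGMA b:T. {a. b \<le> a \<and> a < n \<and> W b a})"
      using fin by simp
    also have "(SIGMA b:T. {a. b \<le> a \<and> a < n \<and> W b a}) =
      prod.swap ` {p \<in> ?X2. W (fst p) (snd p)} \<union> {p \<in> pairs_le T. W (fst p) (snd p)}"
      (is "?S = ?A \<union> ?B")
    proof (intro equalityI subsetI)
      fix p assume "p \<in> ?S"
      then obtain b a where p: "p = (b, a)" "b \<in> T" "b \<le> a" "a < n" "W b a" by auto
      show "p \<in> ?A \<union> ?B"
      proof (cases "a \<in> T")
        case True
        then show ?thesis using p by (auto simp: pairs_le_def)
      next
        case False
        then have "b < a" using p by (metis le_neq_implies_less)
        then have "(a, b) \<in> {p \<in> ?X2. W (fst p) (snd p)}" using False p W by auto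
        then show ?thesis using p(1) by (auto simp: image_iff)
      qed
    next
      fix p assume "p \<in> ?A \<union> ?B"
      then show "p \<in> ?S" using T W by (auto simp: pairs_le_def)
    qed
    also have "card (?A \<union> ?B) = card ?A + card ?B"
    proof (rule card_Un_disjoint)
      show "finite ?A" using fin2 by simp
      show "finite ?B" using finite_pairs_le[OF fin] by simp
      show "?A \<inter> ?B = {}" by (auto simp: pairs_le_def)
    qed
    also have "card ?A = card {p \<in> ?X2. W (fst p) (snd p)}"
      by (intro card_image) (auto simp: inj_on_def)
    finally show ?thesis .
  qed
  ultimately show ?thesis by simp
qed

text \<open>The budget demands \<open>\<Sum>{..q}\<close> edges inside \<open>T\<close>, which is
  all of \<open>pairs_le T\<close>. The approved set is \<open>T\<close> together with the preferred
  candidate, hence \<open>Suc q\<close>; hypothesis \<open>q\<close> keeps the budget from being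
  truncated at 0.\<close>

lemma approval_bribable_graph_inst:
  assumes W: "\<And>a b. W a b \<Longrightarrow> W b a" "\<And>a. a < n \<Longrightarrow> W a a" and "q \<le> n"
    and q: "\<Sum>{..q} \<le> (\<Sum>b<n. card {a. b \<le> a \<and> a < n \<and> W b a})"
  shows "approval_bribable (Suc q) (graph_inst n W q) \<longleftrightarrow>
    (\<exists>T \<subseteq> {..<n}. card T = q \<and> (\<forall>a \<in> T. \<forall>b \<in> T. W a b))"
proof -
  let ?I = "graph_inst n W q"
  let ?E = "\<Sum>b<n. card {a. b \<le> a \<and> a < n \<and> W b a}"
  have clique: "front_cost (\<lambda>a b. costs ?I ! 0 ! a ! b) (rev [0..<n] @ [n]) (insert n T) \<le> budget ?I \<longleftrightarrow>
    (\<forall>a \<in> T. \<forall>b \<in> T. W a b)" if T: "T \<subseteq> {..<n}" "card T = q" for T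
  proof -
    have fin: "finite T" using T finite_subset by blast
    let ?F = "{p \<in> pairs_le T. W (fst p) (snd p)}"
    have card: "card (pairs_le T) = \<Sum>{..q}" using card_pairs_le[OF fin] T(2) by simp
    have "front_cost (\<lambda>a b. costs ?I ! 0 ! a ! b) (rev [0..<n] @ [n]) (insert n T) \<le> budget ?I
      \<longleftrightarrow> card (pairs_le T) \<le> card ?F"
      using front_cost_graph_inst[where W = W and n = n and q = q, OF W(1) T(1)] q card by (simp add: graph_inst_def) linarith
    also have "\<dots> \<longleftrightarrow> ?F = pairs_le T"
      using card_seteq[OF finite_pairs_le[OF fin], of ?F] by auto
    also have "\<dots> \<longleftrightarrow> (\<forall>a \<in> T. \<forall>b \<in> T. W a b)"
    proof
      assume eq: "?F = pairs_le T"
      have le: "W b a" if "b \<in> T" "a \<in> T" "b \<le> a" for a b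
      proof -
        have "(b, a) \<in> ?F" unfolding eq using that by (simp add: pairs_le_def)
        then show ?thesis by simp
      qed
      then show "\<forall>a \<in> T. \<forall>b \<in> T. W a b" using W(1) nat_le_linear by blast
    qed (auto simp: pairs_le_def)
    finally show ?thesis .
  qed
  have "approval_bribable (Suc q) ?I \<longleftrightarrow> (\<exists>T' \<subseteq> {..<Suc n}. card T' = Suc q \<and> n \<in> T' \<and>
      front_cost (\<lambda>a b. costs ?I ! 0 ! a ! b) (rev [0..<n] @ [n]) T' \<le> budget ?I)"
    using approval_bribable_single[OF valid_graph_inst, of n W q "rev [0..<n] @ [n]" "Suc q"] \<open>q \<le> n\<close>
    by (simp add: graph_inst_def cands_def)
  also have "\<dots> \<longleftrightarrow> (\<exists>T \<subseteq> {..<n}. card T = q \<and>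
      front_cost (\<lambda>a b. costs ?I ! 0 ! a ! b) (rev [0..<n] @ [n]) (insert n T) \<le> budget ?I)"
  proof
    assume "\<exists>T' \<subseteq> {..<Suc n}. card T' = Suc q \<and> n \<in> T' \<and>
      front_cost (\<lambda>a b. costs ?I ! 0 ! a ! b) (rev [0..<n] @ [n]) T' \<le> budget ?I"
    then obtain T' where T': "T' \<subseteq> {..<Suc n}" "card T' = Suc q" "n \<in> T'"
      "front_cost (\<lambda>a b. costs ?I ! 0 ! a ! b) (rev [0..<n] @ [n]) T' \<le> budget ?I" by blast
    have "insert n (T' - {n}) = T'" "T' - {n} \<subseteq> {..<n}" using T' by auto
    moreover have "card (T' - {n}) = q" using T' finite_subset[OF T'(1)] by simp
    ultimately show "\<exists>T \<subseteq> {..<n}. card T = q \<and>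
      front_cost (\<lambda>a b. costs ?I ! 0 ! a ! b) (rev [0..<n] @ [n]) (insert n T) \<le> budget ?I"
      using T'(4) by (intro exI[of _ "T' - {n}"]) simp
  next
    assume "\<exists>T \<subseteq> {..<n}. card T = q \<and>
      front_cost (\<lambda>a b. costs ?I ! 0 ! a ! b) (rev [0..<n] @ [n]) (insert n T) \<le> budget ?I"
    then obtain T where T: "T \<subseteq> {..<n}" "card T = q"
      "front_cost (\<lambda>a b. costs ?I ! 0 ! a ! b) (rev [0..<n] @ [n]) (insert n T) \<le> budget ?I" by blast
    then have "finite T" "n \<notin> T" using finite_subset by auto
    then show "\<exists>T' \<subseteq> {..<Suc n}. card T' = Suc q \<and> n \<in> T' \<and>
      front_cost (\<lambda>a b. costs ?I ! 0 ! a ! b) (rev [0..<n] @ [n]) T' \<le> budget ?I"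
      using T by (intro exI[of _ "insert n T"]) auto
  qed
  also have "\<dots> \<longleftrightarrow> (\<exists>T \<subseteq> {..<n}. card T = q \<and> (\<forall>a \<in> T. \<forall>b \<in> T. W a b))"
    using clique by auto
  finally show ?thesis .
qed

section \<open>Evaluating circuits of weft one\<close>

text \<open>The numbers agree with \<open>enc_gate\<close>, so the tag can be read off the tree of a
  gate.\<close>

fun gate_tag :: "gate \<Rightarrow> nat" where
  "gate_tag InputG = 0"
| "gate_tag (NotG _) = 1"
| "gate_tag (AndG _) = 2"
| "gate_tag (OrG _) = 3"

text \<open>
  A set \<open>K\<close> of facts \<open>(i, b)\<close> records which gates \<open>i\<close> are known to have the value \<open>b\<close>. A small
  gate is evaluated only if all its arguments are known. A large gate is always evaluated, under
  the assumption that its unknown arguments do not matter.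
\<close>

definition gate_out :: "gate \<Rightarrow> (nat \<times> bool) set \<Rightarrow> bool" where
  "gate_out g K = (if gate_tag g = 3 then \<exists>i \<in> set (wires g). (i, True) \<in> K
    else if gate_tag g = 2 then \<not> (\<exists>i \<in> set (wires g). (i, False) \<in> K)
    else \<not> (\<exists>i \<in> set (wires g). (i, True) \<in> K))"

text \<open>\<open>tl (tl (wires g)) \<noteq> []\<close> expresses fan-in above two with list
  operations only.\<close>

definition evaluable :: "gate \<Rightarrow> (nat \<times> bool) set \<Rightarrow> bool" where
  "evaluable g K \<longleftrightarrow> g \<noteq> InputG \<and>
    (tl (tl (wires g)) \<noteq> [] \<or> (\<forall>i \<in> set (wires g). (i, True) \<in> K \<or> (i, False) \<in> K))"

definition gate_facts :: "nat \<times> gate \<Rightarrow> (nat \<times> bool) list \<Rightarrow> (nat \<times> bool) list" where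
  "gate_facts p K = (if evaluable (snd p) (set K) then [(fst p, gate_out (snd p) (set K))] else [])"

definition known :: "(nat \<times> bool) list \<Rightarrow> gate list \<Rightarrow> (nat \<times> bool) list" where
  "known F C = foldl (\<lambda>K p. gate_facts p K @ K) F (List.enumerate 0 C)"

lemma gate_out_cong:
  "(\<And>i b. i \<in> set (wires g) \<Longrightarrow> (i, b) \<in> K \<longleftrightarrow> (i, b) \<in> K') \<Longrightarrow> gate_out g K = gate_out g K'"
  by (auto simp: gate_out_def)

lemma evaluable_cong:
  "(\<And>i b. i \<in> set (wires g) \<Longrightarrow> (i, b) \<in> K \<longleftrightarrow> (i, b) \<in> K') \<Longrightarrow> evaluable g K = evaluable g K'"
  by (auto simp: evaluable_def)

lemma known_take_Suc:
  assumes "m < length C"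
  shows "known F (take (Suc m) C) = gate_facts (m, C ! m) (known F (take m C)) @ known F (take m C)"
  using assms by (simp add: known_def take_Suc_conv_app_nth enumerate_append_eq)

lemma in_known_take:
  "m \<le> length C \<Longrightarrow> (j, b) \<in> set (known F (take m C)) \<longleftrightarrow> (j, b) \<in> set F \<or>
    j < m \<and> evaluable (C ! j) (set (known F (take j C))) \<and> b = gate_out (C ! j) (set (known F (take j C)))"
proof (induction m)
  case 0
  show ?case by (simp add: known_def)
next
  case (Suc m)
  then show ?case
    by (auto simp: known_take_Suc gate_facts_def less_Suc_eq)
qed

text \<open>The arguments of gate \<open>j\<close> precede it, so the facts about them are final
  when \<open>j\<close> is processed. The left-to-right computation thus becomes a fixed-point
  equation for the final set.\<close>

lemma in_known:
  assumes C: "is_circuit C" "j < length C"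
  shows "(j, b) \<in> set (known F C) \<longleftrightarrow> (j, b) \<in> set F \<or>
    evaluable (C ! j) (set (known F C)) \<and> b = gate_out (C ! j) (set (known F C))"
proof -
  have "(i, c) \<in> set (known F (take j C)) \<longleftrightarrow> (i, c) \<in> set (known F C)"
    if "i \<in> set (wires (C ! j))" for i c
  proof -
    have "i < j" using C that by (auto simp: is_circuit_def)
    then show ?thesis
      using in_known_take[of j C i c F] in_known_take[of "length C" C i c F] C(2) by simp
  qed
  then have "evaluable (C ! j) (set (known F (take j C))) = evaluable (C ! j) (set (known F C))"
    "gate_out (C ! j) (set (known F (take j C))) = gate_out (C ! j) (set (known F C))"
    by (intro evaluable_cong gate_out_cong; blast)+
  then show ?thesis
    using in_known_take[of "length C" C j b F] C(2) by simp
qed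

lemma gate_val_eq_gate_out:
  assumes C: "is_circuit C" "j < length C" "C ! j \<noteq> InputG"
  shows "gate_val C S j = gate_out (C ! j) {(i, b). b = gate_val C S i}"
proof -
  have "i < j" if "i \<in> set (wires (C ! j))" for i
    using C that by (auto simp: is_circuit_def)
  then show ?thesis
    using C(3) by (subst gate_val.simps) (auto simp: gate_out_def split: gate.split)
qed

lemma wires_weft_depth:
  assumes C: "is_circuit C" "j < length C" and i: "i \<in> set (wires (C ! j))"
  shows "i < j" "i < length C" "gate_depth C i < gate_depth C j"
    "gate_weft C i + of_bool (2 < length (wires (C ! j))) \<le> gate_weft C j"
proof -
  show "i < j" using C i by (auto simp: is_circuit_def)
  then show "i < length C" using C(2) by simp
  let ?I = "{i \<in> set (wires (C ! j)). i < j}"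
  have fin: "finite ?I" by simp
  have "C ! j \<noteq> InputG" using i by auto
  have "gate_depth C i \<le> Max (insert 0 (gate_depth C ` ?I))"
    using i \<open>i < j\<close> fin by (intro Max_ge) auto
  then show "gate_depth C i < gate_depth C j"
    using \<open>C ! j \<noteq> InputG\<close> by (subst gate_depth.simps[of C j]) simp
  have "gate_weft C i \<le> Max (insert 0 (gate_weft C ` ?I))"
    using i \<open>i < j\<close> fin by (intro Max_ge) auto
  then show "gate_weft C i + of_bool (2 < length (wires (C ! j))) \<le> gate_weft C j"
    by (subst gate_weft.simps[of C j]) simp
qed

lemma weft_pos_if_large: "2 < length (wires (C ! j)) \<Longrightarrow> 0 < gate_weft C j"
  by (subst gate_weft.simps) simp

lemma tl_tl_Nil_iff: "tl (tl xs) = [] \<longleftrightarrow> length xs \<le> 2"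
  by (cases xs; cases "tl xs") auto

text \<open>
  The value of a gate of weft at most one is forced by the facts of few items, whatever items
  are added: for the large gates, this is a single argument that determines its value if there
  is one, and nothing otherwise.
\<close>

context
  fixes C :: "gate list" and S :: "nat set" and facts :: "'e \<Rightarrow> (nat \<times> bool) list" and E :: "'e set"
  assumes C: "is_circuit C"
    and sound: "\<And>e j b. e \<in> E \<Longrightarrow> (j, b) \<in> set (facts e) \<Longrightarrow> j \<in> inputs C \<and> b = (j \<in> S)"
    and complete: "\<And>j. j \<in> inputs C \<Longrightarrow> \<exists>e \<in> E. (j, j \<in> S) \<in> set (facts e)"
begin

abbreviation "known_from X \<equiv> set (known (concat (map facts X)) C)"

lemma known_input:
  assumes "j < length C" "C ! j = InputG"
  shows "(j, b) \<in> known_from X \<longleftrightarrow> (\<exists>e \<in> set X. (j, b) \<in> set (facts e))"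
  using in_known[OF C assms(1)] assms(2) by (auto simp: evaluable_def)

lemma known_gate:
  assumes "j < length C" "C ! j \<noteq> InputG" "set X \<subseteq> E"
  shows "(j, b) \<in> known_from X \<longleftrightarrow>
    evaluable (C ! j) (known_from X) \<and> b = gate_out (C ! j) (known_from X)"
proof -
  have "(j, b) \<notin> set (concat (map facts X))"
    using sound[of _ j b] assms by (auto simp: inputs_def)
  then show ?thesis using in_known[OF C assms(1)] by blast
qed

text \<open>At weft zero all gates involved are small and wait for all their arguments, so no
  default value enters and every derived fact is true.\<close>

lemma known_sound:
  assumes "j < length C" "gate_weft C j = 0" "(j, b) \<in> known_from X" "set X \<subseteq> E"
  shows "b = gate_val C S j"
  using assms
proof (induction j arbitrary: b rule: less_induct)
  case (less j)
  show ?case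
  proof (cases "C ! j = InputG")
    case True
    then obtain e where "e \<in> E" "(j, b) \<in> set (facts e)"
      using less.prems known_input by blast
    then show ?thesis using sound True by (subst gate_val.simps) auto
  next
    case False
    then have *: "evaluable (C ! j) (known_from X)" "b = gate_out (C ! j) (known_from X)"
      using less.prems known_gate by blast+
    have "length (wires (C ! j)) \<le> 2"
      using less.prems(2) weft_pos_if_large[of C j] by fastforce
    then have all: "\<forall>i \<in> set (wires (C ! j)). (i, True) \<in> known_from X \<or> (i, False) \<in> known_from X"
      using *(1) by (auto simp: evaluable_def tl_tl_Nil_iff)
    have IH: "c = gate_val C S i" if "i \<in> set (wires (C ! j))" "(i, c) \<in> known_from X" for i c
      using wires_weft_depth[OF C less.prems(1) that(1)] less.prems that less.IH[of i c] by simp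
    then have "(i, c) \<in> known_from X \<longleftrightarrow> c = gate_val C S i" if "i \<in> set (wires (C ! j))" for i c
      using all that by (metis (full_types))
    then show ?thesis
      unfolding *(2) gate_val_eq_gate_out[OF C less.prems(1) False] by (intro gate_out_cong) auto
  qed
qed

text \<open>The claim is made for all \<open>X\<close> containing \<open>w\<close> because
  evaluation is not monotone: a default value is withdrawn when a decisive argument becomes
  known.\<close>

lemma known_complete:
  assumes "j < length C" "gate_weft C j \<le> 1"
  shows "\<exists>w. set w \<subseteq> E \<and> length w \<le> 2 ^ gate_depth C j \<and>
    (\<forall>X b. set w \<subseteq> set X \<longrightarrow> set X \<subseteq> E \<longrightarrow> ((j, b) \<in> known_from X \<longleftrightarrow> b = gate_val C S j))"
  using assms
proof (induction j rule: less_induct)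
  case (less j)
  consider (input) "C ! j = InputG" | (large) "2 < length (wires (C ! j))"
    | (small) "C ! j \<noteq> InputG" "length (wires (C ! j)) \<le> 2" by fastforce
  then show ?case
  proof cases
    case input
    then have j: "j \<in> inputs C" using less.prems by (simp add: inputs_def)
    obtain e where e: "e \<in> E" "(j, j \<in> S) \<in> set (facts e)" using complete[OF j] by blast
    have "gate_val C S j = (j \<in> S)" using input by (subst gate_val.simps) simp
    moreover have "(j, b) \<in> known_from X \<longleftrightarrow> b = (j \<in> S)" if "set [e] \<subseteq> set X" "set X \<subseteq> E" for X b
      using known_input[OF less.prems(1) input] sound[of _ j b] e(2) that by auto
    ultimately show ?thesis using e(1) by (intro exI[of _ "[e]"]) auto
  next
    case large
    then have inp: "C ! j \<noteq> InputG" by auto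
    have ev: "evaluable (C ! j) K" for K
      using large inp by (simp add: evaluable_def tl_tl_Nil_iff)
    have weft: "gate_weft C i = 0" if "i \<in> set (wires (C ! j))" for i
      using wires_weft_depth(4)[OF C less.prems(1) that] large less.prems(2) by simp
    note wire = wires_weft_depth(1-3)[OF C less.prems(1)]
    have out: "(j, b) \<in> known_from X \<longleftrightarrow> b = gate_out (C ! j) (known_from X)" if "set X \<subseteq> E" for X b
      using known_gate[OF less.prems(1) inp that] ev by blast
    \<comment> \<open>\<open>c\<close> is the controlling value, true for disjunctions and false for
      conjunctions: a single argument with value \<open>c\<close> determines the gate.\<close>
    define c where "c = (gate_tag (C ! j) = 3)"
    have tag: "gate_tag (C ! j) = 2 \<or> gate_tag (C ! j) = 3"
      using large by (cases "C ! j") auto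
    have c: "gate_out (C ! j) K = (if \<exists>i \<in> set (wires (C ! j)). (i, c) \<in> K then c else \<not> c)" for K
      using tag by (auto simp: gate_out_def c_def)
    show ?thesis
    proof (cases "\<exists>i \<in> set (wires (C ! j)). gate_val C S i = c")
      case True
      then obtain i where i: "i \<in> set (wires (C ! j))" "gate_val C S i = c" by blast
      obtain w where w: "set w \<subseteq> E" "length w \<le> 2 ^ gate_depth C i"
        "\<forall>X b. set w \<subseteq> set X \<longrightarrow> set X \<subseteq> E \<longrightarrow> ((i, b) \<in> known_from X \<longleftrightarrow> b = gate_val C S i)"
        using less.IH[of i] wire[OF i(1)] weft[OF i(1)] by auto
      have "\<exists>i \<in> set (wires (C ! j)). (i, c) \<in> {(i, b). b = gate_val C S i}" using i by blast
      then have "gate_val C S j = c"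
        unfolding gate_val_eq_gate_out[OF C less.prems(1) inp] c by (rule if_P)
      moreover have "(j, b) \<in> known_from X \<longleftrightarrow> b = c" if "set w \<subseteq> set X" "set X \<subseteq> E" for X b
      proof -
        have "(i, c) \<in> known_from X" using w(3) that i(2) by blast
        then have "\<exists>i \<in> set (wires (C ! j)). (i, c) \<in> known_from X" using i(1) by blast
        then have "gate_out (C ! j) (known_from X) = c" unfolding c by (rule if_P)
        then show ?thesis using out[OF that(2)] by simp
      qed
      moreover have "length w \<le> 2 ^ gate_depth C j"
        using w(2) wire(3)[OF i(1)] by (elim order_trans) (intro power_increasing, simp_all)
      ultimately show ?thesis using w(1) by (intro exI[of _ w]) auto
    next
      case False
      then have "\<not> (\<exists>i \<in> set (wires (C ! j)). (i, c) \<in> {(i, b). b = gate_val C S i})" by blast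
      then have "gate_val C S j = (\<not> c)"
        unfolding gate_val_eq_gate_out[OF C less.prems(1) inp] c by (rule if_not_P)
      moreover have "(j, b) \<in> known_from X \<longleftrightarrow> b = (\<not> c)" if "set X \<subseteq> E" for X b
      proof -
        \<comment> \<open>The arguments have weft zero, so by \<open>known_sound\<close> no choice
          of items can produce a wrong fact \<open>(i, c)\<close>; the default value is safe and the
          empty witness suffices.\<close>
        have "(i, c) \<notin> known_from X" if "i \<in> set (wires (C ! j))" for i
          using known_sound[of i c X] wire[OF that] weft[OF that] False \<open>set X \<subseteq> E\<close> that by auto
        then have "\<not> (\<exists>i \<in> set (wires (C ! j)). (i, c) \<in> known_from X)" by blast
        then have "gate_out (C ! j) (known_from X) = (\<not> c)" unfolding c by (rule if_not_P)
        then show ?thesis using out[OF that] by simp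
      qed
      ultimately show ?thesis by (intro exI[of _ "[]"]) auto
    qed
  next
    case small
    note wire = wires_weft_depth(1-3)[OF C less.prems(1)]
    have "\<exists>w. set w \<subseteq> E \<and> length w \<le> 2 ^ gate_depth C i \<and>
      (\<forall>X b. set w \<subseteq> set X \<longrightarrow> set X \<subseteq> E \<longrightarrow> ((i, b) \<in> known_from X \<longleftrightarrow> b = gate_val C S i))"
      if "i \<in> set (wires (C ! j))" for i
      using less.IH[of i] wire[OF that] wires_weft_depth(4)[OF C less.prems(1) that] less.prems(2) by simp
    then obtain w where w: "\<And>i. i \<in> set (wires (C ! j)) \<Longrightarrow> set (w i) \<subseteq> E"
      "\<And>i. i \<in> set (wires (C ! j)) \<Longrightarrow> length (w i) \<le> 2 ^ gate_depth C i"
      "\<And>i X b. i \<in> set (wires (C ! j)) \<Longrightarrow> set (w i) \<subseteq> set X \<Longrightarrow> set X \<subseteq> E \<Longrightarrow>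
        (i, b) \<in> known_from X \<longleftrightarrow> b = gate_val C S i"
      by metis
    let ?w = "concat (map w (wires (C ! j)))"
    have "(j, b) \<in> known_from X \<longleftrightarrow> b = gate_val C S j" if X: "set ?w \<subseteq> set X" "set X \<subseteq> E" for X b
    proof -
      have eq: "(i, c) \<in> known_from X \<longleftrightarrow> c = gate_val C S i" if "i \<in> set (wires (C ! j))" for i c
        using w(3)[OF that _ X(2)] X(1) that by auto
      then have "gate_out (C ! j) (known_from X) = gate_out (C ! j) {(i, b). b = gate_val C S i}"
        by (intro gate_out_cong) simp
      moreover have "evaluable (C ! j) (known_from X)"
        using eq small(1) by (auto simp: evaluable_def)
      ultimately show ?thesis
        using known_gate[OF less.prems(1) small(1) X(2)] gate_val_eq_gate_out[OF C less.prems(1) small(1)]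
        by simp
    qed
    \<comment> \<open>At most two arguments, each of smaller depth: this doubling per level is the
      origin of the bound.\<close>
    moreover have "length ?w \<le> 2 ^ gate_depth C j"
    proof (cases "gate_depth C j")
      case 0
      then have "wires (C ! j) = []" using wire(3) by (cases "wires (C ! j)") fastforce+
      then show ?thesis by simp
    next
      case (Suc d)
      have "length (w i) \<le> 2 ^ d" if "i \<in> set (wires (C ! j))" for i
        using w(2)[OF that] wire(3)[OF that] Suc
        by (elim order_trans) (intro power_increasing, simp_all)
      then have "length ?w \<le> (\<Sum>i\<leftarrow>wires (C ! j). 2 ^ d)"
        by (auto simp: length_concat comp_def intro!: sum_list_mono)
      also have "\<dots> \<le> 2 * 2 ^ d"
        using small(2) by (simp add: sum_list_triv)
      finally show ?thesis by (simp add: Suc)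
    qed
    moreover have "set ?w \<subseteq> E" using w(1) by auto
    ultimately show ?thesis by (intro exI[of _ ?w]) auto
  qed
qed

end


section \<open>Gaps\<close>

text \<open>
  A subset \<open>{s\<^sub>0 < \<dots> < s\<^sub>k\<^sub>-\<^sub>1}\<close> of a list \<open>P\<close> is given by the items \<open>(i, A, D)\<close>, where \<open>A\<close> is
  the part of \<open>P\<close> after \<open>s\<^sub>i\<^sub>-\<^sub>1\<close> and \<open>D\<close> the part of \<open>P\<close> from \<open>s\<^sub>i\<close> on. In this way, each element
  outside the set is witnessed by an item, too. The last two items, with \<open>i = k\<close> and \<open>i = k + 1\<close>,
  have \<open>D = []\<close>; the very last one only serves to make the number of indices at least two.
\<close>

type_synonym gap = "nat \<times> nat list \<times> nat list"

definition gap_facts :: "gap \<Rightarrow> (nat \<times> bool) list" where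
  "gap_facts e = map (\<lambda>j. (j, False)) (filter (\<lambda>j. j \<notin> set (snd (snd e))) (fst (snd e)))
    @ map (\<lambda>j. (j, True)) (take 1 (snd (snd e)))"

text \<open>These are the conditions on a single item; the links between items are left to
  \<open>consistent\<close>. The last conjunct ends the chain after exactly \<open>length ks\<close>
  heads, which fixes the weight.\<close>

definition valid_gap :: "nat list \<Rightarrow> unit list \<Rightarrow> gap \<Rightarrow> bool" where
  "valid_gap P ks e \<longleftrightarrow> snd (snd e) \<in> set (tails (fst (snd e))) \<and>
    (fst e = 0 \<longrightarrow> fst (snd e) = P) \<and> ((snd (snd e) = []) = (fst e \<notin> set [0..<length ks]))"

text \<open>It is a condition on pairs of items, so that it can be enforced through edges of a
  graph.\<close>

definition consistent :: "gap list \<Rightarrow> bool" where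
  "consistent xs \<longleftrightarrow> (\<forall>e \<in> set xs. \<forall>e' \<in> set xs. (fst e = fst e' \<longrightarrow> snd e = snd e') \<and>
    (fst e' = Suc (fst e) \<longrightarrow> fst (snd e') = tl (snd (snd e))))"

context
  fixes P :: "nat list" and ks :: "unit list" and A D :: "nat \<Rightarrow> nat list"
  assumes P: "distinct P" and A0: "A 0 = P"
    and D: "\<And>i. i < length ks + 2 \<Longrightarrow> D i \<in> set (tails (A i))"
    and D_Nil: "\<And>i. i < length ks + 2 \<Longrightarrow> D i = [] \<longleftrightarrow> length ks \<le> i"
    and A_Suc: "\<And>i. Suc i < length ks + 2 \<Longrightarrow> A (Suc i) = tl (D i)"
begin

lemma chain_distinct: "i < length ks + 2 \<Longrightarrow> distinct (A i) \<and> set (A i) \<subseteq> set P"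
proof (induction i)
  case (Suc i)
  then have "distinct (A i) \<and> set (A i) \<subseteq> set P" "A (Suc i) = tl (D i)" "D i \<in> set (tails (A i))"
    using A_Suc D by auto
  then show ?case
    by (cases "D i") (auto simp: set_tails)
qed (simp add: A0 P)

lemma chain_subset:
  assumes "i < length ks + 2"
  shows "set (D i) \<subseteq> set (A i)" "distinct (D i)"
  using D[OF assms] chain_distinct[OF assms] by (auto simp: set_tails)

text \<open>\<open>tl\<close> removes the head selected at step \<open>l\<close>, and all later
  parts stay inside the remainder. So no selected element returns, and the heads are
  distinct.\<close>

lemma chain_later: "l < i \<Longrightarrow> i < length ks + 2 \<Longrightarrow> set (A i) \<subseteq> set (tl (D l))"
proof (induction i)
  case (Suc i)
  have "set (A (Suc i)) \<subseteq> set (D i)"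
    using A_Suc[OF Suc.prems(2)] by (cases "D i") auto
  then show ?case
    using Suc A_Suc[OF Suc.prems(2)] chain_subset(1)[of i] by (cases "l = i") auto
qed simp

lemma hd_chain:
  assumes "i < length ks"
  shows "hd (D i) \<in> set (D i)" "hd (D i) \<notin> set (tl (D i))"
  using assms D_Nil[of i] chain_subset(2)[of i] by (cases "D i"; simp)+

lemma card_chain: "card ((\<lambda>i. hd (D i)) ` {..<length ks}) = length ks"
proof -
  have "hd (D l) \<noteq> hd (D i)" if "l < i" "i < length ks" for l i
    using chain_later[of l i] hd_chain[of i] hd_chain[of l] chain_subset(1)[of i] that by auto
  then have "inj_on (\<lambda>i. hd (D i)) {..<length ks}"
    unfolding inj_on_def by (metis lessThan_iff linorder_neqE_nat)
  then show ?thesis by (simp add: card_image)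
qed

text \<open>The essential case is a false fact: an element of \<open>A i\<close> outside
  \<open>D i\<close> differs from the heads before \<open>i\<close>, which have been removed, and
  from the head of \<open>D i\<close> and the later heads, which all lie in
  \<open>D i\<close>.\<close>

lemma chain_sound:
  assumes "i < length ks + 2" "(j, b) \<in> set (gap_facts (i, A i, D i))"
  shows "j \<in> set P \<and> b = (j \<in> (\<lambda>i. hd (D i)) ` {..<length ks})"
proof (cases b)
  case True
  then have "D i \<noteq> []" "j = hd (D i)"
    using assms(2) by (cases "D i"; auto simp: gap_facts_def)+
  then have "j \<in> set (D i)" by simp
  then have "j \<in> set P" using chain_subset(1)[OF assms(1)] chain_distinct[OF assms(1)] by blast
  then show ?thesis
    using True \<open>D i \<noteq> []\<close> \<open>j = hd (D i)\<close> assms(1) D_Nil[of i] by auto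
next
  case False
  then have j: "j \<in> set (A i)" "j \<notin> set (D i)"
    using assms(2) by (auto simp: gap_facts_def)
  have "j \<noteq> hd (D l)" if l: "l < length ks" for l
  proof (cases l i rule: linorder_cases)
    case less
    then show ?thesis using chain_later[of l i] hd_chain[of l] j(1) l assms(1) by auto
  next
    case equal
    then show ?thesis using hd_chain[of l] j(2) l by auto
  next
    case greater
    then have "set (A l) \<subseteq> set (D i)"
      using chain_later[of i l] l by (cases "D i") auto
    then show ?thesis using hd_chain[of l] chain_subset(1)[of l] j(2) l by auto
  qed
  then show ?thesis using False j(1) chain_distinct[OF assms(1)] by auto
qed

text \<open>An element that is never selected is pursued along the chain: while it is in
  \<open>D i\<close>, it is not the head and reaches \<open>A (Suc i)\<close>. As
  \<open>D (length ks)\<close> is empty, some item must skip it and certify that it is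
  false.\<close>

lemma chain_complete:
  assumes "j \<in> set P"
  shows "\<exists>i < length ks + 2. (j, j \<in> (\<lambda>i. hd (D i)) ` {..<length ks}) \<in> set (gap_facts (i, A i, D i))"
proof (cases "j \<in> (\<lambda>i. hd (D i)) ` {..<length ks}")
  case True
  then obtain i where i: "i < length ks" "j = hd (D i)" by auto
  then have "(j, True) \<in> set (gap_facts (i, A i, D i))"
    using D_Nil[of i] by (cases "D i") (auto simp: gap_facts_def)
  then show ?thesis using True i(1) by (intro exI[of _ i]) simp
next
  case False
  have "\<exists>i < length ks + 2. j \<in> set (A i) \<and> j \<notin> set (D i)" if "i \<le> length ks" "j \<in> set (A i)" for i
    using that
  proof (induction "length ks - i" arbitrary: i rule: less_induct)
    case less
    show ?case
    proof (cases "j \<in> set (D i)")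
      case True
      then have i: "i < length ks" using D_Nil[of i] less.prems(1) by (cases "D i") auto
      then have "j \<noteq> hd (D i)" using \<open>j \<notin> (\<lambda>i. hd (D i)) ` {..<length ks}\<close> by auto
      then have "j \<in> set (A (Suc i))"
        using i A_Suc[of i] True by (cases "D i") auto
      then show ?thesis using less.hyps[of "Suc i"] i by simp
    qed (use less.prems in \<open>auto intro!: exI[of _ i]\<close>)
  qed
  from this[of 0] obtain i where "i < length ks + 2" "j \<in> set (A i)" "j \<notin> set (D i)"
    using assms A0 by auto
  then show ?thesis using False by (intro exI[of _ i]) (auto simp: gap_facts_def)
qed

end

text \<open>\<open>D i\<close> starts at the first element of \<open>S\<close> in
  \<open>A i\<close>. Each step removes one element of \<open>S\<close> as long as any is left, so
  \<open>D i\<close> is empty exactly from \<open>length ks\<close> on.\<close>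

lemma chain_exists:
  fixes P :: "nat list"
  assumes P: "distinct P" and S: "S \<subseteq> set P" "card S = length ks"
  shows "\<exists>A D. A 0 = P \<and> (\<forall>i. D i \<in> set (tails (A i))) \<and> (\<forall>i. D i = [] \<longleftrightarrow> length ks \<le> i) \<and>
    (\<forall>i. A (Suc i) = tl (D i)) \<and> (\<lambda>i. hd (D i)) ` {..<length (ks :: unit list)} = S"
proof -
  define A where "A = rec_nat P (\<lambda>_ xs. tl (dropWhile (\<lambda>j. j \<notin> S) xs))"
  define D where "D i = dropWhile (\<lambda>j. j \<notin> S) (A i)" for i
  have A: "A 0 = P" "\<And>i. A (Suc i) = tl (D i)" by (simp_all add: A_def D_def)
  have tails: "D i \<in> set (tails (A i))" for i
    unfolding set_tails D_def by (auto intro!: exI[of _ "takeWhile (\<lambda>j. j \<notin> S) (A i)"])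
  have fin: "finite S" using S(1) finite_subset by auto
  have Nil: "D i = [] \<longleftrightarrow> S \<inter> set (A i) = {}" for i
    by (auto simp: D_def dropWhile_eq_Nil_conv)
  have hd: "hd (D i) \<in> S" if "D i \<noteq> []" for i
    using hd_dropWhile[of "\<lambda>j. j \<notin> S" "A i"] that by (simp add: D_def)
  have inter: "S \<inter> set (D i) = S \<inter> set (A i)" for i
  proof -
    have "set (A i) = set (takeWhile (\<lambda>j. j \<notin> S) (A i)) \<union> set (D i)"
      unfolding D_def by (metis set_append takeWhile_dropWhile_id)
    then show ?thesis by (auto dest: set_takeWhileD)
  qed
  have card: "distinct (A i) \<and> card (S \<inter> set (A i)) = length ks - i" for i
  proof (induction i)
    case 0
    have "S \<inter> set P = S" using S(1) by auto
    then show ?case using P S(2) A(1) by simp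
  next
    case (Suc i)
    have dist: "distinct (D i)" using Suc by (simp add: D_def)
    show ?case
    proof (cases "D i")
      case Nil': Nil
      then have "card (S \<inter> set (A i)) = 0" using Nil[of i] by simp
      then show ?thesis using Suc A(2)[of i] Nil' by simp
    next
      case (Cons d ds)
      have "S \<inter> set ds = S \<inter> set (A i) - {d}"
        using dist hd[of i] inter[of i] Cons by auto
      moreover have "d \<in> S \<inter> set (A i)" using hd[of i] inter[of i] Cons by auto
      ultimately have "card (S \<inter> set ds) = card (S \<inter> set (A i)) - 1" using fin by simp
      then show ?thesis using Suc dist A(2)[of i] Cons by simp
    qed
  qed
  have D_Nil: "D i = [] \<longleftrightarrow> length ks \<le> i" for i
    using card[of i] Nil[of i] fin by (metis card_0_eq diff_is_0_eq finite_Int)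
  have "(\<lambda>i. hd (D i)) ` {..<length ks} = S"
  proof (rule card_subset_eq[OF fin])
    show "(\<lambda>i. hd (D i)) ` {..<length ks} \<subseteq> S" using hd D_Nil by fastforce
    show "card ((\<lambda>i. hd (D i)) ` {..<length ks}) = card S"
      unfolding S(2) using A tails D_Nil by (intro card_chain[of P A ks D] P) auto
  qed
  then show ?thesis using A tails D_Nil by blast
qed

section \<open>From circuits to cliques\<close>

definition input_gates :: "gate list \<Rightarrow> nat list" where
  "input_gates C = map fst (filter (\<lambda>p. snd p = InputG) (List.enumerate 0 C))"

lemma set_input_gates: "set (input_gates C) = inputs C"
proof -
  have "p \<in> set (List.enumerate 0 C) \<longleftrightarrow> fst p < length C \<and> snd p = C ! fst p" for p
    by (auto simp: in_set_enumerate_eq)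
  then show ?thesis
    unfolding input_gates_def inputs_def by (force simp: image_iff)
qed

lemma distinct_input_gates: "distinct (input_gates C)"
  unfolding input_gates_def by (rule distinct_map_filter) simp

text \<open>\<open>length (() # () # snd z)\<close> is \<open>k + 2\<close> in a form covered by
  \<open>ptime_upt\<close>. Both list components are tails of the input list, so there are only
  polynomially many items.\<close>

definition gaps :: "gate list \<times> unit list \<Rightarrow> gap list" where
  "gaps z = filter (valid_gap (input_gates (fst z)) (snd z))
    (List.product [0..<length (() # () # snd z)]
      (List.product (tails (input_gates (fst z))) (tails (input_gates (fst z)))))"

type_synonym vertex = "gap list \<times> gap list"

text \<open>\<open>length (tl C)\<close> is \<open>circuit_out C\<close>, expressed without
  subtraction.\<close>

definition accepts :: "gate list \<Rightarrow> gap list \<Rightarrow> bool" where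
  "accepts C X \<longleftrightarrow> (length (tl C), True) \<in> set (known (concat (map gap_facts X)) C)"

text \<open>
  Without the isolated vertices \<open>dummies\<close>, the graph could have fewer vertices than a clique
  needs, or so few edges that the subtraction in the budget of \<open>graph_inst\<close> is truncated.
\<close>

definition dummies :: "nat \<Rightarrow> unit list \<Rightarrow> vertex list" where
  "dummies R ks = map (\<lambda>J. ([], map (\<lambda>i. (i, [], [])) J))
    (List.n_lists (2 * R) [0..<length (() # () # ks)])"

definition vertices :: "nat \<Rightarrow> gate list \<times> unit list \<Rightarrow> vertex list" where
  "vertices R z = dummies R (snd z) @
    filter (\<lambda>\<sigma>. consistent (fst \<sigma> @ snd \<sigma>) \<and> accepts (fst z) (fst \<sigma> @ snd \<sigma>))
      (List.product (List.n_lists R (gaps z)) (List.n_lists R (gaps z)))"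

text \<open>Different index tuples are demanded so that a clique has at most one vertex per tuple; a
  clique as large as the number of tuples then realizes each of them. Equality supplies the
  loops.\<close>

definition adjacent :: "vertex \<Rightarrow> vertex \<Rightarrow> bool" where
  "adjacent \<sigma> \<tau> \<longleftrightarrow> \<sigma> = \<tau> \<or>
    map fst (fst \<sigma>) \<noteq> map fst (fst \<tau>) \<and> snd \<sigma> = snd \<tau> \<and> consistent (fst \<sigma> @ fst \<tau>)"

section \<open>Symmetry, and enumerations without repetition\<close>

lemma consistent_append_commute: "consistent (xs @ ys) = consistent (ys @ xs)"
  unfolding consistent_def by auto

lemma adjacent_sym: "adjacent \<sigma> \<tau> \<Longrightarrow> adjacent \<tau> \<sigma>"
  unfolding adjacent_def using consistent_append_commute[of "fst \<sigma>"] by auto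

lemma length_n_lists: "length (List.n_lists n xs) = length xs ^ n"
  by (induction n) (auto simp: length_concat comp_def sum_list_triv)

lemma distinct_n_lists:
  assumes "distinct xs"
  shows "distinct (List.n_lists n xs)"
proof (rule card_distinct)
  have "{ys. length ys = n \<and> set ys \<subseteq> set xs} = {ys. set ys \<subseteq> set xs \<and> length ys = n}" by auto
  then show "card (set (List.n_lists n xs)) = length (List.n_lists n xs)"
    unfolding set_n_lists length_n_lists
    using card_lists_length_eq[of "set xs" n] distinct_card[OF assms] by simp
qed

lemma distinct_tails: "distinct (tails xs)"
proof (induction xs)
  case (Cons x xs)
  have "x # xs \<notin> set (tails xs)" by (auto simp: set_tails dest: arg_cong[of _ _ length])
  then show ?case using Cons by simp
qed simp

lemma distinct_gaps: "distinct (gaps z)"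
  unfolding gaps_def by (intro distinct_filter distinct_product distinct_upt distinct_tails)

lemma in_gaps:
  "e \<in> set (gaps z) \<longleftrightarrow> fst e < length (snd z) + 2 \<and> fst (snd e) \<in> set (tails (input_gates (fst z)))
    \<and> snd (snd e) \<in> set (tails (input_gates (fst z))) \<and> valid_gap (input_gates (fst z)) (snd z) e"
  by (cases e) (auto simp: gaps_def)

lemma distinct_vertices:
  assumes "0 < R"
  shows "distinct (vertices R z)"
proof -
  have "inj (\<lambda>J. ([] :: gap list, map (\<lambda>i. (i, [], []) :: gap) J))"
    by (auto simp: inj_on_def inj_map_eq_map)
  then have "distinct (dummies R (snd z))"
    unfolding dummies_def by (simp add: distinct_map distinct_n_lists inj_on_subset[OF _ subset_UNIV] del: upt_Suc)
  moreover have "set (dummies R (snd z)) \<inter> set (List.product (List.n_lists R (gaps z)) (List.n_lists R (gaps z))) = {}"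
    using assms by (auto simp: dummies_def set_n_lists)
  ultimately show ?thesis
    unfolding vertices_def distinct_append
    by (intro conjI distinct_filter distinct_product distinct_n_lists distinct_gaps)
      (auto simp del: set_product)
qed

text \<open>All items are taken from the chain of \<open>S\<close>, so consistency is automatic. As
  \<open>w\<close> contains the list from \<open>known_complete\<close>, further items cannot change
  the value of the output, and all vertices are accepted.\<close>

lemma clique_if_satisfiable:
  assumes C: "C \<in> circuits 1 h" and R: "R = 2 ^ h"
    and S: "S \<subseteq> inputs C" "card S = length ks" "gate_val C S (circuit_out C)"
  shows "\<exists>T \<subseteq> set (vertices R (C, ks)). card T = (length ks + 2) ^ R \<and>
    (\<forall>\<sigma> \<in> T. \<forall>\<tau> \<in> T. adjacent \<sigma> \<tau>)"
proof -
  let ?P = "input_gates C" and ?n = "length ks + 2"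
  have circ: "is_circuit C" "gate_weft C (circuit_out C) \<le> 1" "gate_depth C (circuit_out C) \<le> h"
    using C by (auto simp: circuits_def)
  then have out: "circuit_out C < length C" by (auto simp: is_circuit_def circuit_out_def)
  obtain A D where chain: "A 0 = ?P" "\<And>i. D i \<in> set (tails (A i))" "\<And>i. D i = [] \<longleftrightarrow> length ks \<le> i"
    "\<And>i. A (Suc i) = tl (D i)" "(\<lambda>i. hd (D i)) ` {..<length ks} = S"
    using chain_exists[OF distinct_input_gates[of C], of S ks] S(1,2) by (auto simp: set_input_gates)
  define it where "it i = (i, A i, D i)" for i
  have tails_A: "A i \<in> set (tails ?P)" for i
  proof (induction i)
    case 0
    show ?case by (simp add: chain(1) set_tails)
  next
    case (Suc i)
    then obtain us ws where "?P = us @ A i" "A i = ws @ D i"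
      using chain(2)[of i] by (auto simp: set_tails)
    then show ?case
      by (cases "D i") (auto simp: chain(4) set_tails intro: exI[of _ ?P])
  qed
  have it: "it i \<in> set (gaps (C, ks))" if "i < ?n" for i
  proof -
    have "D i \<in> set (tails ?P)"
      using tails_A[of i] chain(2)[of i] by (auto simp: set_tails)
    then show ?thesis
      using that tails_A[of i] chain(1-3) by (auto simp: in_gaps it_def valid_gap_def)
  qed
  have cons: "consistent xs" if "set xs \<subseteq> range it" for xs
  proof -
    have "e = it (fst e)" if "e \<in> set xs" for e
      using that \<open>set xs \<subseteq> range it\<close> by (auto simp: it_def)
    then show ?thesis
      unfolding consistent_def by (metis chain(4) fst_conv it_def snd_conv)
  qed
  note hyps = distinct_input_gates[of C] chain(1-4)
  have sound: "j \<in> inputs C \<and> b = (j \<in> S)" if "e \<in> it ` {..<?n}" "(j, b) \<in> set (gap_facts e)" for e j b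
    using chain_sound[of ?P A ks D _ j b] hyps that unfolding chain(5)
    by (auto simp: it_def set_input_gates simp del: One_nat_def)
  have complete: "\<exists>e \<in> it ` {..<?n}. (j, j \<in> S) \<in> set (gap_facts e)" if "j \<in> inputs C" for j
    using chain_complete[of ?P A ks D j] hyps that unfolding chain(5)
    by (auto simp: it_def set_input_gates)
  have "\<exists>w. set w \<subseteq> it ` {..<?n} \<and> length w \<le> 2 ^ gate_depth C (circuit_out C) \<and>
    (\<forall>X b. set w \<subseteq> set X \<longrightarrow> set X \<subseteq> it ` {..<?n} \<longrightarrow>
      ((circuit_out C, b) \<in> set (known (concat (map gap_facts X)) C) \<longleftrightarrow> b = gate_val C S (circuit_out C)))"
    by (rule known_complete) (fact circ(1) out circ(2) | erule (1) sound | erule complete)+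
  then obtain w' where w': "set w' \<subseteq> it ` {..<?n}" "length w' \<le> 2 ^ gate_depth C (circuit_out C)"
    "\<And>X b. set w' \<subseteq> set X \<Longrightarrow> set X \<subseteq> it ` {..<?n} \<Longrightarrow>
      (circuit_out C, b) \<in> set (known (concat (map gap_facts X)) C) \<longleftrightarrow> b = gate_val C S (circuit_out C)"
    by blast
  have "length w' \<le> R"
    using w'(2) circ(3) unfolding R by (elim order_trans) (intro power_increasing, simp_all)
  \<comment> \<open>Vertices carry exactly \<open>R\<close> items; padding is harmless because
    \<open>w'\<close> forces the output for every larger \<open>X\<close>.\<close>
  define w where "w = w' @ replicate (R - length w') (it 0)"
  have w: "set w \<subseteq> it ` {..<?n}" "length w = R" "set w' \<subseteq> set w"
    using w'(1) \<open>length w' \<le> R\<close> by (auto simp: w_def)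
  define T where "T = (\<lambda>J. (map it J, w)) ` set (List.n_lists R [0..<?n])"
  have J: "length J = R" "set (map it J) \<subseteq> it ` {..<?n}" if "J \<in> set (List.n_lists R [0..<?n])" for J
    using that by (auto simp: set_n_lists)
  have fst_it: "map fst (map it J) = J" for J by (simp add: it_def comp_def)
  have inj: "inj_on (\<lambda>J. (map it J, w)) X" for X
    by (rule inj_on_inverseI[of _ "\<lambda>\<sigma>. map fst (fst \<sigma>)"]) (simp add: fst_it del: map_map)
  have "card T = ?n ^ R"
    unfolding T_def card_image[OF inj] distinct_card[OF distinct_n_lists[OF distinct_upt]] length_n_lists
    by simp
  moreover have "T \<subseteq> set (vertices R (C, ks))"
  proof
    fix \<sigma> assume "\<sigma> \<in> T"
    then obtain J where \<sigma>: "\<sigma> = (map it J, w)" "J \<in> set (List.n_lists R [0..<?n])"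
      by (auto simp: T_def)
    note J = J[OF \<sigma>(2)]
    have "circuit_out C = length (tl C)" by (simp add: circuit_out_def)
    then have "accepts C (map it J @ w)"
      using w'(3)[of "map it J @ w" True] w J(2) S(3) unfolding accepts_def by (simp; blast)
    moreover have "consistent (map it J @ w)"
      using w(1) by (intro cons) auto
    moreover have "map it J \<in> set (List.n_lists R (gaps (C, ks)))" "w \<in> set (List.n_lists R (gaps (C, ks)))"
      using J w(1,2) it by (auto simp: set_n_lists)
    ultimately show "\<sigma> \<in> set (vertices R (C, ks))"
      by (simp add: vertices_def \<sigma>(1))
  qed
  moreover have "adjacent \<sigma> \<tau>" if "\<sigma> \<in> T" "\<tau> \<in> T" for \<sigma> \<tau>
  proof -
    obtain J J' where \<sigma>: "\<sigma> = (map it J, w)" "\<tau> = (map it J', w)" using \<open>\<sigma> \<in> T\<close> \<open>\<tau> \<in> T\<close> by (auto simp: T_def)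
    have "consistent (map it J @ map it J')" by (intro cons) auto
    then show ?thesis unfolding adjacent_def \<sigma> fst_conv snd_conv fst_it by auto
  qed
  ultimately show ?thesis by blast
qed

text \<open>Constant index tuples yield one item per index; adjacency and the consistency of each
  vertex force all other items, also those of \<open>w\<close>, to be among them. They form a chain
  defining \<open>S\<close>, and the vertex whose tuple forces the output for \<open>S\<close> was
  accepted.\<close>

lemma satisfiable_if_clique:
  assumes C: "C \<in> circuits 1 h" and R: "R = 2 ^ h"
    and T: "T \<subseteq> set (vertices R (C, ks))" "card T = (length ks + 2) ^ R"
      "\<And>\<sigma> \<tau>. \<sigma> \<in> T \<Longrightarrow> \<tau> \<in> T \<Longrightarrow> adjacent \<sigma> \<tau>"
  shows "\<exists>S \<subseteq> inputs C. card S = length ks \<and> gate_val C S (circuit_out C)"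
proof -
  let ?P = "input_gates C" and ?n = "length ks + 2"
  let ?J = "\<lambda>\<sigma> :: vertex. map fst (fst \<sigma>)"
  have circ: "is_circuit C" "gate_weft C (circuit_out C) \<le> 1" "gate_depth C (circuit_out C) \<le> h"
    using C by (auto simp: circuits_def)
  then have out: "circuit_out C < length C" by (auto simp: is_circuit_def circuit_out_def)
  have "0 < R" using R by simp
  have fin: "finite T" using T(1) finite_subset by blast
  have "2 \<le> card T"
  proof -
    have "2 \<le> ?n ^ 1" by simp
    also have "\<dots> \<le> ?n ^ R" using \<open>0 < R\<close> by (intro power_increasing) simp_all
    finally show ?thesis using T(2) by simp
  qed
  have real: "fst \<sigma> \<in> set (List.n_lists R (gaps (C, ks)))" "snd \<sigma> \<in> set (List.n_lists R (gaps (C, ks)))"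
    "consistent (fst \<sigma> @ snd \<sigma>)" "accepts C (fst \<sigma> @ snd \<sigma>)" if \<sigma>: "\<sigma> \<in> T" for \<sigma>
  proof -
    \<comment> \<open>A dummy is adjacent only to itself: dummies share the empty index tuple, and
      the second components of the other vertices have length \<open>R\<close> instead of
      \<open>2 * R\<close>. But the clique has two vertices.\<close>
    have "\<sigma> \<notin> set (dummies R ks)"
    proof
      assume dummy: "\<sigma> \<in> set (dummies R ks)"
      have "T \<noteq> {\<sigma>}" using \<open>2 \<le> card T\<close> by auto
      then obtain \<tau> where \<tau>: "\<tau> \<in> T" "\<tau> \<noteq> \<sigma>" using \<sigma> by blast
      then have snd: "snd \<tau> = snd \<sigma>" using T(3)[OF \<sigma> \<tau>(1)] by (auto simp: adjacent_def)
      have "\<tau> \<in> set (vertices R (C, ks))" using \<tau>(1) T(1) by blast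
      then consider "\<tau> \<in> set (dummies R ks)" | "length (snd \<tau>) = R"
        by (auto simp: vertices_def set_n_lists)
      then show False
      proof cases
        case 1
        then have "fst \<tau> = fst \<sigma>" using dummy by (auto simp: dummies_def)
        then show False using snd \<tau>(2) by (simp add: prod_eq_iff)
      next
        case 2
        moreover have "length (snd \<sigma>) = 2 * R" using dummy by (auto simp: dummies_def set_n_lists)
        ultimately show False using snd \<open>0 < R\<close> by simp
      qed
    qed
    then have "\<sigma> \<in> set (vertices R (C, ks)) - set (dummies R ks)" using T(1) \<sigma> by blast
    then show "fst \<sigma> \<in> set (List.n_lists R (gaps (C, ks)))" "snd \<sigma> \<in> set (List.n_lists R (gaps (C, ks)))"
      "consistent (fst \<sigma> @ snd \<sigma>)" "accepts C (fst \<sigma> @ snd \<sigma>)"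
      by (auto simp: vertices_def)
  qed
  have inj: "inj_on ?J T"
    using T(3) by (auto simp: inj_on_def adjacent_def)
  have gap_less: "fst e < ?n" if "e \<in> set (gaps (C, ks))" for e
    using that by (simp add: in_gaps)
  have J_sub: "?J ` T \<subseteq> set (List.n_lists R [0..<?n])"
    using real(1) gap_less by (fastforce simp: set_n_lists)
  \<comment> \<open>The vertices have distinct tuples and there are as many of them as tuples, so
    every tuple occurs.\<close>
  have J_image: "?J ` T = set (List.n_lists R [0..<?n])"
  proof (rule card_subset_eq[OF _ J_sub])
    show "card (?J ` T) = card (set (List.n_lists R [0..<?n]))"
      unfolding card_image[OF inj] T(2) distinct_card[OF distinct_n_lists[OF distinct_upt]] length_n_lists
      by simp
  qed simp
  have ex: "\<exists>\<sigma>. \<sigma> \<in> T \<and> ?J \<sigma> = J" if "length J = R" "set J \<subseteq> {..<?n}" for J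
  proof -
    have "J \<in> ?J ` T" unfolding J_image using that by (auto simp: set_n_lists)
    then show ?thesis by auto
  qed
  have "T \<noteq> {}" using \<open>2 \<le> card T\<close> by auto
  then obtain \<sigma>0 where "\<sigma>0 \<in> T" by blast
  define w where "w = snd \<sigma>0"
  have w: "snd \<sigma> = w" if "\<sigma> \<in> T" for \<sigma>
    using T(3)[OF that \<open>\<sigma>0 \<in> T\<close>] by (auto simp: adjacent_def w_def)
  have cons: "consistent (fst \<sigma> @ fst \<tau>)" if "\<sigma> \<in> T" "\<tau> \<in> T" for \<sigma> \<tau>
    using T(3)[OF that] real(3)[OF that(1)] by (auto simp: adjacent_def consistent_def)
  have "\<exists>\<sigma>. \<sigma> \<in> T \<and> ?J \<sigma> = replicate R i" if "i < ?n" for i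
    using that by (intro ex) auto
  then obtain s where s: "\<And>i. i < ?n \<Longrightarrow> s i \<in> T" "\<And>i. i < ?n \<Longrightarrow> ?J (s i) = replicate R i"
    by metis
  define it where "it i = hd (fst (s i))" for i
  have it: "it i \<in> set (fst (s i))" "fst (it i) = i" if "i < ?n" for i
  proof -
    have "fst (s i) \<noteq> []" using s(2)[OF that] \<open>0 < R\<close> by auto
    then show "it i \<in> set (fst (s i))" by (simp add: it_def)
    show "fst (it i) = i"
      using s(2)[OF that] \<open>0 < R\<close> \<open>fst (s i) \<noteq> []\<close> unfolding it_def
      by (metis hd_map hd_replicate length_0_conv length_replicate map_is_Nil_conv)
  qed
  have gap: "it i \<in> set (gaps (C, ks))" if "i < ?n" for i
    using it(1)[OF that] real(1)[OF s(1)[OF that]] by (auto simp: set_n_lists)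
  have eq_it: "e = it (fst e)" if "consistent (fst (s (fst e)) @ xs)" "e \<in> set xs" "fst e < ?n" for e xs
  proof -
    have "snd (it (fst e)) = snd e"
      using that(1,2) it[OF that(3)] unfolding consistent_def by (metis Un_iff set_append)
    then show ?thesis using it(2)[OF that(3)] by (simp add: prod_eq_iff)
  qed
  have \<rho>_it: "e = it (fst e) \<and> fst e < ?n" if "\<sigma> \<in> T" "e \<in> set (fst \<sigma>)" for \<sigma> e
  proof -
    have "e \<in> set (gaps (C, ks))" using real(1)[OF that(1)] that(2) by (auto simp: set_n_lists)
    then have "fst e < ?n" by (simp add: in_gaps)
    then show ?thesis using eq_it[OF cons[OF s(1) that(1)] that(2)] by blast
  qed
  have w_it: "e = it (fst e) \<and> fst e < ?n" if "e \<in> set w" for e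
  proof -
    have "e \<in> set (gaps (C, ks))" using real(2)[OF \<open>\<sigma>0 \<in> T\<close>] that by (auto simp: set_n_lists w_def)
    then have e: "fst e < ?n" by (simp add: in_gaps)
    have "consistent (fst (s (fst e)) @ w)" using real(3)[OF s(1)[OF e]] w[OF s(1)[OF e]] by simp
    then show ?thesis using eq_it that e by blast
  qed
  define A D where "A i = fst (snd (it i))" and "D i = snd (snd (it i))" for i
  have it_eq: "it i = (i, A i, D i)" if "i < ?n" for i
    using it(2)[OF that] by (simp add: A_def D_def prod_eq_iff)
  have valid: "valid_gap ?P ks (i, A i, D i)" if "i < ?n" for i
    using gap[OF that] it_eq[OF that] by (simp add: in_gaps)
  have A0: "A 0 = ?P" using valid[of 0] by (simp add: valid_gap_def)
  have D: "D i \<in> set (tails (A i))" "D i = [] \<longleftrightarrow> length ks \<le> i" if "i < ?n" for i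
    using valid[OF that] by (auto simp: valid_gap_def)
  have A_Suc: "A (Suc i) = tl (D i)" if "Suc i < ?n" for i
  proof -
    have "consistent (fst (s i) @ fst (s (Suc i)))" using s(1) that by (intro cons) simp_all
    then show ?thesis
      using it[of i] it[of "Suc i"] that unfolding consistent_def A_def D_def by (metis Suc_lessD Un_iff set_append)
  qed
  note hyps = distinct_input_gates[of C] A0 D A_Suc
  define S where "S = (\<lambda>i. hd (D i)) ` {..<length ks}"
  have sound: "j \<in> inputs C \<and> b = (j \<in> S)" if "e \<in> it ` {..<?n}" "(j, b) \<in> set (gap_facts e)" for e j b
  proof -
    obtain i where "i < ?n" "e = (i, A i, D i)" using \<open>e \<in> it ` {..<?n}\<close> it_eq by auto
    then show ?thesis
      using chain_sound[of ?P A ks D i j b, OF hyps] that(2) by (simp add: S_def set_input_gates)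
  qed
  have complete: "\<exists>e \<in> it ` {..<?n}. (j, j \<in> S) \<in> set (gap_facts e)" if j: "j \<in> inputs C" for j
  proof -
    obtain i where "i < ?n" "(j, j \<in> S) \<in> set (gap_facts (i, A i, D i))"
      using chain_complete[of ?P A ks D j, OF hyps] j by (auto simp: S_def set_input_gates)
    then show ?thesis using it_eq by (metis imageI lessThan_iff)
  qed
  have "card S = length ks"
    unfolding S_def using hyps by (rule card_chain)
  moreover have "S \<subseteq> inputs C"
  proof
    fix j assume "j \<in> S"
    then obtain i where i: "i < length ks" "j = hd (D i)" by (auto simp: S_def)
    then have "(j, True) \<in> set (gap_facts (it i))"
      using D(2)[of i] it_eq[of i] by (cases "D i") (auto simp: gap_facts_def)
    then show "j \<in> inputs C" using sound[of "it i" j True] i(1) by simp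
  qed
  moreover have "gate_val C S (circuit_out C)"
  proof -
    have "\<exists>w. set w \<subseteq> it ` {..<?n} \<and> length w \<le> 2 ^ gate_depth C (circuit_out C) \<and>
      (\<forall>X b. set w \<subseteq> set X \<longrightarrow> set X \<subseteq> it ` {..<?n} \<longrightarrow>
        ((circuit_out C, b) \<in> set (known (concat (map gap_facts X)) C) \<longleftrightarrow> b = gate_val C S (circuit_out C)))"
      by (rule known_complete) (fact circ(1) out circ(2) | erule (1) sound | erule complete)+
    then obtain w' where w': "set w' \<subseteq> it ` {..<?n}" "length w' \<le> 2 ^ gate_depth C (circuit_out C)"
      "\<And>X b. set w' \<subseteq> set X \<Longrightarrow> set X \<subseteq> it ` {..<?n} \<Longrightarrow>
        (circuit_out C, b) \<in> set (known (concat (map gap_facts X)) C) \<longleftrightarrow> b = gate_val C S (circuit_out C)"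
      by blast
    have "length w' \<le> R"
      using w'(2) circ(3) unfolding R by (elim order_trans) (intro power_increasing, simp_all)
    define w'' where "w'' = w' @ replicate (R - length w') (it 0)"
    have w'': "set w'' \<subseteq> it ` {..<?n}" "length w'' = R" "set w' \<subseteq> set w''"
      using w'(1) \<open>length w' \<le> R\<close> by (auto simp: w''_def)
    have e: "e = it (fst e)" "fst e < ?n" if "e \<in> set w''" for e
      using w''(1) that it(2) by auto
    have "set (map fst w'') \<subseteq> {..<?n}" using e(2) unfolding set_map by blast
    moreover have "length (map fst w'') = R" using w''(2) by simp
    ultimately obtain \<sigma> where \<sigma>: "\<sigma> \<in> T" "?J \<sigma> = map fst w''"
      using ex by blast
    \<comment> \<open>The vertex was found by the indices of \<open>w''\<close> only; consistency
      identifies its items with those of \<open>w''\<close>.\<close>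
    have "fst \<sigma> = map it (?J \<sigma>)"
      using \<rho>_it[OF \<sigma>(1)] by (simp add: map_idI)
    also have "\<dots> = w''"
      unfolding \<sigma>(2) using e(1) by (simp add: map_idI)
    finally have "accepts C (w'' @ w)"
      using real(4)[OF \<sigma>(1)] w[OF \<sigma>(1)] by simp
    moreover have "set (w'' @ w) \<subseteq> it ` {..<?n}"
    proof -
      have "set w \<subseteq> it ` {..<?n}" using w_it by (metis imageI lessThan_iff subsetI)
      then show ?thesis using w''(1) by simp
    qed
    moreover have "circuit_out C = length (tl C)" by (simp add: circuit_out_def)
    ultimately show ?thesis
      using w'(3)[of "w'' @ w" True] w''(3) unfolding accepts_def by auto
  qed
  ultimately show ?thesis by blast
qed

section \<open>The reduction\<close>

text \<open>Index access is avoided: along \<open>tails L\<close>, \<open>take 1 M\<close> holds the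
  current vertex and \<open>M\<close> the vertices from it on, which the last entry of its row
  counts.\<close>

definition cost_rows :: "vertex list \<Rightarrow> nat list list" where
  "cost_rows L = concat (map (\<lambda>M. map (\<lambda>\<sigma>. map (\<lambda>\<tau>. if adjacent \<sigma> \<tau> then 1 else 0) L
    @ [length (filter (adjacent \<sigma>) M)]) (take 1 M)) (tails L))"

text \<open>One entry per edge, loops included; the length is the number of edges, which enters the
  budget.\<close>

definition edges :: "vertex list \<Rightarrow> vertex list" where
  "edges L = concat (map (\<lambda>M. concat (map (\<lambda>\<sigma>. filter (adjacent \<sigma>) M) (take 1 M))) (tails L))"

text \<open>The nested tuple is built to have the same tree as \<open>enc_bribery_inst\<close>.
  \<open>Q\<close> stands for the clique size, its length; dropping
  \<open>length (concat (tails Q))\<close> edges performs the subtraction in the budget.\<close>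

definition clique_inst :: "vertex list \<Rightarrow> nat list list \<Rightarrow> nat \<times> nat list list \<times> nat \<times> nat list list list \<times> nat" where
  "clique_inst L Q = (Suc (length L), [rev [0..<length L] @ [length L]], length L,
    [cost_rows L @ [map (\<lambda>_. 0) (0 # [0..<length L])]],
    length (drop (length (concat (tails Q))) (edges L)))"

lemma concat_map_take1_tails:
  "concat (map (\<lambda>M. map (\<lambda>\<sigma>. f \<sigma> M) (take 1 M)) (tails L)) = map (\<lambda>i. f (L ! i) (drop i L)) [0..<length L]"
proof (induction L)
  case (Cons x L)
  have "[0..<length (x # L)] = 0 # map Suc [0..<length L]"
    by (simp add: map_Suc_upt upt_conv_Cons del: upt_Suc)
  then show ?case using Cons by (simp add: comp_def)
qed simp

lemma length_filter_drop:
  "b \<le> length L \<Longrightarrow> length (filter P (drop b L)) = card {a. b \<le> a \<and> a < length L \<and> P (L ! a)}"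
proof -
  assume b: "b \<le> length L"
  have "length (filter P (drop b L)) = card {i. i < length L - b \<and> P (L ! (b + i))}"
    using b by (simp add: length_filter_conv_card nth_drop cong: conj_cong)
  also have "\<dots> = card ((\<lambda>i. b + i) ` {i. i < length L - b \<and> P (L ! (b + i))})"
    by (simp add: card_image)
  also have "(\<lambda>i. b + i) ` {i. i < length L - b \<and> P (L ! (b + i))} = {a. b \<le> a \<and> a < length L \<and> P (L ! a)}"
  proof (intro equalityI subsetI)
    fix a assume "a \<in> {a. b \<le> a \<and> a < length L \<and> P (L ! a)}"
    then show "a \<in> (\<lambda>i. b + i) ` {i. i < length L - b \<and> P (L ! (b + i))}"
      by (intro image_eqI[of _ _ "a - b"]) auto
  qed auto
  finally show ?thesis .
qed

lemma length_concat_tails: "length (concat (tails Q)) = \<Sum>{..length Q}"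
  by (induction Q) simp_all

lemma encode_clique_inst:
  "encode (clique_inst L Q) =
    enc_bribery_inst (graph_inst (length L) (\<lambda>a b. adjacent (L ! a) (L ! b)) (length Q))"
proof -
  let ?d = "\<lambda>b. card {a. b \<le> a \<and> a < length L \<and> adjacent (L ! b) (L ! a)}"
  have "cost_rows L = map (\<lambda>b. map (\<lambda>a. of_bool (adjacent (L ! b) (L ! a))) [0..<length L] @ [?d b]) [0..<length L]"
    unfolding cost_rows_def concat_map_take1_tails
  proof (intro map_cong refl)
    fix b assume "b \<in> set [0..<length L]"
    then have "length (filter (adjacent (L ! b)) (drop b L)) = ?d b"
      by (intro length_filter_drop) simp
    moreover have "map (\<lambda>\<tau>. if adjacent (L ! b) \<tau> then 1 else 0 :: nat) L =
      map (\<lambda>a. of_bool (adjacent (L ! b) (L ! a))) [0..<length L]"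
      by (rule nth_equalityI) auto
    ultimately show "map (\<lambda>\<tau>. if adjacent (L ! b) \<tau> then 1 else 0) L @ [length (filter (adjacent (L ! b)) (drop b L))] =
      map (\<lambda>a. of_bool (adjacent (L ! b) (L ! a))) [0..<length L] @ [?d b]" by simp
  qed
  moreover have "map (\<lambda>_. 0 :: nat) (0 # [0..<length L]) = replicate (Suc (length L)) 0"
    by (simp add: map_replicate_const)
  moreover have "length (drop (length (concat (tails Q))) (edges L)) = (\<Sum>b<length L. ?d b) - \<Sum>{..length Q}"
  proof -
    have eq: "edges L = concat (map (\<lambda>b. filter (adjacent (L ! b)) (drop b L)) [0..<length L])"
    proof -
      have "concat (map concat xsss) = concat (concat xsss)" for xsss :: "vertex list list list"
        by (induction xsss) auto
      moreover have "edges L = concat (map concat (map (\<lambda>M. map (\<lambda>\<sigma>. filter (adjacent \<sigma>) M) (take 1 M)) (tails L)))"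
        by (simp add: edges_def comp_def)
      ultimately have "edges L = concat (concat (map (\<lambda>M. map (\<lambda>\<sigma>. filter (adjacent \<sigma>) M) (take 1 M)) (tails L)))"
        by (simp only:)
      then show ?thesis unfolding concat_map_take1_tails .
    qed
    have "length (edges L) = (\<Sum>b\<leftarrow>[0..<length L]. length (filter (adjacent (L ! b)) (drop b L)))"
      unfolding eq by (simp add: length_concat comp_def)
    also have "\<dots> = (\<Sum>b<length L. length (filter (adjacent (L ! b)) (drop b L)))"
      by (simp add: sum_list_distinct_conv_sum_set lessThan_atLeast0)
    also have "\<dots> = (\<Sum>b<length L. ?d b)"
      by (intro sum.cong refl length_filter_drop) simp
    finally show ?thesis by (simp add: length_concat_tails)
  qed
  ultimately show ?thesis
    unfolding clique_inst_def enc_bribery_inst_def graph_inst_def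
    by (simp add: encode_nat_def encode_list_def)
qed

subsection \<open>Running time\<close>

lemma ptime_comp2:
  assumes "ptime (\<lambda>p. f (fst p) (snd p))" "ptime a" "ptime b"
  shows "ptime (\<lambda>x. f (a x) (b x))"
  using ptime_comp[OF assms(1) ptime_Pair[OF assms(2,3)]] by simp

lemma ptime_comp3:
  assumes "ptime (\<lambda>p. f (fst p) (fst (snd p)) (snd (snd p)))" "ptime a" "ptime b" "ptime c"
  shows "ptime (\<lambda>x. f (a x) (b x) (c x))"
  using ptime_comp[OF assms(1) ptime_Pair[OF assms(2) ptime_Pair[OF assms(3,4)]]] by simp

lemmas ptime_intros = ptime_const ptime_id ptime_fst ptime_snd ptime_Pair ptime_Cons ptime_tl
  ptime_if ptime_not ptime_conj ptime_disj ptime_imp ptime_eq ptime_rev ptime_append ptime_map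
  ptime_concat ptime_filter ptime_Bex ptime_Ball ptime_member ptime_take1 ptime_n_lists ptime_tails
  ptime_drop_length ptime_Suc ptime_length ptime_enumerate ptime_upt

lemma ptime_product: "ptime a \<Longrightarrow> ptime b \<Longrightarrow> ptime (\<lambda>x. List.product (a x) (b x))"
proof (rule ptime_comp2[where f = List.product])
  have "ptime (\<lambda>p :: 'b list \<times> 'c list. concat (map (\<lambda>x. map (\<lambda>y. (x, y)) (snd p)) (fst p)))"
    by (intro ptime_intros)
  then show "ptime (\<lambda>p :: 'b list \<times> 'c list. List.product (fst p) (snd p))"
    by (simp add: product_concat_map)
qed

lemma ptime_gate_tag: "ptime g \<Longrightarrow> ptime (\<lambda>x. gate_tag (g x))"
proof (rule ptime_comp[of gate_tag], rule ptime_expr[of "Hd (Var 0)"])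
  fix g and s :: "nat \<Rightarrow> tree" assume "s 0 = encode (g :: gate)"
  then show "expr_val (Hd (Var 0)) s = encode (gate_tag g)"
    by (cases g) (simp_all add: encode_gate_def encode_nat_def)
qed

lemma ptime_wires: "ptime g \<Longrightarrow> ptime (\<lambda>x. wires (g x))"
proof (rule ptime_comp[of wires])
  let ?tl = "\<lambda>t. case t of Leaf \<Rightarrow> Leaf | Node l r \<Rightarrow> r"
  have "ptime ?tl"
    by (rule ptime_expr[of "Tl (Var 0)"]) simp
  moreover have "ptime (\<lambda>g :: gate. encode g)"
    by (simp add: ptime_encode ptime_id)
  ultimately have tl: "ptime (\<lambda>g :: gate. ?tl (encode g))"
    by (rule ptime_comp)
  \<comment> \<open>A negation stores its argument as a bare number, which has to be wrapped into a
    list.\<close>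
  have "ptime (\<lambda>g :: gate. encode [?tl (encode g)])"
    unfolding ptime_encode by (intro ptime_intros tl)
  then have "ptime (\<lambda>g. if gate_tag g = 0 then Leaf else
      if gate_tag g = 1 then encode [?tl (encode g)] else ?tl (encode g))"
    by (intro ptime_if ptime_eq ptime_gate_tag ptime_id ptime_const tl)
  then show "ptime wires"
  proof (rule ptime_same_encode[rotated])
    show "encode (if gate_tag g = 0 then Leaf else
      if gate_tag g = 1 then encode [?tl (encode g)] else ?tl (encode g)) = encode (wires g)" for g
      by (cases g) (simp_all add: encode_gate_def encode_nat_def encode_list_def)
  qed
qed

lemma ptime_gate_facts: "ptime a \<Longrightarrow> ptime b \<Longrightarrow> ptime (\<lambda>x. gate_facts (a x) (b x))"
  by (rule ptime_comp2[where f = gate_facts])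
    (unfold gate_facts_def evaluable_def gate_out_def, intro ptime_intros ptime_wires ptime_gate_tag)

lemma ptime_known: "ptime a \<Longrightarrow> ptime b \<Longrightarrow> ptime (\<lambda>x. known (a x) (b x))"
proof (rule ptime_comp2[where f = known])
  \<comment> \<open>Each gate adds at most one fact, whose position is below the length of the
    circuit, so the accumulator grows at most quadratically.\<close>
  have size: "esize (known F (take i C)) \<le> esize F + i * (4 * length C + 8)" if "i \<le> length C" for F C i
    using that
  proof (induction i)
    case (Suc i)
    have "esize (b :: bool) \<le> 3" for b by (cases b) auto
    from this[of "gate_out (C ! i) (set (known F (take i C)))"]
    have "esize (gate_facts (i, C ! i) (known F (take i C)) @ known F (take i C)) \<le> esize (known F (take i C)) + (4 * i + 6)"
      using esize_nat[of i] by (simp add: gate_facts_def)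
    then show ?case using Suc by (simp add: known_take_Suc)
  qed (simp add: known_def)
  have take: "take i (List.enumerate 0 C) = List.enumerate 0 (take i C)" if "i \<le> length C" for i and C :: "gate list"
    using that by (intro nth_equalityI) (auto simp: nth_enumerate_eq)
  show "ptime (\<lambda>p. known (fst p) (snd p))"
    unfolding known_def
  proof (rule ptime_foldl[where B = "\<lambda>p. esize (fst p) + length (snd p) * (4 * length (snd p) + 8)"])
    fix p :: "(nat \<times> bool) list \<times> gate list" and i
    assume "i \<le> length (List.enumerate 0 (snd p))"
    then have i: "i \<le> length (snd p)" by simp
    then have "i * (4 * length (snd p) + 8) \<le> length (snd p) * (4 * length (snd p) + 8)"
      by (rule mult_le_mono1)
    then show "esize (foldl (\<lambda>K p. gate_facts p K @ K) (fst p) (take i (List.enumerate 0 (snd p))))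
      \<le> esize (fst p) + length (snd p) * (4 * length (snd p) + 8)"
      using size[OF i, of "fst p"] unfolding take[OF i] known_def by linarith
  qed (intro ptime_intros ptime_gate_facts poly_bounded_add poly_bounded_mult poly_bounded_const
      poly_bounded_length poly_bounded_esize)+
qed

lemma ptime_consistent: "ptime a \<Longrightarrow> ptime (\<lambda>x. consistent (a x))"
  by (rule ptime_comp[of consistent]) (unfold consistent_def, intro ptime_intros)

lemma ptime_gap_facts: "ptime a \<Longrightarrow> ptime (\<lambda>x. gap_facts (a x))"
  by (rule ptime_comp[of gap_facts]) (unfold gap_facts_def, intro ptime_intros)

lemma ptime_accepts: "ptime a \<Longrightarrow> ptime b \<Longrightarrow> ptime (\<lambda>x. accepts (a x) (b x))"
  by (rule ptime_comp2[where f = accepts])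
    (unfold accepts_def, intro ptime_intros ptime_known ptime_gap_facts)

lemma ptime_adjacent: "ptime a \<Longrightarrow> ptime b \<Longrightarrow> ptime (\<lambda>x. adjacent (a x) (b x))"
  by (rule ptime_comp2[where f = adjacent])
    (unfold adjacent_def, intro ptime_intros ptime_consistent)

lemma ptime_input_gates: "ptime a \<Longrightarrow> ptime (\<lambda>x. input_gates (a x))"
  by (rule ptime_comp[of input_gates]) (unfold input_gates_def, intro ptime_intros)

lemma ptime_valid_gap:
  "ptime a \<Longrightarrow> ptime b \<Longrightarrow> ptime c \<Longrightarrow> ptime (\<lambda>x. valid_gap (a x) (b x) (c x))"
  by (rule ptime_comp3[where f = valid_gap]) (unfold valid_gap_def, intro ptime_intros)

lemma ptime_gaps: "ptime gaps"
  unfolding gaps_def by (intro ptime_intros ptime_valid_gap ptime_product ptime_input_gates)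

lemma ptime_vertices: "ptime (vertices R)"
proof -
  have gaps: "ptime (\<lambda>z. gaps z)" by (rule ptime_gaps)
  show ?thesis
    unfolding vertices_def dummies_def
    by (intro ptime_intros ptime_product ptime_consistent ptime_accepts gaps)
qed

lemma ptime_clique_inst: "ptime a \<Longrightarrow> ptime b \<Longrightarrow> ptime (\<lambda>x. clique_inst (a x) (b x))"
  by (rule ptime_comp2[where f = clique_inst])
    (unfold clique_inst_def cost_rows_def edges_def, intro ptime_intros ptime_adjacent)

subsection \<open>Correctness\<close>

lemma adjacent_refl: "adjacent \<sigma> \<sigma>"
  by (simp add: adjacent_def)

lemma sum_atMost_le_square: "\<Sum>{..q :: nat} \<le> q * q"
proof -
  have "{..q} = insert 0 {1..q}" by auto
  then have "\<Sum>{..q} = \<Sum>{1..q}" by simp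
  also have "\<dots> \<le> card {1..q} * q" by (intro sum_bounded_above[of _ _ q, simplified]) auto
  finally show ?thesis by simp
qed

text \<open>The bribery instance speaks about positions in \<open>L\<close>; as \<open>L\<close> is
  distinct, cliques of positions and of vertices correspond.\<close>

lemma approval_bribable_iff_clique:
  fixes C :: "gate list" and ks :: "unit list"
  assumes "0 < R"
  defines "L \<equiv> vertices R (C, ks)" and "q \<equiv> (length ks + 2) ^ R"
  shows "approval_bribable (Suc q) (graph_inst (length L) (\<lambda>a b. adjacent (L ! a) (L ! b)) q) \<longleftrightarrow>
    (\<exists>T \<subseteq> set L. card T = q \<and> (\<forall>\<sigma> \<in> T. \<forall>\<tau> \<in> T. adjacent \<sigma> \<tau>))"
proof -
  let ?W = "\<lambda>a b. adjacent (L ! a) (L ! b)"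
  \<comment> \<open>The tuples of the dummies have length \<open>2 * R\<close> to make their number
    the square of \<open>q\<close>.\<close>
  have "length (dummies R ks) = q * q"
    by (simp add: dummies_def length_n_lists q_def power_mult power2_eq_square flip: power_mult_distrib power_add)
  then have len: "q * q \<le> length L"
    by (simp add: L_def vertices_def)
  have "0 < q" by (simp add: q_def)
  then have "q \<le> length L" using len le_trans[of q "q * q"] by simp
  \<comment> \<open>The loops alone already provide enough edges, one for each vertex.\<close>
  have "\<Sum>{..q} \<le> (\<Sum>b<length L. 1)" using sum_atMost_le_square[of q] len by simp
  also have "\<dots> \<le> (\<Sum>b<length L. card {a. b \<le> a \<and> a < length L \<and> ?W b a})"
  proof (rule sum_mono)
    fix b assume "b \<in> {..<length L}"
    then have "b \<in> {a. b \<le> a \<and> a < length L \<and> ?W b a}" by (simp add: adjacent_refl)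
    moreover have "finite {a. b \<le> a \<and> a < length L \<and> ?W b a}" by simp
    ultimately show "1 \<le> card {a. b \<le> a \<and> a < length L \<and> ?W b a}"
      using card_mono[of "{a. b \<le> a \<and> a < length L \<and> ?W b a}" "{b}"] by simp
  qed
  finally have "approval_bribable (Suc q) (graph_inst (length L) ?W q) \<longleftrightarrow>
    (\<exists>T \<subseteq> {..<length L}. card T = q \<and> (\<forall>a \<in> T. \<forall>b \<in> T. ?W a b))"
    using \<open>q \<le> length L\<close>
    by (intro approval_bribable_graph_inst) (auto intro: adjacent_sym adjacent_refl)
  also have "\<dots> \<longleftrightarrow> (\<exists>T \<subseteq> set L. card T = q \<and> (\<forall>\<sigma> \<in> T. \<forall>\<tau> \<in> T. adjacent \<sigma> \<tau>))"
  proof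
    assume "\<exists>T \<subseteq> {..<length L}. card T = q \<and> (\<forall>a \<in> T. \<forall>b \<in> T. ?W a b)"
    then obtain T where T: "T \<subseteq> {..<length L}" "card T = q" "\<forall>a \<in> T. \<forall>b \<in> T. ?W a b" by blast
    have "inj_on ((!) L) T"
      using T(1) distinct_vertices[OF assms(1), of "(C, ks)"] by (auto intro!: inj_on_nth simp: L_def)
    then show "\<exists>T \<subseteq> set L. card T = q \<and> (\<forall>\<sigma> \<in> T. \<forall>\<tau> \<in> T. adjacent \<sigma> \<tau>)"
      using T by (intro exI[of _ "(!) L ` T"]) (auto simp: card_image)
  next
    assume "\<exists>T \<subseteq> set L. card T = q \<and> (\<forall>\<sigma> \<in> T. \<forall>\<tau> \<in> T. adjacent \<sigma> \<tau>)"
    then obtain T where T: "T \<subseteq> set L" "card T = q" "\<forall>\<sigma> \<in> T. \<forall>\<tau> \<in> T. adjacent \<sigma> \<tau>" by blast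
    let ?T = "{i. i < length L \<and> L ! i \<in> T}"
    have "inj_on ((!) L) ?T"
      using distinct_vertices[OF assms(1), of "(C, ks)"] by (auto intro!: inj_on_nth simp: L_def)
    moreover have "(!) L ` ?T = T"
      using T(1) by (auto simp: image_iff in_set_conv_nth subset_iff) metis
    ultimately have "card ?T = q" using T(2) card_image by fastforce
    then show "\<exists>T \<subseteq> {..<length L}. card T = q \<and> (\<forall>a \<in> T. \<forall>b \<in> T. ?W a b)"
      using T(3) by (intro exI[of _ ?T]) auto
  qed
  finally show ?thesis .
qed

lemma weighted_circuit_sat_reducible:
  "weighted_circuit_sat 1 h \<le>fpt approval_swap_bribery (\<lambda>I. length (votes I) = 1)"
proof -
  define R :: nat where "R = 2 ^ h"
  have "0 < R" by (simp add: R_def)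
  \<comment> \<open>The list of all index tuples represents the clique size
    \<open>(k + 2) ^ R\<close>, which is thus obtained without exponentiation of numbers.\<close>
  let ?Q = "\<lambda>ks :: unit list. List.n_lists R [0..<length (() # () # ks)]"
  show ?thesis
  proof (rule fpt_reducible_ptime)
    show "ptime (\<lambda>z. (clique_inst (vertices R z) (?Q (snd z)), Suc (length (?Q (snd z)))))"
    proof -
      have "ptime (\<lambda>z. vertices R z)" by (rule ptime_vertices)
      then show ?thesis by (intro ptime_intros ptime_clique_inst)
    qed
    show "ptime (\<lambda>ks. Suc (length (?Q ks)))"
      by (intro ptime_intros)
    fix x k assume "(x, k) \<in> insts (weighted_circuit_sat 1 h)"
    then obtain C where C: "C \<in> circuits 1 h" "x = encode C"
      by (auto simp: weighted_circuit_sat_def encode_list_def encode_gate_def[abs_def])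
    let ?ks = "replicate k ()"
    let ?L = "vertices R (C, ?ks)" and ?q = "(length ?ks + 2) ^ R"
    let ?I = "graph_inst (length ?L) (\<lambda>a b. adjacent (?L ! a) (?L ! b)) ?q"
    have Q: "length (?Q ?ks) = ?q" by (simp add: length_n_lists del: upt_Suc)
    have enc: "encode (clique_inst ?L (?Q ?ks)) = enc_bribery_inst ?I"
      unfolding encode_clique_inst Q ..
    have I: "valid_inst ?I" "length (votes ?I) = 1"
      by (rule valid_graph_inst) (simp add: graph_inst_def)
    have "(x, k) \<in> yes_insts (weighted_circuit_sat 1 h) \<longleftrightarrow>
      (\<exists>S \<subseteq> inputs C. card S = length ?ks \<and> gate_val C S (circuit_out C))"
      using C by (auto simp: weighted_circuit_sat_def encode_list_def encode_gate_def[abs_def]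
          enc_list_inject enc_gate_inject)
    also have "\<dots> \<longleftrightarrow> (\<exists>T \<subseteq> set ?L. card T = ?q \<and> (\<forall>\<sigma> \<in> T. \<forall>\<tau> \<in> T. adjacent \<sigma> \<tau>))"
    proof
      assume "\<exists>S \<subseteq> inputs C. card S = length ?ks \<and> gate_val C S (circuit_out C)"
      then show "\<exists>T \<subseteq> set ?L. card T = ?q \<and> (\<forall>\<sigma> \<in> T. \<forall>\<tau> \<in> T. adjacent \<sigma> \<tau>)"
        by (elim exE conjE) (rule clique_if_satisfiable[OF C(1) R_def])
    next
      assume "\<exists>T \<subseteq> set ?L. card T = ?q \<and> (\<forall>\<sigma> \<in> T. \<forall>\<tau> \<in> T. adjacent \<sigma> \<tau>)"
      then obtain T where "T \<subseteq> set ?L" "card T = ?q" "\<forall>\<sigma> \<in> T. \<forall>\<tau> \<in> T. adjacent \<sigma> \<tau>"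
        by (elim exE conjE) rule
      then show "\<exists>S \<subseteq> inputs C. card S = length ?ks \<and> gate_val C S (circuit_out C)"
        by (intro satisfiable_if_clique[where T = T, OF C(1) R_def]) auto
    qed
    also have "\<dots> \<longleftrightarrow> approval_bribable (Suc ?q) ?I"
      by (rule approval_bribable_iff_clique[OF \<open>0 < R\<close>, symmetric])
    also have "\<dots> \<longleftrightarrow> (encode (clique_inst ?L (?Q ?ks)), Suc (length (?Q ?ks)))
      \<in> yes_insts (approval_swap_bribery (\<lambda>I. length (votes I) = 1))"
      using I unfolding enc Q by (auto simp: approval_swap_bribery_def enc_bribery_inst_inject)
    finally have "(x, k) \<in> yes_insts (weighted_circuit_sat 1 h) \<longleftrightarrow>
      (encode (clique_inst ?L (?Q ?ks)), Suc (length (?Q ?ks)))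
        \<in> yes_insts (approval_swap_bribery (\<lambda>I. length (votes I) = 1))" .
    moreover have "(encode (clique_inst ?L (?Q ?ks)), Suc (length (?Q ?ks)))
        \<in> insts (approval_swap_bribery (\<lambda>I. length (votes I) = 1))"
      using I unfolding enc Q by (auto simp: approval_swap_bribery_def)
    ultimately show "\<exists>X Y. x = encode X \<and>
      (clique_inst (vertices R (X, ?ks)) (?Q (snd (X, ?ks))), Suc (length (?Q (snd (X, ?ks))))) = (Y, Suc (length (?Q ?ks))) \<and>
      (encode Y, Suc (length (?Q ?ks))) \<in> insts (approval_swap_bribery (\<lambda>I. length (votes I) = 1)) \<and>
      ((x, k) \<in> yes_insts (weighted_circuit_sat 1 h) \<longleftrightarrow>
        (encode Y, Suc (length (?Q ?ks))) \<in> yes_insts (approval_swap_bribery (\<lambda>I. length (votes I) = 1)))"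
      using C(2) by (intro exI[of _ C] exI[of _ "clique_inst ?L (?Q ?ks)"]) simp
  qed
qed

theorem theorem7:
  shows "W1_hard (approval_swap_bribery (\<lambda>I. length (votes I) = 1))"
  unfolding W1_hard_def W_class_def
  using fpt_reducible_trans weighted_circuit_sat_reducible by blast

end
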